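(* Assume that: (i) $\rho$ is lower semicontinuous and bounded on $(\mathbb R^d\cup\{x_{\mathrm{init}}\})\times\mathbb R^d$; (ii) $\mathrm{Leb}(\partial C)=0$, where $C=\bigcup_{j\in\mathcal J}C_j$ is the union of the communicating classes; (iii) for every $\mu\in\mathcal P(\mathbb R^d)$ with $\mu(C)<1$ there is a neighborhood $V$ of $\mu$ in the weak topology such that $\lim_{n\to\infty}\frac1n\log\mathbb P(L_n\in V)=-\infty$. Then $(L_n)_{n\ge1}$ satisfies the weak large deviation principle in $\mathcal P(\mathbb R^d)$ (weak topology) with a lower semicontinuous rate function $I:\mathcal P(\mathbb R^d)\to[0,\infty]$ satisfying, with $\mathcal A$ the set of admissible measures and the convention $0\cdot\infty=0$: 1. if $\mu\notin\mathcal A$, then $I(\mu)=\infty$; 2. if $\mu_1,\mu_2\in\mathcal A$ and $\lambda\in[0,1]$ are such that $\lambda\mu_1+(1-\lambda)\mu_2\in\mathcal A$, then $I(\lambda\mu_1+(1-\lambda)\mu_2)\le\lambda I(\mu_1)+(1-\lambda)I(\mu_2)$; 3. if $\mu_1,\mu_2\in\mathcal A$ and $\lambda\in[0,1]$ are such that $\lambda\mu_1+(1-\lambda)\mu_2\in\mathcal A$, and if no class $C_j$ satisfies $\mu_1(C_j)\mu_2(C_j)>0$, then $I(\lambda\mu_1+(1-\lambda)\mu_2)=\lambda I(\mu_1)+(1-\lambda)I(\mu_2)$.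
   Context: Setting. Let $d\ge1$, $\mathrm{Leb}$ the Lebesgue measure on $\mathbb R^d$, and $\mathcal P(\mathbb R^d)$ the set of Borel probability measures with the weak topology. Let $\beta\in\mathcal P(\mathbb R^d)$ and let $p$ be a stochastic kernel on $\mathbb R^d$. Adjoin an extra point $x_{\mathrm{init}}\notin\mathbb R^d$ (an isolated point of $\mathbb R^d\cup\{x_{\mathrm{init}}\}$) and put $p(x_{\mathrm{init}},\cdot)=\beta$. Standing assumption: $p(x,\cdot)\ll\mathrm{Leb}$ for every $x\in\mathbb R^d\cup\{x_{\mathrm{init}}\}$; fix a jointly measurable density $\rho:(\mathbb R^d\cup\{x_{\mathrm{init}}\})\times\mathbb R^d\to[0,\infty)$, so $p(x,A)=\int_A\rho(x,y)\,\mathrm{Leb}(dy)$. $(X_n)_{n\ge1}$ is the Markov chain with $X_1\sim\beta$ and kernel $p$, with law $\mathbb P$, and $L_n=\frac1n\sum_{i=1}^n\delta_{X_i}$. Iterates. $\rho^1=\rho$, $\rho^{k+1}(x,y)=\int_{\mathbb R^d}\rho^k(x,z)\rho(z,y)\,\mathrm{Leb}(dz)$, $\tilde\rho=\sum_{k\ge1}2^{-k}\rho^k$, $\tilde p(x,A)=\int_A\tilde\rho(x,y)\,\mathrm{Leb}(dy)$. Communicating classes. A communicating class is a maximal nonempty set $A\subseteq\mathbb R^d$ such that $\tilde\rho(x,y)>0$ for all $x,y\in A$. The family of all classes is $(C_j)_{j\in\mathcal J}$, and $C=\bigcup_{j\in\mathcal J}C_j$. For $j_1,j_2\in\mathcal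 J$, $j_1\leadsto j_2$ means $\tilde p(x,C_{j_2})>0$ for all $x\in C_{j_1}$; and $\beta\leadsto j$ means $\tilde p(x_{\mathrm{init}},C_j)>0$. (Under (i) the classes are open, pairwise disjoint and at most countably many, and $\leadsto$ is a partial order on $\mathcal J$.) Admissible measures. $\mu\in\mathcal P(\mathbb R^d)$ is admissible if: $\mu\ll\mathrm{Leb}$; $\operatorname{supp}\mu\subseteq\overline C$; $\beta\leadsto j$ for every $j\in\mathcal J$ with $\mu(C_j)>0$; and $\leadsto$ is a total order on $\{j\in\mathcal J:\mu(C_j)>0\}$. $\mathcal A$ is the set of admissible measures. Weak LDP. $(L_n)$ satisfies the weak LDP with lower semicontinuous rate function $I$ if $\liminf_n\frac1n\log\mathbb P(L_n\in O)\ge-\inf_OI$ for all open $O\subseteq\mathcal P(\mathbb R^d)$ and $\limsup_n\frac1n\log\mathbb P(L_n\in F)\le-\inf_FI$ for all compact $F\subseteq\mathcal P(\mathbb R^d)$. *)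

theory Defs
  imports "HOL-Probability.Probability"
begin

section \<open>The state space with an additional isolated point\<close>

text \<open>The space \<open>\<real>\<^sup>d \<union> {x_init}\<close> is \<open>'a option\<close> with \<open>'a :: euclidean_space\<close>; \<open>None\<close> is the
  additional point. Lower semicontinuity and measurability of a function on
  \<open>'a option \<times> 'a\<close> refer to this topology.\<close>

instantiation option :: (topological_space) topological_space
begin

definition open_option :: "'a option set \<Rightarrow> bool" where
  "open_option U \<longleftrightarrow> open (Some -` U)"

instance
proof
  fix K :: "'a option set set"
  assume "\<forall>S\<in>K. open S"
  then have "open (\<Union>S\<in>K. Some -` S)"
    by (auto simp: open_option_def)
  then show "open (\<Union> K)"
    by (simp add: open_option_def vimage_Union)
qed (auto simp: open_option_def)

end

lemma open_None: "open {None :: 'a::topological_space option}"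
  by (auto simp: open_option_def vimage_def)

lemma open_image_Some: "open (Some ` S) \<longleftrightarrow> open S"
proof -
  have "Some -` Some ` S = S"
    by auto
  then show ?thesis
    by (simp add: open_option_def)
qed

definition lsc :: "('b::topological_space \<Rightarrow> real) \<Rightarrow> bool" where
  "lsc f \<longleftrightarrow> (\<forall>a. open {x. f x > a})"

section \<open>Probability measures and the weak topology\<close>

abbreviation prob_measures :: "'a::topological_space measure set" where
  "prob_measures \<equiv> space (prob_algebra borel)"

definition weak_topology :: "'a::topological_space measure topology" where
  "weak_topology = topology_generated_by
     {{\<mu> \<in> prob_measures. (\<integral>x. f x \<partial>\<mu>) \<in> U} | (f :: 'a \<Rightarrow> real) U.
        continuous_on UNIV f \<and> bounded (range f) \<and> open U}"

lemma topspace_weak_topology: "topspace weak_topology = prob_measures"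
proof -
  have "\<exists>(f :: 'a \<Rightarrow> real) U. prob_measures = {\<mu> \<in> prob_measures. (\<integral>x. f x \<partial>\<mu>) \<in> U} \<and>
      continuous_on UNIV f \<and> bounded (range f) \<and> open U"
    by (rule exI[of _ "\<lambda>_. 0"], rule exI[of _ UNIV]) auto
  then show ?thesis
    unfolding weak_topology_def topology_generated_by_topspace by blast
qed

definition measure_support :: "'a::topological_space measure \<Rightarrow> 'a set" where
  "measure_support \<mu> = {x. \<forall>U. open U \<longrightarrow> x \<in> U \<longrightarrow> emeasure \<mu> U > 0}"

text \<open>The convex combination \<open>t \<mu> + (1 - t) \<nu>\<close>.\<close>

definition mixture :: "real \<Rightarrow> 'a::topological_space measure \<Rightarrow> 'a measure \<Rightarrow> 'a measure" where
  "mixture t \<mu> \<nu> = measure_of UNIV (sets borel)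
     (\<lambda>A. ennreal t * emeasure \<mu> A + ennreal (1 - t) * emeasure \<nu> A)"

lemma emeasure_mixture:
  assumes "\<mu> \<in> prob_measures" "\<nu> \<in> prob_measures" "A \<in> sets borel"
  shows "emeasure (mixture t \<mu> \<nu>) A = ennreal t * emeasure \<mu> A + ennreal (1 - t) * emeasure \<nu> A"
proof (rule emeasure_measure_of[OF mixture_def])
  have s: "sets \<mu> = sets borel" "sets \<nu> = sets borel"
    using assms by (auto simp: space_prob_algebra)
  show "countably_additive (sets (mixture t \<mu> \<nu>))
      (\<lambda>A. ennreal t * emeasure \<mu> A + ennreal (1 - t) * emeasure \<nu> A)"
  proof (rule countably_additiveI)
    fix F :: "nat \<Rightarrow> _ set"
    assume F: "range F \<subseteq> sets (mixture t \<mu> \<nu>)" "disjoint_family F"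
    have "sets (mixture t \<mu> \<nu>) = sets borel"
      unfolding mixture_def using sets.sigma_sets_eq[of borel] by (simp add: sets_measure_of)
    with F(1) have "range F \<subseteq> sets \<mu>" "range F \<subseteq> sets \<nu>"
      using s by auto
    then show "(\<Sum>i. ennreal t * emeasure \<mu> (F i) + ennreal (1 - t) * emeasure \<nu> (F i)) =
        ennreal t * emeasure \<mu> (\<Union> (range F)) + ennreal (1 - t) * emeasure \<nu> (\<Union> (range F))"
      using F(2) by (simp add: suminf_add[symmetric] suminf_emeasure)
  qed
qed (use assms in \<open>auto simp: mixture_def positive_def sets.sigma_sets_eq[of borel, simplified]\<close>)

section \<open>The Markov chain and its empirical measures\<close>

definition past :: "'w measure \<Rightarrow> (nat \<Rightarrow> 'w \<Rightarrow> 'a::topological_space) \<Rightarrow> nat \<Rightarrow> 'w measure" where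
  "past M X n = sigma (space M) {X i -` B \<inter> space M | i B. 1 \<le> i \<and> i \<le> n \<and> B \<in> sets borel}"

text \<open>\<open>X 0\<close> is not used: the chain is \<open>X 1, X 2, \<dots>\<close>.\<close>

definition markov_chain ::
    "'w measure \<Rightarrow> (nat \<Rightarrow> 'w \<Rightarrow> 'a::topological_space) \<Rightarrow> 'a measure \<Rightarrow> ('a \<Rightarrow> 'a measure) \<Rightarrow> bool" where
  "markov_chain M X \<beta> p \<longleftrightarrow>
     prob_space M \<and>
     (\<forall>n\<ge>1. X n \<in> M \<rightarrow>\<^sub>M borel) \<and>
     distr M borel (X 1) = \<beta> \<and>
     (\<forall>n\<ge>1. \<forall>B\<in>sets borel. AE \<omega> in M.
        real_cond_exp M (past M X n) (indicator (X (Suc n) -` B \<inter> space M)) \<omega> = measure (p (X n \<omega>)) B)"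

text \<open>\<open>L\<^sub>n = 1/n (\<delta>\<^bsub>X 1\<^esub> + \<dots> + \<delta>\<^bsub>X n\<^esub>)\<close>.\<close>

definition empirical :: "(nat \<Rightarrow> 'w \<Rightarrow> 'a::topological_space) \<Rightarrow> nat \<Rightarrow> 'w \<Rightarrow> 'a measure" where
  "empirical X n \<omega> = measure_of UNIV (sets borel)
     (\<lambda>A. ennreal (1 / real n) * (\<Sum>i=1..n. emeasure (return borel (X i \<omega>)) A))"

lemma emeasure_empirical:
  assumes "A \<in> sets borel"
  shows "emeasure (empirical X n \<omega>) A =
    ennreal (1 / real n) * (\<Sum>i=1..n. emeasure (return borel (X i \<omega>)) A)"
proof (rule emeasure_measure_of[OF empirical_def])
  show "countably_additive (sets (empirical X n \<omega>))
      (\<lambda>A. ennreal (1 / real n) * (\<Sum>i=1..n. emeasure (return borel (X i \<omega>)) A))"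
  proof (rule countably_additiveI)
    fix F :: "nat \<Rightarrow> _ set"
    assume F: "range F \<subseteq> sets (empirical X n \<omega>)" "disjoint_family F"
    have "sets (empirical X n \<omega>) = sets borel"
      unfolding empirical_def using sets.sigma_sets_eq[of borel] by (simp add: sets_measure_of)
    with F(1) have r: "range F \<subseteq> sets (return borel (X i \<omega>))" for i
      by simp
    have "(\<Sum>k. \<Sum>i=1..n. emeasure (return borel (X i \<omega>)) (F k)) =
        (\<Sum>i=1..n. emeasure (return borel (X i \<omega>)) (\<Union> (range F)))"
      by (subst suminf_sum) (auto intro!: sum.cong suminf_emeasure[OF r F(2)] simp del: emeasure_return)
    then show "(\<Sum>k. ennreal (1 / real n) * (\<Sum>i=1..n. emeasure (return borel (X i \<omega>)) (F k))) =
        ennreal (1 / real n) * (\<Sum>i=1..n. emeasure (return borel (X i \<omega>)) (\<Union> (range F)))"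
      by (simp del: emeasure_return)
  qed
qed (use assms in \<open>auto simp: empirical_def positive_def sets.sigma_sets_eq[of borel, simplified]\<close>)

section \<open>Large deviations\<close>

definition elog :: "real \<Rightarrow> ereal" where
  "elog x = (if x \<le> 0 then -\<infinity> else ereal (ln x))"

text \<open>\<open>1/n log \<P>(L\<^sub>n \<in> V)\<close>; only \<open>n \<ge> 1\<close> is relevant.\<close>

definition log_rate ::
    "'w measure \<Rightarrow> (nat \<Rightarrow> 'w \<Rightarrow> 'a::topological_space) \<Rightarrow> 'a measure set \<Rightarrow> nat \<Rightarrow> ereal" where
  "log_rate M X V n =
     ereal (1 / real n) * elog (measure M {\<omega> \<in> space M. empirical X n \<omega> \<in> V})"

definition lsc_rate_function :: "('a::topological_space measure \<Rightarrow> ereal) \<Rightarrow> bool" where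
  "lsc_rate_function I \<longleftrightarrow>
     (\<forall>\<mu>\<in>prob_measures. 0 \<le> I \<mu>) \<and>
     (\<forall>a. openin weak_topology {\<mu> \<in> prob_measures. I \<mu> > a})"

definition weak_LDP ::
    "'w measure \<Rightarrow> (nat \<Rightarrow> 'w \<Rightarrow> 'a::topological_space) \<Rightarrow> ('a measure \<Rightarrow> ereal) \<Rightarrow> bool" where
  "weak_LDP M X I \<longleftrightarrow>
     (\<forall>U. openin weak_topology U \<longrightarrow> liminf (log_rate M X U) \<ge> - (INF \<mu>\<in>U. I \<mu>)) \<and>
     (\<forall>F. compactin weak_topology F \<longrightarrow> limsup (log_rate M X F) \<le> - (INF \<mu>\<in>F. I \<mu>))"

section \<open>Communicating classes and admissible measures\<close>

text \<open>The kernel on the extended space, with \<open>p(x_init, \<cdot>) = \<beta>\<close>.\<close>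

definition ext_kernel :: "'a measure \<Rightarrow> ('a \<Rightarrow> 'a measure) \<Rightarrow> 'a option \<Rightarrow> 'a measure" where
  "ext_kernel \<beta> p x = (case x of None \<Rightarrow> \<beta> | Some y \<Rightarrow> p y)"

text \<open>The index is shifted: \<open>rho_iter \<rho> k\<close> is \<open>\<rho>\<close> iterated \<open>k + 1\<close> times.\<close>

primrec rho_iter ::
    "('a::euclidean_space option \<Rightarrow> 'a \<Rightarrow> real) \<Rightarrow> nat \<Rightarrow> 'a option \<Rightarrow> 'a \<Rightarrow> ennreal" where
  "rho_iter \<rho> 0 = (\<lambda>x y. ennreal (\<rho> x y))"
| "rho_iter \<rho> (Suc k) = (\<lambda>x y. \<integral>\<^sup>+z. rho_iter \<rho> k x z * ennreal (\<rho> (Some z) y) \<partial>lborel)"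

definition rho_tilde ::
    "('a::euclidean_space option \<Rightarrow> 'a \<Rightarrow> real) \<Rightarrow> 'a option \<Rightarrow> 'a \<Rightarrow> ennreal" where
  "rho_tilde \<rho> x y = (\<Sum>k. ennreal ((1 / 2) ^ (k + 1)) * rho_iter \<rho> k x y)"

definition p_tilde ::
    "('a::euclidean_space option \<Rightarrow> 'a \<Rightarrow> real) \<Rightarrow> 'a option \<Rightarrow> 'a set \<Rightarrow> ennreal" where
  "p_tilde \<rho> x A = (\<integral>\<^sup>+y\<in>A. rho_tilde \<rho> x y \<partial>lborel)"

definition communicating :: "('a::euclidean_space option \<Rightarrow> 'a \<Rightarrow> real) \<Rightarrow> 'a set \<Rightarrow> bool" where
  "communicating \<rho> A \<longleftrightarrow> A \<noteq> {} \<and> (\<forall>x\<in>A. \<forall>y\<in>A. rho_tilde \<rho> (Some x) y > 0)"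

text \<open>The family of classes is indexed by itself.\<close>

definition comm_classes :: "('a::euclidean_space option \<Rightarrow> 'a \<Rightarrow> real) \<Rightarrow> 'a set set" where
  "comm_classes \<rho> = {A. communicating \<rho> A \<and> (\<forall>B. communicating \<rho> B \<longrightarrow> A \<subseteq> B \<longrightarrow> B = A)}"

definition leads_to :: "('a::euclidean_space option \<Rightarrow> 'a \<Rightarrow> real) \<Rightarrow> 'a set \<Rightarrow> 'a set \<Rightarrow> bool" where
  "leads_to \<rho> A B \<longleftrightarrow> (\<forall>x\<in>A. p_tilde \<rho> (Some x) B > 0)"

definition init_leads_to :: "('a::euclidean_space option \<Rightarrow> 'a \<Rightarrow> real) \<Rightarrow> 'a set \<Rightarrow> bool" where
  "init_leads_to \<rho> B \<longleftrightarrow> p_tilde \<rho> None B > 0"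

definition charged_classes ::
    "('a::euclidean_space option \<Rightarrow> 'a \<Rightarrow> real) \<Rightarrow> 'a measure \<Rightarrow> 'a set set" where
  "charged_classes \<rho> \<mu> = {A \<in> comm_classes \<rho>. measure \<mu> A > 0}"

definition admissible ::
    "('a::euclidean_space option \<Rightarrow> 'a \<Rightarrow> real) \<Rightarrow> 'a measure set" where
  "admissible \<rho> = {\<mu> \<in> prob_measures.
     absolutely_continuous lborel \<mu> \<and>
     measure_support \<mu> \<subseteq> closure (\<Union> (comm_classes \<rho>)) \<and>
     (\<forall>A\<in>charged_classes \<rho> \<mu>. init_leads_to \<rho> A) \<and>
     linear_order_on (charged_classes \<rho> \<mu>)
       {(A, B). A \<in> charged_classes \<rho> \<mu> \<and> B \<in> charged_classes \<rho> \<mu> \<and> leads_to \<rho> A B}}"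

end

theory Submission
  imports Defs
begin

text \<open>
  Let \<open>s\<close> and \<open>S\<close> be the local exponential rates of \<open>\<P>(L\<^sub>n \<in> V)\<close>, with the liminf and
  the limsup, as \<open>V\<close> shrinks to a measure. The weak principle with rate \<open>- s\<close> amounts to \<open>S \<le> s\<close>
  everywhere. Almost surely the chain never moves against \<open>\<leadsto>\<close>, so it meets finitely many classes
  in order. If compact parts of these classes carry most of \<open>\<mu>\<close>, a path with \<open>L\<^sub>n\<close> near
  \<open>\<mu>\<close> is, up to few points, a sequence of blocks, one per class, running from the first to the last
  visit of its compact part. As \<open>\<rho>\<close> is bounded, the probability of the path is at most a subexponential
  factor times the product of the masses of the blocks with starting points distributed by Lebesgue
  measure. Conversely, as \<open>\<rho>\<close> is lower semicontinuous, the iterated densities are bounded below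
  between the compact parts, so that any blocks, repeated at will, can be joined by gaps of bounded
  length at a bounded cost, in any sequence respecting \<open>\<leadsto>\<close>.

  Repeating blocks typical for \<open>\<mu>\<^sub>1\<close> and for \<open>\<mu>\<^sub>2\<close> in the proportions \<open>\<lambda>\<close> and \<open>1 - \<lambda>\<close>
  gives \<open>s(\<lambda> \<mu>\<^sub>1 + (1 - \<lambda>) \<mu>\<^sub>2) \<ge> \<lambda> S(\<mu>\<^sub>1) + (1 - \<lambda>) S(\<mu>\<^sub>2)\<close>: this is convexity, and \<open>S \<le> s\<close> when
  \<open>\<mu>\<^sub>1 = \<mu>\<^sub>2\<close>. If \<open>\<mu>\<^sub>1\<close> and \<open>\<mu>\<^sub>2\<close> charge different classes, the blocks of a path typical for the mixture
  split into two groups, and joining each group separately gives the reverse inequality.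
\<close>

section \<open>The weak topology\<close>

text \<open>One quantity, \<open>mass\<close>, bounds the probability of a block from both sides:
  from above up to a factor \<open>R\<close>, since a bounded density makes the entrance law at most
  \<open>R\<close> times Lebesgue measure, and from below up to a factor
  \<open>1 / L\<^sup>2\<close>, since some gap of bounded length leads into the block. With one
  block per class of a frame, the discrepancy \<open>(R * L\<^sup>2) ^ r\<close> is independent of
  the path length. A single length N at which a neighbourhood has large probability thus yields
  lower bounds for all large n, by repetition; this is how a limsup becomes a liminf.

  The classes force the shape of the blocks. A path may leave the compact part of a class and come
  back, but it never returns from another class; so one block per class suffices, and blocks of
  different classes are disjoint. There may be infinitely many classes, none of them compact;
  tightness of a single measure reduces them to finitely many compact parts up to \<epsilon>, and
  the time spent elsewhere is an error of the averages. Measures without full mass on the classes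
  have infinite rate by (iii), so the construction never meets them.\<close>

lemma prob_measuresD:
  assumes "\<mu> \<in> prob_measures"
  shows "prob_space \<mu>" "sets \<mu> = sets borel" "space \<mu> = UNIV"
proof -
  show "prob_space \<mu>" and *: "sets \<mu> = sets borel"
    using assms by (simp_all add: space_prob_algebra)
  show "space \<mu> = UNIV"
    using sets_eq_imp_space_eq[OF *] by simp
qed

lemma integrable_bounded_borel:
  fixes f :: "'a::topological_space \<Rightarrow> real"
  assumes "\<mu> \<in> prob_measures" "f \<in> borel_measurable borel" "\<And>x. \<bar>f x\<bar> \<le> B"
  shows "integrable \<mu> f"
proof -
  interpret prob_space \<mu> using assms(1) by (rule prob_measuresD)
  show ?thesis
    by (rule integrable_const_bound[where B=B])
      (use assms prob_measuresD(2)[OF assms(1)] in \<open>auto cong: measurable_cong_sets\<close>)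
qed

text \<open>Induction over the generation of the topology; an intersection takes the union of the
  test functions and the smaller tolerance. The normalization to functions bounded by 1 makes every
  time that an argument fails to control cost at most 1 in a sum along the path.\<close>

lemma weak_topology_nbhd:
  fixes \<mu> :: "'a::topological_space measure"
  assumes "openin weak_topology V" "\<mu> \<in> V"
  obtains Fs \<delta> where "finite Fs" "0 < \<delta>"
    "\<And>f. f \<in> Fs \<Longrightarrow> continuous_on UNIV f" "\<And>f x. f \<in> Fs \<Longrightarrow> \<bar>f x\<bar> \<le> (1::real)"
    "\<And>\<nu>. \<nu> \<in> prob_measures \<Longrightarrow> (\<And>f. f \<in> Fs \<Longrightarrow> \<bar>(\<integral>x. f x \<partial>\<nu>) - (\<integral>x. f x \<partial>\<mu>)\<bar> < \<delta>) \<Longrightarrow> \<nu> \<in> V"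
proof -
  have "generate_topology_on {{\<mu> \<in> prob_measures. (\<integral>x. f x \<partial>\<mu>) \<in> U} | (f :: 'a \<Rightarrow> real) U.
        continuous_on UNIV f \<and> bounded (range f) \<and> open U} V"
    using assms(1) unfolding weak_topology_def openin_topology_generated_by_iff .
  then have "\<mu> \<in> V \<Longrightarrow> \<exists>Fs \<delta>. finite Fs \<and> 0 < \<delta> \<and> (\<forall>f\<in>Fs. continuous_on UNIV f \<and> (\<forall>x. \<bar>f x\<bar> \<le> (1::real))) \<and>
     (\<forall>\<nu>\<in>prob_measures. (\<forall>f\<in>Fs. \<bar>(\<integral>x. f x \<partial>\<nu>) - (\<integral>x. f x \<partial>\<mu>)\<bar> < \<delta>) \<longrightarrow> \<nu> \<in> V)"
  proof induction
    case Empty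
    then show ?case by simp
  next
    case (Int a b)
    then obtain F1 d1 F2 d2 where
      "finite F1" "0 < d1" "\<forall>f\<in>F1. continuous_on UNIV f \<and> (\<forall>x. \<bar>f x\<bar> \<le> (1::real))"
      "\<forall>\<nu>\<in>prob_measures. (\<forall>f\<in>F1. \<bar>(\<integral>x. f x \<partial>\<nu>) - (\<integral>x. f x \<partial>\<mu>)\<bar> < d1) \<longrightarrow> \<nu> \<in> a"
      "finite F2" "0 < d2" "\<forall>f\<in>F2. continuous_on UNIV f \<and> (\<forall>x. \<bar>f x\<bar> \<le> (1::real))"
      "\<forall>\<nu>\<in>prob_measures. (\<forall>f\<in>F2. \<bar>(\<integral>x. f x \<partial>\<nu>) - (\<integral>x. f x \<partial>\<mu>)\<bar> < d2) \<longrightarrow> \<nu> \<in> b"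
      by (auto simp: Int_iff)
    then show ?case
      by (intro exI[of _ "F1 \<union> F2"] exI[of _ "min d1 d2"]) auto
  next
    case (UN K)
    then obtain k where "k \<in> K" "\<mu> \<in> k" by auto
    with UN(2)[OF this] obtain Fs \<delta> where "finite Fs" "0 < \<delta>" "\<forall>f\<in>Fs. continuous_on UNIV f \<and> (\<forall>x. \<bar>f x\<bar> \<le> (1::real))"
     "\<forall>\<nu>\<in>prob_measures. (\<forall>f\<in>Fs. \<bar>(\<integral>x. f x \<partial>\<nu>) - (\<integral>x. f x \<partial>\<mu>)\<bar> < \<delta>) \<longrightarrow> \<nu> \<in> k"
      by auto
    with \<open>k \<in> K\<close> show ?case by (intro exI[of _ Fs] exI[of _ \<delta>]) auto
  next
    case (Basis s)
    then obtain f :: "'a \<Rightarrow> real" and U where s: "s = {\<mu> \<in> prob_measures. (\<integral>x. f x \<partial>\<mu>) \<in> U}"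
      "continuous_on UNIV f" "bounded (range f)" "open U" by auto
    obtain B where B: "B > 0" "\<And>x. \<bar>f x\<bar> \<le> B"
      using s(3) unfolding bounded_pos by auto
    obtain e where e: "e > 0" "\<And>y. \<bar>y - (\<integral>x. f x \<partial>\<mu>)\<bar> < e \<Longrightarrow> y \<in> U"
      using s(1,4) Basis(2) unfolding open_dist dist_real_def by auto
    show ?case
    proof (intro exI[of _ "{\<lambda>x. f x / B}"] exI[of _ "e / B"] conjI ballI impI allI)
      fix \<nu> :: "'a measure"
      assume "\<nu> \<in> prob_measures" "\<forall>f\<in>{\<lambda>x. f x / B}. \<bar>(\<integral>x. f x \<partial>\<nu>) - (\<integral>x. f x \<partial>\<mu>)\<bar> < e / B"
      then have "\<bar>(\<integral>x. f x \<partial>\<nu>) / B - (\<integral>x. f x \<partial>\<mu>) / B\<bar> < e / B"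
        by auto
      then have "\<bar>(\<integral>x. f x \<partial>\<nu>) - (\<integral>x. f x \<partial>\<mu>)\<bar> < e"
        using B by (simp add: diff_divide_distrib[symmetric] abs_divide divide_less_cancel)
      then show "\<nu> \<in> s" using e \<open>\<nu> \<in> prob_measures\<close> s(1) by auto
    qed (use B e s in \<open>auto intro!: continuous_intros\<close>)
  qed
  with assms(2) that show ?thesis by auto
qed

lemma openin_weak_test_function:
  fixes f :: "'a::topological_space \<Rightarrow> real"
  assumes "continuous_on UNIV f" "\<And>x. \<bar>f x\<bar> \<le> B" "open U"
  shows "openin weak_topology {\<nu> \<in> prob_measures. (\<integral>x. f x \<partial>\<nu>) \<in> U}"
proof -
  have "bounded (range f)" using assms(2) by (auto simp: bounded_iff)
  then show ?thesis
    unfolding weak_topology_def openin_topology_generated_by_iff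
    using assms by (intro generate_topology_on.Basis) blast
qed

lemma openin_weak_prob_measures: "openin weak_topology (prob_measures :: 'a::topological_space measure set)"
  using openin_topspace[of "weak_topology :: 'a measure topology"] by (simp only: topspace_weak_topology)

lemma openin_weak_ball:
  fixes \<mu> :: "'a::topological_space measure"
  assumes "finite Fs" "\<And>f. f \<in> Fs \<Longrightarrow> continuous_on UNIV f" "\<And>f x. f \<in> Fs \<Longrightarrow> \<bar>f x\<bar> \<le> (B::real)"
  shows "openin weak_topology {\<nu> \<in> prob_measures. \<forall>f\<in>Fs. \<bar>(\<integral>x. f x \<partial>\<nu>) - c f\<bar> < \<delta>}"
  using assms
proof (induction Fs)
  case empty
  then show ?case using openin_weak_prob_measures by simp
next
  case (insert f Fs)
  have "openin weak_topology ({\<nu> \<in> prob_measures. \<forall>f\<in>Fs. \<bar>(\<integral>x. f x \<partial>\<nu>) - c f\<bar> < \<delta>} \<inter>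
      {\<nu> \<in> prob_measures. (\<integral>x. f x \<partial>\<nu>) \<in> ball (c f) \<delta>})"
    using insert by (intro openin_Int openin_weak_test_function) auto
  also have "\<dots> = {\<nu> \<in> prob_measures. \<forall>f\<in>insert f Fs. \<bar>(\<integral>x. f x \<partial>\<nu>) - c f\<bar> < \<delta>}"
    by (auto simp: dist_real_def abs_minus_commute)
  finally show ?case .
qed

text \<open>Half of the portmanteau theorem: the indicator of an open set is the increasing limit of
  the continuous functions \<open>f n\<close>, so the superlevel set is a union of sets given by
  test functions.\<close>

lemma openin_weak_open_set:
  fixes S :: "'a::metric_space set"
  assumes "open S"
  shows "openin weak_topology {\<nu> \<in> prob_measures. measure \<nu> S > a}"
\<comment> \<open>\<open>infdist\<close> to the empty complement is 0, so the functions
  \<open>f n\<close> below would not converge to the indicator.\<close>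
proof (cases "S = UNIV")
  case True
  have "measure \<nu> UNIV = 1" if "\<nu> \<in> prob_measures" for \<nu> :: "'a measure"
    using prob_space.prob_space[OF prob_measuresD(1)[OF that]] prob_measuresD(3)[OF that] by simp
  then have "{\<nu> \<in> prob_measures. measure \<nu> S > a} = (if a < 1 then prob_measures else {})"
    using True by auto
  then show ?thesis by (simp add: openin_weak_prob_measures)
next
  case False
  define f where "f n x = min 1 (real n * infdist x (-S))" for n x
  have f: "\<bar>f n x\<bar> \<le> 1" "0 \<le> f n x" "continuous_on UNIV (f n)" for n x
    using mult_nonneg_nonneg[OF of_nat_0_le_iff infdist_nonneg, of n x "-S"]
    by (simp_all add: f_def abs_le_iff) (intro continuous_intros)
  have lim: "(\<lambda>n. f n x) \<longlonglongrightarrow> indicator S x" for x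
  proof (cases "x \<in> S")
    case True
    have "infdist x (-S) > 0"
      using True False assms in_closed_iff_infdist_zero[of "-S" x] infdist_nonneg[of x "-S"]
      by (auto simp: less_le)
    then obtain N where N: "1 \<le> real N * infdist x (-S)"
      by (metis less_le mult.commute reals_Archimedean3)
    have "eventually (\<lambda>n. f n x = 1) sequentially"
      using eventually_ge_at_top[of N]
    proof eventually_elim
      case (elim n)
      have "real N * infdist x (-S) \<le> real n * infdist x (-S)"
        using elim infdist_nonneg by (intro mult_right_mono) auto
      with N show ?case by (simp add: f_def)
    qed
    then show ?thesis using True by (simp add: tendsto_eventually)
  next
    case False
    then have "f n x = 0" for n by (simp add: f_def infdist_zero)
    then show ?thesis using False by simp
  qed
  have le: "f n x \<le> indicator S x" for n x
    by (cases "x \<in> S") (auto simp: f_def infdist_zero)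
  have meas[measurable]: "f n \<in> borel_measurable borel" for n
    using f by (simp add: borel_measurable_continuous_onI)
  have S[measurable]: "S \<in> sets borel" using assms by simp
  have int: "(\<lambda>n. \<integral>x. f n x \<partial>\<nu>) \<longlonglongrightarrow> measure \<nu> S" "(\<integral>x. f n x \<partial>\<nu>) \<le> measure \<nu> S"
    if nu: "\<nu> \<in> prob_measures" for \<nu> n
  proof -
    interpret prob_space \<nu> using nu by (rule prob_measuresD)
    note [measurable_cong] = prob_measuresD(2)[OF nu]
    have "(\<lambda>n. \<integral>x. f n x \<partial>\<nu>) \<longlonglongrightarrow> (\<integral>x. indicator S x \<partial>\<nu>)"
      by (rule integral_dominated_convergence[where w="\<lambda>_. 1"]) (use lim f in auto)
    then show "(\<lambda>n. \<integral>x. f n x \<partial>\<nu>) \<longlonglongrightarrow> measure \<nu> S" 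
      by (simp add: prob_measuresD(3)[OF nu])
    have "(\<integral>x. f n x \<partial>\<nu>) \<le> (\<integral>x. indicator S x \<partial>\<nu>)"
      by (intro integral_mono integrable_bounded_borel[OF nu, where B=1] le) 
       (use f in \<open>auto simp: indicator_def\<close>)
    then show "(\<integral>x. f n x \<partial>\<nu>) \<le> measure \<nu> S" by (simp add: prob_measuresD(3)[OF nu])
  qed
  have "{\<nu> \<in> prob_measures. measure \<nu> S > a} = (\<Union>n. {\<nu> \<in> prob_measures. (\<integral>x. f n x \<partial>\<nu>) \<in> {a<..}})"
  proof (intro equalityI subsetI)
    fix \<nu> assume nu: "\<nu> \<in> {\<nu> \<in> prob_measures. measure \<nu> S > a}"
    then have "eventually (\<lambda>n. (\<integral>x. f n x \<partial>\<nu>) > a) sequentially"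
      using int(1)[of \<nu>] by (auto intro: order_tendstoD)
    then obtain n where "(\<integral>x. f n x \<partial>\<nu>) > a"
      using eventually_happens by fastforce
    with nu show "\<nu> \<in> (\<Union>n. {\<nu> \<in> prob_measures. (\<integral>x. f n x \<partial>\<nu>) \<in> {a<..}})" by auto
  next
    fix \<nu> assume "\<nu> \<in> (\<Union>n. {\<nu> \<in> prob_measures. (\<integral>x. f n x \<partial>\<nu>) \<in> {a<..}})"
    then show "\<nu> \<in> {\<nu> \<in> prob_measures. measure \<nu> S > a}"
      using int(2) by (force intro: less_le_trans)
  qed
  also have "openin weak_topology \<dots>"
    using openin_weak_test_function[OF f(3) f(1) open_greaterThan] by (intro openin_Union) blast
  finally show ?thesis .
qed

section \<open>Mixtures and empirical measures\<close>

lemma sets_mixture [simp, measurable_cong]: "sets (mixture t \<mu> \<nu>) = sets borel"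
  unfolding mixture_def using sets.sigma_sets_eq[of borel] by (simp add: sets_measure_of)

lemma mixture_prob:
  assumes "\<mu> \<in> prob_measures" "\<nu> \<in> prob_measures" "t \<in> {0..1}"
  shows "mixture t \<mu> \<nu> \<in> prob_measures"
proof -
  interpret mu: prob_space \<mu> using assms(1) by (rule prob_measuresD)
  interpret nu: prob_space \<nu> using assms(2) by (rule prob_measuresD)
  have "emeasure \<mu> UNIV = 1" "emeasure \<nu> UNIV = 1"
    using mu.emeasure_space_1 nu.emeasure_space_1 prob_measuresD(3)[OF assms(1)] prob_measuresD(3)[OF assms(2)]
    by simp_all
  then have "emeasure (mixture t \<mu> \<nu>) UNIV = ennreal t + ennreal (1 - t)"
    using emeasure_mixture[OF assms(1,2), of UNIV t] by simp
  also have "\<dots> = 1"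
    using assms(3) by (subst ennreal_plus[symmetric]) auto
  finally have "emeasure (mixture t \<mu> \<nu>) UNIV = 1" .
  moreover have "space (mixture t \<mu> \<nu>) = UNIV" by (simp add: mixture_def space_measure_of_conv)
  ultimately show ?thesis
    by (simp add: space_prob_algebra prob_spaceI)
qed

lemma measure_mixture:
  assumes "\<mu> \<in> prob_measures" "\<nu> \<in> prob_measures" "t \<in> {0..1}" "A \<in> sets borel"
  shows "measure (mixture t \<mu> \<nu>) A = t * measure \<mu> A + (1 - t) * measure \<nu> A"
proof -
  interpret mu: prob_space \<mu> using assms(1) by (rule prob_measuresD)
  interpret nu: prob_space \<nu> using assms(2) by (rule prob_measuresD)
  interpret mx: prob_space "mixture t \<mu> \<nu>" using mixture_prob[OF assms(1-3)] by (rule prob_measuresD)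
  have "ennreal (measure (mixture t \<mu> \<nu>) A) = ennreal t * ennreal (measure \<mu> A) + ennreal (1 - t) * ennreal (measure \<nu> A)"
    by (simp only: mx.emeasure_eq_measure[symmetric] mu.emeasure_eq_measure[symmetric]
        nu.emeasure_eq_measure[symmetric] emeasure_mixture[OF assms(1,2,4)])
  also have "\<dots> = ennreal (t * measure \<mu> A) + ennreal ((1 - t) * measure \<nu> A)"
    using assms(3) by (simp add: ennreal_mult)
  also have "\<dots> = ennreal (t * measure \<mu> A + (1 - t) * measure \<nu> A)"
    using assms(3) by (intro ennreal_plus[symmetric]) auto
  finally show ?thesis
    using assms(3) by (subst (asm) ennreal_inj) auto
qed

lemma nn_integral_mixture:
  assumes "\<mu> \<in> prob_measures" "\<nu> \<in> prob_measures" and f: "f \<in> borel_measurable borel"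
  shows "(\<integral>\<^sup>+x. f x \<partial>mixture t \<mu> \<nu>) = ennreal t * (\<integral>\<^sup>+x. f x \<partial>\<mu>) + ennreal (1 - t) * (\<integral>\<^sup>+x. f x \<partial>\<nu>)"
  using f
proof induction
  case (cong f g)
  then have "f = g" by auto
  with cong show ?case by simp
next
  case (set A)
  then show ?case using emeasure_mixture[OF assms(1,2)] prob_measuresD[OF assms(1)] prob_measuresD[OF assms(2)] by simp
next
  case (mult u c)
  note [measurable_cong] = prob_measuresD(2)[OF assms(1)] prob_measuresD(2)[OF assms(2)]
  note [measurable] = mult(2)
  show ?case by (simp add: nn_integral_cmult mult distrib_left mult_ac)
next
  case (add u v)
  note [measurable_cong] = prob_measuresD(2)[OF assms(1)] prob_measuresD(2)[OF assms(2)]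
  note [measurable] = add(1,4)
  note [measurable] = add(3)
  show ?case by (simp add: nn_integral_add add distrib_left add_ac)
next
  case (seq U)
  note [measurable_cong] = prob_measuresD(2)[OF assms(1)] prob_measuresD(2)[OF assms(2)]
  note [measurable] = seq(1)
  have "(\<integral>\<^sup>+x. (\<Squnion>i. U i x) \<partial>m) = (\<Squnion>i. \<integral>\<^sup>+x. U i x \<partial>m)" if "sets m = sets borel" for m
    using seq that by (intro nn_integral_monotone_convergence_SUP) (auto cong: measurable_cong_sets)
  moreover have "incseq (\<lambda>i. ennreal s * (\<integral>\<^sup>+x. U i x \<partial>m))" for m s
    using seq(3) by (auto simp: incseq_def le_fun_def intro!: mult_left_mono nn_integral_mono)
  moreover have "\<Squnion> (range U) = (\<lambda>x. \<Squnion>i. U i x)" by (simp add: fun_eq_iff image_comp)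
  ultimately show ?case
    using prob_measuresD(2)[OF assms(1)] prob_measuresD(2)[OF assms(2)] sets_mixture seq(4)
    by (simp add: seq.IH ennreal_SUP_add SUP_mult_left_ennreal)
qed

text \<open>Adding the bound \<open>B\<close> makes the integrand nonnegative, which reduces the
  claim to \<open>nn_integral_mixture\<close>.\<close>

lemma integral_mixture:
  fixes f :: "'a::topological_space \<Rightarrow> real"
  assumes "\<mu> \<in> prob_measures" "\<nu> \<in> prob_measures" "t \<in> {0..1}"
    and f[measurable]: "f \<in> borel_measurable borel" and b: "\<And>x. \<bar>f x\<bar> \<le> B"
  shows "(\<integral>x. f x \<partial>mixture t \<mu> \<nu>) = t * (\<integral>x. f x \<partial>\<mu>) + (1 - t) * (\<integral>x. f x \<partial>\<nu>)"
proof -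
  note [measurable_cong] = prob_measuresD(2)[OF assms(1)] prob_measuresD(2)[OF assms(2)]
  have int: "integrable m f" "integrable m (\<lambda>x. f x + B)" "(\<integral>\<^sup>+x. ennreal (f x + B) \<partial>m) = ennreal ((\<integral>x. f x \<partial>m) + B)" "0 \<le> (\<integral>x. f x \<partial>m) + B"
    if m: "m \<in> prob_measures" for m
  proof -
    interpret prob_space m using m by (rule prob_measuresD)
    show i: "integrable m f" using integrable_bounded_borel[OF m f b] .
    then show i2: "integrable m (\<lambda>x. f x + B)" by simp
    have nn: "0 \<le> f x + B" for x using b[of x] by linarith
    have I: "(\<integral>x. f x + B \<partial>m) = (\<integral>x. f x \<partial>m) + B"
      using i by (simp add: prob_space)
    show "(\<integral>\<^sup>+x. ennreal (f x + B) \<partial>m) = ennreal ((\<integral>x. f x \<partial>m) + B)"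
      using nn_integral_eq_integral[OF i2] nn I by simp
    show "0 \<le> (\<integral>x. f x \<partial>m) + B" using Bochner_Integration.integral_nonneg[of m "\<lambda>x. f x + B"] nn I by simp
  qed
  have mx: "mixture t \<mu> \<nu> \<in> prob_measures" using mixture_prob[OF assms(1-3)] .
  have "ennreal ((\<integral>x. f x \<partial>mixture t \<mu> \<nu>) + B) =
      ennreal t * ennreal ((\<integral>x. f x \<partial>\<mu>) + B) + ennreal (1 - t) * ennreal ((\<integral>x. f x \<partial>\<nu>) + B)"
    using nn_integral_mixture[OF assms(1,2), of "\<lambda>x. ennreal (f x + B)" t]
    by (simp only: int(3)[OF mx] int(3)[OF assms(1)] int(3)[OF assms(2)]) measurable
  also have "\<dots> = ennreal (t * ((\<integral>x. f x \<partial>\<mu>) + B)) + ennreal ((1 - t) * ((\<integral>x. f x \<partial>\<nu>) + B))"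
    using assms(3) int(4)[OF assms(1)] int(4)[OF assms(2)] by (simp add: ennreal_mult)
  also have "\<dots> = ennreal (t * ((\<integral>x. f x \<partial>\<mu>) + B) + (1 - t) * ((\<integral>x. f x \<partial>\<nu>) + B))"
    using assms(3) int(4)[OF assms(1)] int(4)[OF assms(2)] by (intro ennreal_plus[symmetric]) auto
  finally have "(\<integral>x. f x \<partial>mixture t \<mu> \<nu>) + B = t * ((\<integral>x. f x \<partial>\<mu>) + B) + (1 - t) * ((\<integral>x. f x \<partial>\<nu>) + B)"
    using int(4)[OF mx] int(4)[OF assms(1)] int(4)[OF assms(2)] assms(3)
    by (subst (asm) ennreal_inj) auto
  then show ?thesis by (simp add: algebra_simps)
qed

text \<open>With this identity the concatenation bound for mixtures also compares the two local
  rates of a single measure.\<close>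

lemma mixture_self: "\<mu> \<in> prob_measures \<Longrightarrow> t \<in> {0..1} \<Longrightarrow> mixture t \<mu> \<mu> = \<mu>"
proof (rule measure_eqI)
  assume mu: "\<mu> \<in> prob_measures" and t: "t \<in> {0..1}"
  note smu = prob_measuresD(2)[OF mu]
  show "sets (mixture t \<mu> \<mu>) = sets \<mu>" by (simp add: smu)
  fix A assume "A \<in> sets (mixture t \<mu> \<mu>)"
  then have "emeasure (mixture t \<mu> \<mu>) A = (ennreal t + ennreal (1 - t)) * emeasure \<mu> A"
    using emeasure_mixture[OF mu mu, of A t] by (simp add: distrib_right)
  also have "ennreal t + ennreal (1 - t) = 1" using t by (subst ennreal_plus[symmetric]) auto
  finally show "emeasure (mixture t \<mu> \<mu>) A = emeasure \<mu> A" by simp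
qed

lemma empirical_eq_distr:
  assumes "n \<ge> 1"
  shows "empirical X n \<omega> = distr (uniform_count_measure {1..n}) borel (\<lambda>i. X i \<omega>)"
proof (rule measure_eqI)
  have sets: "sets (empirical X n \<omega>) = sets borel"
    unfolding empirical_def using sets.sigma_sets_eq[of borel] by (simp add: sets_measure_of)
  then show "sets (empirical X n \<omega>) = sets (distr (uniform_count_measure {1..n}) borel (\<lambda>i. X i \<omega>))"
    by simp
  fix A assume "A \<in> sets (empirical X n \<omega>)"
  with sets have A: "A \<in> sets borel" by simp
  have sub: "{i\<in>{1..n}. X i \<omega> \<in> A} \<subseteq> {1..n}" by auto
  have m: "(\<lambda>i. X i \<omega>) \<in> uniform_count_measure {1..n} \<rightarrow>\<^sub>M borel"
    by (simp add: measurable_def)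
  have "emeasure (distr (uniform_count_measure {1..n}) borel (\<lambda>i. X i \<omega>)) A
     = ennreal (real (card {i\<in>{1..n}. X i \<omega> \<in> A}) / real n)"
  proof -
    have "(\<lambda>i. X i \<omega>) -` A \<inter> {1..n} = {i\<in>{1..n}. X i \<omega> \<in> A}" by auto
    then show ?thesis
      using A m emeasure_uniform_count_measure[OF _ sub] by (simp add: emeasure_distr space_uniform_count_measure)
  qed
  also have "\<dots> = ennreal (1 / real n) * (\<Sum>i=1..n. indicator A (X i \<omega>))"
  proof -
    have "(\<Sum>i=1..n. indicator A (X i \<omega>)) = (of_nat (card {i\<in>{1..n}. X i \<omega> \<in> A}) :: ennreal)"
      by (simp add: indicator_def of_bool_def sum.If_cases Int_def conj_commute)
    then show ?thesis by (simp add: ennreal_of_nat_eq_real_of_nat ennreal_mult[symmetric])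
  qed
  finally show "emeasure (empirical X n \<omega>) A = emeasure (distr (uniform_count_measure {1..n}) borel (\<lambda>i. X i \<omega>)) A"
    using emeasure_empirical[OF A] A by simp
qed

lemma empirical_prob: "n \<ge> 1 \<Longrightarrow> empirical X n \<omega> \<in> prob_measures"
  unfolding empirical_eq_distr space_prob_algebra
  by (auto intro!: prob_space.prob_space_distr prob_space_uniform_count_measure simp: measurable_def)

lemma integral_empirical:
  fixes f :: "'a::topological_space \<Rightarrow> real"
  assumes "n \<ge> 1" "f \<in> borel_measurable borel"
  shows "(\<integral>x. f x \<partial>empirical X n \<omega>) = (\<Sum>i=1..n. f (X i \<omega>)) / real n"
  unfolding empirical_eq_distr[OF assms(1)]
  by (subst integral_distr) (use assms in \<open>auto simp: measurable_def integral_uniform_count_measure\<close>)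

lemma measure_empirical:
  assumes "n \<ge> 1" "A \<in> sets borel"
  shows "measure (empirical X n \<omega>) A = real (card {i\<in>{1..n}. X i \<omega> \<in> A}) / real n"
proof -
  have sub: "{i\<in>{1..n}. X i \<omega> \<in> A} \<subseteq> {1..n}" by auto
  have m: "(\<lambda>i. X i \<omega>) \<in> uniform_count_measure {1..n} \<rightarrow>\<^sub>M borel"
    by (simp add: measurable_def)
  show ?thesis
    unfolding empirical_eq_distr[OF assms(1)]
  proof -
    have "(\<lambda>i. X i \<omega>) -` A \<inter> {1..n} = {i\<in>{1..n}. X i \<omega> \<in> A}" by auto
    then show "measure (distr (uniform_count_measure {1..n}) borel (\<lambda>i. X i \<omega>)) A = real (card {i\<in>{1..n}. X i \<omega> \<in> A}) / real n"
      using assms m measure_uniform_count_measure[OF _ sub] by (simp add: measure_distr space_uniform_count_measure)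
  qed
qed

text \<open>Preimages of weakly open sets are open in the space of paths, hence measurable; no
  countable base of the weak topology is needed.\<close>

lemma measurable_empirical:
  fixes X :: "nat \<Rightarrow> 'w \<Rightarrow> 'a::second_countable_topology"
  assumes "n \<ge> 1" "\<And>i. i \<ge> 1 \<Longrightarrow> X i \<in> M \<rightarrow>\<^sub>M borel" "openin weak_topology V"
  shows "{\<omega> \<in> space M. empirical X n \<omega> \<in> V} \<in> sets M"
proof -
  define S where "S = {\<eta>::nat \<Rightarrow> 'a. empirical (\<lambda>i \<eta>. \<eta> i) n \<eta> \<in> V}"
  have "open S"
  proof (subst open_subopen, intro ballI)
    fix \<eta> assume "\<eta> \<in> S"
    then have "empirical (\<lambda>i \<eta>. \<eta> i) n \<eta> \<in> V" by (simp add: S_def)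
    from weak_topology_nbhd[OF assms(3) this] obtain Fs \<delta> where F: "finite Fs" "0 < \<delta>"
      "\<And>f. f \<in> Fs \<Longrightarrow> continuous_on UNIV f" "\<And>f x. f \<in> Fs \<Longrightarrow> \<bar>f x\<bar> \<le> (1::real)"
      "\<And>\<nu>. \<nu> \<in> prob_measures \<Longrightarrow> (\<And>f. f \<in> Fs \<Longrightarrow> \<bar>(\<integral>x. f x \<partial>\<nu>) - (\<integral>x. f x \<partial>empirical (\<lambda>i \<eta>. \<eta> i) n \<eta>)\<bar> < \<delta>) \<Longrightarrow> \<nu> \<in> V"
      by metis
    define T where "T = (\<Inter>f\<in>Fs. {\<eta>'. \<bar>(\<Sum>i=1..n. f (\<eta>' i)) / real n - (\<Sum>i=1..n. f (\<eta> i)) / real n\<bar> < \<delta>})"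
    have "open T"
      unfolding T_def
    proof (intro open_INT ballI F(1))
      fix f assume "f \<in> Fs"
      then have "continuous_on UNIV (\<lambda>\<eta>' :: nat \<Rightarrow> 'a. f (\<eta>' i))" for i
        by (intro continuous_on_compose2[OF F(3)] continuous_on_product_coordinates) auto
      then show "open {\<eta>'. \<bar>(\<Sum>i=1..n. f (\<eta>' i)) / real n - (\<Sum>i=1..n. f (\<eta> i)) / real n\<bar> < \<delta>}"
        by (intro open_Collect_less continuous_on_rabs continuous_on_diff continuous_on_const continuous_on_sum continuous_on_divide) (use assms in auto)
    qed
    moreover have "\<eta> \<in> T" using F(2) by (auto simp: T_def)
    moreover have "T \<subseteq> S"
    proof
      fix \<eta>' assume "\<eta>' \<in> T"
      then show "\<eta>' \<in> S"
        unfolding S_def using F assms(1)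
        by (auto simp: T_def integral_empirical borel_measurable_continuous_onI intro!: F(5) empirical_prob)
    qed
    ultimately show "\<exists>T. open T \<and> \<eta> \<in> T \<and> T \<subseteq> S" by blast
  qed
  then have "S \<in> sets (PiM UNIV (\<lambda>i::nat. borel :: 'a measure))"
    by (simp add: sets_PiM_equal_borel)
  \<comment> \<open>\<open>X 0\<close> carries no measurability assumption, so coordinate 0 is
    replaced by a constant, on which the empirical measure does not depend.\<close>
  moreover have "(\<lambda>\<omega> i. if 1 \<le> i then X i \<omega> else undefined) \<in> M \<rightarrow>\<^sub>M PiM UNIV (\<lambda>i::nat. borel)"
  proof (intro measurable_PiM_single')
    fix i :: nat
    show "(\<lambda>\<omega>. if 1 \<le> i then X i \<omega> else undefined) \<in> M \<rightarrow>\<^sub>M borel"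
      using assms(2)[of i] by (cases "1 \<le> i") auto
  qed auto
  ultimately have "(\<lambda>\<omega> i. if 1 \<le> i then X i \<omega> else undefined) -` S \<inter> space M \<in> sets M"
    by (rule measurable_sets[rotated])
  also have "(\<lambda>\<omega> i. if 1 \<le> i then X i \<omega> else undefined) -` S \<inter> space M = {\<omega> \<in> space M. empirical X n \<omega> \<in> V}"
  proof -
    have "empirical (\<lambda>i \<eta>. \<eta> i) n (\<lambda>i. if 1 \<le> i then X i \<omega> else undefined) = empirical X n \<omega>" for \<omega>
      unfolding empirical_def by (intro arg_cong[where f="measure_of UNIV (sets borel)"] ext arg_cong2[where f="(*)"] refl sum.cong) auto
    then show ?thesis by (auto simp: S_def)
  qed
  finally show ?thesis .
qed

section \<open>Iterated transition densities\<close>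

lemma measurable_Some_borel [measurable]: "Some \<in> borel \<rightarrow>\<^sub>M (borel :: 'a::topological_space option measure)"
proof (rule borel_measurable_continuous_onI)
  show "continuous_on UNIV (Some :: 'a \<Rightarrow> 'a option)"
    by (simp add: continuous_on_open_vimage open_option_def)
qed

lemma tendsto_Some:
  fixes u :: "'b \<Rightarrow> 'a::topological_space"
  assumes "(u \<longlongrightarrow> x) F"
  shows "((\<lambda>n. Some (u n)) \<longlongrightarrow> Some x) F"
  using assms unfolding tendsto_def open_option_def by auto

lemma liminf_mult_ennreal:
  fixes u v :: "nat \<Rightarrow> ennreal"
  shows "liminf u * liminf v \<le> liminf (\<lambda>n. u n * v n)"
proof -
  have "(INF m\<in>{i..}. u m) * (INF m\<in>{j..}. v m) \<le> liminf (\<lambda>n. u n * v n)" for i j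
  proof -
    have "(INF m\<in>{i..}. u m) * (INF m\<in>{j..}. v m) \<le> (INF m\<in>{max i j..}. u m * v m)"
      by (intro INF_greatest mult_mono INF_lower) auto
    also have "\<dots> \<le> liminf (\<lambda>n. u n * v n)"
      unfolding liminf_SUP_INF by (rule SUP_upper) simp
    finally show ?thesis .
  qed
  then show ?thesis
    unfolding liminf_SUP_INF[of u] liminf_SUP_INF[of v]
    by (auto simp: SUP_mult_left_ennreal SUP_mult_right_ennreal intro!: SUP_least)
qed

text \<open>The open sets \<open>W N\<close> increase, so one of them contains the compact set. A
  single integer controls both the index and the lower bound; it later serves as the bound for the
  length of a gap and for its cost.\<close>

lemma compact_uniform_positive:
  fixes g :: "nat \<Rightarrow> 'b::topological_space \<Rightarrow> ennreal"
  assumes "compact S" "\<And>k a. open {x. a < g k x}" "\<And>x. x \<in> S \<Longrightarrow> \<exists>k. 0 < g k x"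
  shows "\<exists>N. \<forall>n\<ge>N. \<forall>x\<in>S. \<exists>k<n. ennreal (1 / real n) \<le> g k x"
proof -
  define W where "W N = (\<Union>k<Suc N. {x. ennreal (1 / real (Suc N)) < g k x})" for N
  have mono: "W N \<subseteq> W N'" if "N \<le> N'" for N N'
  proof
    fix x assume "x \<in> W N"
    then obtain k where k: "k < Suc N" "ennreal (1 / real (Suc N)) < g k x" by (auto simp: W_def)
    have "ennreal (1 / real (Suc N')) \<le> ennreal (1 / real (Suc N))"
      using that by (intro ennreal_leI frac_le) auto
    from le_less_trans[OF this k(2)] k(1) that show "x \<in> W N'"
      unfolding W_def by (intro UN_I[of k]) auto
  qed
  have "S \<subseteq> (\<Union>N. W N)"
  proof
    fix x assume "x \<in> S"
    then obtain k where "0 < g k x" using assms(3) by auto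
    then obtain m where m: "ennreal (1 / real (Suc m)) < g k x"
    proof (cases "g k x")
      case (real r)
      then obtain m where "inverse (real (Suc m)) < r" using reals_Archimedean[of r] \<open>0 < g k x\<close> by auto
      then show ?thesis using that[of m] real by (simp add: ennreal_less_iff inverse_eq_divide)
    next
      case top
      then show ?thesis using that[of 0] by simp
    qed
    have "ennreal (1 / real (Suc (max m k))) \<le> ennreal (1 / real (Suc m))"
      by (intro ennreal_leI frac_le) auto
    from le_less_trans[OF this m] have "x \<in> W (max m k)"
      unfolding W_def by (intro UN_I[of k]) auto
    then show "x \<in> (\<Union>N. W N)" by auto
  qed
  moreover have "open (W N)" for N unfolding W_def using assms(2) by auto
  ultimately obtain F where F: "finite F" "S \<subseteq> (\<Union>N\<in>F. W N)"
    using compactE_image[OF assms(1), of UNIV W] by auto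
  define N where "N = Max (insert 0 F)"
  have "S \<subseteq> W N"
  proof
    fix x assume "x \<in> S"
    then obtain M where "M \<in> F" "x \<in> W M" using F by auto
    then show "x \<in> W N" using mono[of M N] F(1) by (auto simp: N_def)
  qed
  show ?thesis
  proof (rule exI[of _ "Suc N"], intro allI impI ballI)
    fix n x assume n: "Suc N \<le> n" and "x \<in> S"
    moreover have "W N \<subseteq> W (n - 1)" using n by (intro mono) simp
    ultimately have "x \<in> W (n - 1)" using \<open>S \<subseteq> W N\<close> by blast
    then show "\<exists>k<n. ennreal (1 / real n) \<le> g k x"
      using n unfolding W_def by (auto intro: less_imp_le)
  qed
qed

section \<open>Lower semicontinuity of the iterated densities\<close>

locale bounded_density =
  fixes \<rho> :: "'a::euclidean_space option \<Rightarrow> 'a \<Rightarrow> real" and R :: real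
  assumes rho_nonneg: "\<And>x y. 0 \<le> \<rho> x y"
    and rho_measurable: "(\<lambda>(x, y). \<rho> x y) \<in> borel_measurable (borel \<Otimes>\<^sub>M borel)"
    and rho_lsc: "lsc (\<lambda>(x, y). \<rho> x y)"
    and rho_le: "\<And>x y. \<rho> x y \<le> R"
    and rho_prob: "\<And>x. (\<integral>\<^sup>+y. ennreal (\<rho> x y) \<partial>lborel) = 1"
begin

lemma R_pos: "0 < R"
proof (rule ccontr)
  assume "\<not> 0 < R"
  then have "\<rho> None y \<le> 0" for y using rho_le[of None y] by simp
  then have "(\<integral>\<^sup>+y. ennreal (\<rho> None y) \<partial>lborel) = (\<integral>\<^sup>+y. 0 \<partial>(lborel :: 'a measure))"
    by (intro nn_integral_cong) (simp add: ennreal_neg)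
  then show False using rho_prob[of None] by simp
qed

lemma measurable_rho [measurable (raw)]:
  assumes "f \<in> N \<rightarrow>\<^sub>M borel" "g \<in> N \<rightarrow>\<^sub>M borel"
  shows "(\<lambda>w. \<rho> (f w) (g w)) \<in> borel_measurable N"
  using measurable_compose[OF measurable_Pair[OF assms] rho_measurable] by simp

lemma measurable_rho_iter0: "(\<lambda>p. rho_iter \<rho> k (fst p) (snd p)) \<in> borel_measurable (borel \<Otimes>\<^sub>M borel)"
proof (induction k)
  case 0
  then show ?case by simp
next
  case (Suc k)
  have m[measurable (raw)]: "(\<lambda>w. rho_iter \<rho> k (f w) (g w)) \<in> borel_measurable N"
    if "f \<in> N \<rightarrow>\<^sub>M borel" "g \<in> N \<rightarrow>\<^sub>M borel" for N :: "(('a option \<times> 'a) \<times> 'a) measure" and f g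
    using measurable_compose[OF measurable_Pair[OF that] Suc] by simp
  have "(\<lambda>p. \<integral>\<^sup>+z. rho_iter \<rho> k (fst p) z * ennreal (\<rho> (Some z) (snd p)) \<partial>(lborel :: 'a measure)) \<in> borel_measurable (borel \<Otimes>\<^sub>M borel)"
    by (rule lborel.borel_measurable_nn_integral) measurable
  then show ?case by simp
qed

lemma measurable_rho_iter [measurable (raw)]:
  assumes "f \<in> N \<rightarrow>\<^sub>M borel" "g \<in> N \<rightarrow>\<^sub>M borel"
  shows "(\<lambda>w. rho_iter \<rho> k (f w) (g w)) \<in> borel_measurable N"
  using measurable_compose[OF measurable_Pair[OF assms] measurable_rho_iter0] by simp

text \<open>Chapman-Kolmogorov. Index \<open>k\<close> means \<open>k + 1\<close> steps, so the
  indices \<open>k\<close> and \<open>l\<close> compose to \<open>k + l + 1\<close>.\<close>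

lemma rho_iter_add:
  "rho_iter \<rho> (Suc (k + l)) x y = (\<integral>\<^sup>+z. rho_iter \<rho> k x z * rho_iter \<rho> l (Some z) y \<partial>lborel)"
proof (induction l arbitrary: y)
  case 0
  then show ?case by simp
next
  case (Suc l)
  have "rho_iter \<rho> (Suc (k + Suc l)) x y = (\<integral>\<^sup>+w. (\<integral>\<^sup>+z. rho_iter \<rho> k x z * rho_iter \<rho> l (Some z) w \<partial>lborel) * ennreal (\<rho> (Some w) y) \<partial>lborel)"
    using Suc by simp
  also have "\<dots> = (\<integral>\<^sup>+w. \<integral>\<^sup>+z. rho_iter \<rho> k x z * rho_iter \<rho> l (Some z) w * ennreal (\<rho> (Some w) y) \<partial>lborel \<partial>lborel)"
    by (intro nn_integral_cong nn_integral_multc[symmetric]) measurable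
  also have "\<dots> = (\<integral>\<^sup>+z. \<integral>\<^sup>+w. rho_iter \<rho> k x z * rho_iter \<rho> l (Some z) w * ennreal (\<rho> (Some w) y) \<partial>lborel \<partial>lborel)"
    by (rule lborel_pair.Fubini') measurable
  also have "\<dots> = (\<integral>\<^sup>+z. rho_iter \<rho> k x z * rho_iter \<rho> (Suc l) (Some z) y \<partial>lborel)"
    by (simp add: mult.assoc nn_integral_cmult)
  finally show ?case .
qed

lemma rho_liminf:
  assumes "u \<longlonglongrightarrow> x" "v \<longlonglongrightarrow> y"
  shows "ennreal (\<rho> x y) \<le> liminf (\<lambda>n. ennreal (\<rho> (u n) (v n)))"
proof (unfold le_Liminf_iff, intro allI impI)
  fix a assume a: "a < ennreal (\<rho> x y)"
  then obtain b where b: "a = ennreal b" "0 \<le> b"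
    by (cases a) auto
  have "b < \<rho> x y" using a b by (simp add: ennreal_less_iff)
  moreover have "open {p. b < (\<lambda>(x, y). \<rho> x y) p}" using rho_lsc unfolding lsc_def by blast
  ultimately have "eventually (\<lambda>n. (u n, v n) \<in> {p. b < (\<lambda>(x, y). \<rho> x y) p}) sequentially"
    by (intro topological_tendstoD[OF tendsto_Pair[OF assms]]) auto
  then show "eventually (\<lambda>n. a < ennreal (\<rho> (u n) (v n))) sequentially"
    by eventually_elim (use b in \<open>auto simp: ennreal_less_iff\<close>)
qed

text \<open>Fatou's lemma carries lower semicontinuity through the integral over the intermediate
  point. Both variables move at once because the links between compact sets need joint lower
  semicontinuity.\<close>

lemma rho_iter_liminf:
  assumes "u \<longlonglongrightarrow> x" "v \<longlonglongrightarrow> y"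
  shows "rho_iter \<rho> k x y \<le> liminf (\<lambda>n. rho_iter \<rho> k (u n) (v n))"
  using assms
proof (induction k arbitrary: u v x y)
  case 0
  then show ?case using rho_liminf by simp
next
  case (Suc k)
  have "rho_iter \<rho> (Suc k) x y = (\<integral>\<^sup>+z. rho_iter \<rho> k x z * rho_iter \<rho> 0 (Some z) y \<partial>lborel)" by simp
  also have "\<dots> \<le> (\<integral>\<^sup>+z. liminf (\<lambda>n. rho_iter \<rho> k (u n) z * rho_iter \<rho> 0 (Some z) (v n)) \<partial>lborel)"
  proof (intro nn_integral_mono)
    fix z
    have "rho_iter \<rho> k x z * rho_iter \<rho> 0 (Some z) y
        \<le> liminf (\<lambda>n. rho_iter \<rho> k (u n) z) * liminf (\<lambda>n. rho_iter \<rho> 0 (Some z) (v n))"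
      by (intro mult_mono Suc.IH Suc.prems) (use rho_liminf[OF tendsto_const Suc.prems(2)] in auto)
    also have "\<dots> \<le> liminf (\<lambda>n. rho_iter \<rho> k (u n) z * rho_iter \<rho> 0 (Some z) (v n))"
      by (rule liminf_mult_ennreal)
    finally show "rho_iter \<rho> k x z * rho_iter \<rho> 0 (Some z) y \<le> liminf (\<lambda>n. rho_iter \<rho> k (u n) z * rho_iter \<rho> 0 (Some z) (v n))" .
  qed
  also have "\<dots> \<le> liminf (\<lambda>n. \<integral>\<^sup>+z. rho_iter \<rho> k (u n) z * rho_iter \<rho> 0 (Some z) (v n) \<partial>lborel)"
    by (rule nn_integral_liminf) measurable
  finally show ?case by simp
qed

text \<open>Restricting the start to \<open>Some\<close> leaves a metric space, in which closed
  sublevel sets can be checked along sequences. The isolated start \<open>None\<close> is covered by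
  the version in the second variable alone.\<close>

lemma open_rho_iter_pair: "open {p. a < rho_iter \<rho> k (Some (fst p)) (snd p)}"
proof -
  have "closed {p. rho_iter \<rho> k (Some (fst p)) (snd p) \<le> a}"
    unfolding closed_sequential_limits
  proof (intro allI impI)
    fix w l assume w: "(\<forall>n. w n \<in> {p. rho_iter \<rho> k (Some (fst p)) (snd p) \<le> a}) \<and> w \<longlonglongrightarrow> l"
    have "rho_iter \<rho> k (Some (fst l)) (snd l) \<le> liminf (\<lambda>n. rho_iter \<rho> k (Some (fst (w n))) (snd (w n)))"
      using w by (intro rho_iter_liminf tendsto_Some tendsto_fst tendsto_snd) auto
    also have "\<dots> \<le> liminf (\<lambda>n::nat. a)"
      using w by (intro Liminf_mono) auto
    finally show "l \<in> {p. rho_iter \<rho> k (Some (fst p)) (snd p) \<le> a}" by (simp add: Liminf_const)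
  qed
  then have "open (- {p. rho_iter \<rho> k (Some (fst p)) (snd p) \<le> a})" by (rule open_Compl)
  also have "- {p. rho_iter \<rho> k (Some (fst p)) (snd p) \<le> a} = {p. a < rho_iter \<rho> k (Some (fst p)) (snd p)}"
    by auto
  finally show ?thesis .
qed

lemma open_rho_iter_right: "open {y. a < rho_iter \<rho> k x y}"
proof -
  have "closed {y. rho_iter \<rho> k x y \<le> a}"
    unfolding closed_sequential_limits
  proof (intro allI impI)
    fix w l assume w: "(\<forall>n. w n \<in> {y. rho_iter \<rho> k x y \<le> a}) \<and> w \<longlonglongrightarrow> l"
    have "rho_iter \<rho> k x l \<le> liminf (\<lambda>n. rho_iter \<rho> k x (w n))"
      using w by (intro rho_iter_liminf) auto
    also have "\<dots> \<le> liminf (\<lambda>n::nat. a)"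
      using w by (intro Liminf_mono) auto
    finally show "l \<in> {y. rho_iter \<rho> k x y \<le> a}" by (simp add: Liminf_const)
  qed
  then have "open (- {y. rho_iter \<rho> k x y \<le> a})" by (rule open_Compl)
  also have "- {y. rho_iter \<rho> k x y \<le> a} = {y. a < rho_iter \<rho> k x y}" by auto
  finally show ?thesis .
qed

lemma open_rho_iter_left: "open {x. a < rho_iter \<rho> k (Some x) y}"
proof -
  have "open ((\<lambda>x. (x, y)) -` {p. a < rho_iter \<rho> k (Some (fst p)) (snd p)})"
    by (intro open_vimage open_rho_iter_pair continuous_intros)
  then show ?thesis by (simp add: vimage_def)
qed

section \<open>Communicating classes\<close>

text \<open>Positivity of \<open>rho_tilde\<close>, read off one iterate at a time. By lower
  semicontinuity it is an open condition, so reachability can be discussed at points instead of up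
  to null sets.\<close>

definition arrow :: "'a option \<Rightarrow> 'a \<Rightarrow> bool" where
  "arrow x y \<longleftrightarrow> (\<exists>k. 0 < rho_iter \<rho> k x y)"

text \<open>A nonempty open set is not negligible; this is how positivity at a point becomes
  positivity of an integral.\<close>

lemma nn_integral_pos_open:
  fixes f :: "'a \<Rightarrow> ennreal"
  assumes [measurable]: "f \<in> borel_measurable borel" and "open S" "S \<noteq> {}" "\<And>z. z \<in> S \<Longrightarrow> 0 < f z"
  shows "0 < (\<integral>\<^sup>+z. f z \<partial>lborel)"
proof (rule ccontr)
  assume "\<not> 0 < (\<integral>\<^sup>+z. f z \<partial>lborel)"
  then have "AE z in lborel. f z = 0" by (simp add: nn_integral_0_iff_AE)
  then have "AE z in lborel. z \<notin> S"
    by eventually_elim (use assms(4) in force)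
  then have "S \<in> null_sets lborel"
    using assms(2) by (subst AE_iff_null_sets) auto
  then have "negligible S"
    using null_sets_completionI by (auto simp: negligible_iff_null_sets)
  then show False using assms(2,3) open_not_negligible by blast
qed

text \<open>The two factors are positive on open sets that both contain the intermediate point
  \<open>y\<close>, hence the Chapman-Kolmogorov integral is positive.\<close>

lemma arrow_trans:
  assumes "arrow x y" "arrow (Some y) z"
  shows "arrow x z"
proof -
  obtain k l where kl: "0 < rho_iter \<rho> k x y" "0 < rho_iter \<rho> l (Some y) z" using assms by (auto simp: arrow_def)
  have "0 < (\<integral>\<^sup>+w. rho_iter \<rho> k x w * rho_iter \<rho> l (Some w) z \<partial>lborel)"
    by (rule nn_integral_pos_open[where S = "{w. 0 < rho_iter \<rho> k x w} \<inter> {w. 0 < rho_iter \<rho> l (Some w) z}"])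
      (use kl in \<open>auto intro!: open_Int open_rho_iter_right open_rho_iter_left simp: ennreal_zero_less_mult_iff\<close>)
  then show ?thesis unfolding rho_iter_add[symmetric] arrow_def by blast
qed

lemma open_arrow_right: "open {y. arrow x y}"
proof -
  have "{y. arrow x y} = (\<Union>k. {y. 0 < rho_iter \<rho> k x y})" by (auto simp: arrow_def)
  then show ?thesis using open_rho_iter_right by auto
qed

lemma open_arrow_left: "open {x. arrow (Some x) y}"
proof -
  have "{x. arrow (Some x) y} = (\<Union>k. {x. 0 < rho_iter \<rho> k (Some x) y})" by (auto simp: arrow_def)
  then show ?thesis using open_rho_iter_left by auto
qed

lemma rho_tilde_pos_iff: "0 < rho_tilde \<rho> x y \<longleftrightarrow> arrow x y"
proof -
  have "rho_tilde \<rho> x y = 0 \<longleftrightarrow> (\<forall>k. ennreal ((1 / 2) ^ (k + 1)) * rho_iter \<rho> k x y = 0)"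
    unfolding rho_tilde_def by (rule suminf_eq_zero_iff) auto
  also have "\<dots> \<longleftrightarrow> (\<forall>k. rho_iter \<rho> k x y = 0)"
    by simp
  finally show ?thesis unfolding arrow_def by (metis not_gr_zero)
qed

lemma measurable_rho_tilde [measurable]: "rho_tilde \<rho> x \<in> borel_measurable borel"
  unfolding rho_tilde_def[abs_def] by measurable

text \<open>One reachable point of an open set comes with an open set of reachable points, which has
  positive mass.\<close>

lemma p_tilde_pos_iff:
  assumes "open S"
  shows "0 < p_tilde \<rho> x S \<longleftrightarrow> (\<exists>y\<in>S. arrow x y)"
proof
  assume "\<exists>y\<in>S. arrow x y"
  then show "0 < p_tilde \<rho> x S" unfolding p_tilde_def
    using assms open_arrow_right
    by (intro nn_integral_pos_open[where S = "{y. arrow x y} \<inter> S"]) 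
       (auto simp: rho_tilde_pos_iff)
next
  assume "0 < p_tilde \<rho> x S"
  show "\<exists>y\<in>S. arrow x y"
  proof (rule ccontr)
    assume "\<not> (\<exists>y\<in>S. arrow x y)"
    then have "rho_tilde \<rho> x y * indicator S y = 0" for y
      using rho_tilde_pos_iff[of x y] by (auto simp: indicator_def)
    then show False using \<open>0 < p_tilde \<rho> x S\<close> by (simp only: p_tilde_def) simp
  qed
qed

text \<open>The points that communicate with \<open>x\<close> form a communicating set containing
  \<open>A\<close>, and maximality of \<open>A\<close> identifies the two. Openness and disjointness
  of the classes follow from this description.\<close>

lemma class_eq:
  assumes "A \<in> comm_classes \<rho>" "x \<in> A"
  shows "A = {y. arrow (Some x) y \<and> arrow (Some y) x}"
proof -
  define B where "B = {y. arrow (Some x) y \<and> arrow (Some y) x}"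
  have A: "arrow (Some u) v" if "u \<in> A" "v \<in> A" for u v
    using assms that by (auto simp: comm_classes_def communicating_def rho_tilde_pos_iff)
  have "A \<subseteq> B" using A assms(2) by (auto simp: B_def)
  moreover have "communicating \<rho> B"
    using \<open>A \<subseteq> B\<close> assms(2) unfolding communicating_def rho_tilde_pos_iff
    by (auto simp: B_def intro: arrow_trans)
  ultimately show ?thesis using assms(1) unfolding comm_classes_def B_def by blast
qed

lemma arrow_in_class: "A \<in> comm_classes \<rho> \<Longrightarrow> x \<in> A \<Longrightarrow> y \<in> A \<Longrightarrow> arrow (Some x) y"
  by (auto simp: comm_classes_def communicating_def rho_tilde_pos_iff)

lemma class_nonempty: "A \<in> comm_classes \<rho> \<Longrightarrow> A \<noteq> {}"
  by (auto simp: comm_classes_def communicating_def)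

lemma class_open: "A \<in> comm_classes \<rho> \<Longrightarrow> open A"
proof -
  assume A: "A \<in> comm_classes \<rho>"
  then obtain x where "x \<in> A" using class_nonempty by auto
  have "open ({y. arrow (Some x) y} \<inter> {y. arrow (Some y) x})"
    by (intro open_Int open_arrow_left open_arrow_right)
  also have "{y. arrow (Some x) y} \<inter> {y. arrow (Some y) x} = A"
    unfolding class_eq[OF A \<open>x \<in> A\<close>] by auto
  finally show ?thesis .
qed

lemma class_disjoint:
  assumes "A \<in> comm_classes \<rho>" "B \<in> comm_classes \<rho>" "x \<in> A" "x \<in> B"
  shows "A = B"
  using class_eq[OF assms(1,3)] class_eq[OF assms(2,4)] by simp

lemma leads_to_iff:
  assumes "A \<in> comm_classes \<rho>" "B \<in> comm_classes \<rho>"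
  shows "leads_to \<rho> A B \<longleftrightarrow> (\<forall>x\<in>A. \<forall>y\<in>B. arrow (Some x) y)"
  using class_nonempty[OF assms(1)] class_nonempty[OF assms(2)] arrow_in_class[OF assms(2)]
  unfolding leads_to_def p_tilde_pos_iff[OF class_open[OF assms(2)]]
  by (metis all_not_in_conv arrow_trans)

text \<open>Points of one class reach each other, so one arrow between two classes produces all of
  them.\<close>

lemma leads_toI:
  assumes "A \<in> comm_classes \<rho>" "B \<in> comm_classes \<rho>" "x \<in> A" "y \<in> B" "arrow (Some x) y"
  shows "leads_to \<rho> A B"
  unfolding leads_to_iff[OF assms(1,2)]
  using assms arrow_in_class arrow_trans by blast

lemma init_leads_to_iff:
  assumes "B \<in> comm_classes \<rho>"
  shows "init_leads_to \<rho> B \<longleftrightarrow> (\<forall>y\<in>B. arrow None y)"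
  using class_nonempty[OF assms] arrow_in_class[OF assms]
  unfolding init_leads_to_def p_tilde_pos_iff[OF class_open[OF assms]]
  by (metis all_not_in_conv arrow_trans)

lemma init_leads_toI: "B \<in> comm_classes \<rho> \<Longrightarrow> y \<in> B \<Longrightarrow> arrow None y \<Longrightarrow> init_leads_to \<rho> B"
  unfolding init_leads_to_def p_tilde_pos_iff[OF class_open] by blast

lemma leads_to_refl: "A \<in> comm_classes \<rho> \<Longrightarrow> leads_to \<rho> A A"
  by (simp add: leads_to_iff arrow_in_class)

lemma leads_to_trans:
  assumes "A \<in> comm_classes \<rho>" "B \<in> comm_classes \<rho>" "D \<in> comm_classes \<rho>" "leads_to \<rho> A B" "leads_to \<rho> B D"
  shows "leads_to \<rho> A D"
  using assms class_nonempty[OF assms(2)] arrow_trans by (auto simp: leads_to_iff) blast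

lemma leads_to_antisym:
  assumes "A \<in> comm_classes \<rho>" "B \<in> comm_classes \<rho>" "leads_to \<rho> A B" "leads_to \<rho> B A"
  shows "A = B"
proof -
  obtain x y where xy: "x \<in> A" "y \<in> B"
    using class_nonempty[OF assms(1)] class_nonempty[OF assms(2)] by auto
  then have "y \<in> A"
    using assms(3,4) by (subst class_eq[OF assms(1) xy(1)]) (auto simp: leads_to_iff assms(1,2))
  from class_disjoint[OF assms(1,2) this xy(2)] show ?thesis .
qed

text \<open>The number of steps may depend on the two points; only its bound and the lower bound of
  the density are uniform. Hence \<open>block_lower\<close> has to choose a common number of steps
  by pigeonhole.\<close>

definition links :: "nat \<Rightarrow> 'a option set \<Rightarrow> 'a set \<Rightarrow> bool" where
  "links N S T \<longleftrightarrow> (\<forall>x\<in>S. \<forall>y\<in>T. \<exists>k<N. ennreal (1 / real N) \<le> rho_iter \<rho> k x y)"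

text \<open>Stated for all large \<open>N\<close>, so that the finitely many links of a frame can
  share one value.\<close>

lemma links_Some:
  assumes "compact S" "compact T" "\<And>x y. x \<in> S \<Longrightarrow> y \<in> T \<Longrightarrow> arrow (Some x) y"
  shows "\<forall>\<^sub>F N in sequentially. links N (Some ` S) T"
proof -
  have "\<exists>N. \<forall>n\<ge>N. \<forall>p\<in>S \<times> T. \<exists>k<n. ennreal (1 / real n) \<le> rho_iter \<rho> k (Some (fst p)) (snd p)"
    using assms by (intro compact_uniform_positive compact_Times open_rho_iter_pair) (auto simp: arrow_def)
  then show ?thesis by (auto simp: links_def eventually_sequentially)
qed

lemma links_None:
  assumes "compact T" "\<And>y. y \<in> T \<Longrightarrow> arrow None y"
  shows "\<forall>\<^sub>F N in sequentially. links N {None} T"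
proof -
  have "\<exists>N. \<forall>n\<ge>N. \<forall>y\<in>T. \<exists>k<n. ennreal (1 / real n) \<le> rho_iter \<rho> k None y"
    using assms by (intro compact_uniform_positive open_rho_iter_right) (auto simp: arrow_def)
  then show ?thesis by (auto simp: links_def eventually_sequentially)
qed

end

section \<open>Laws of finite paths\<close>

abbreviation path_space :: "(nat \<Rightarrow> 'a::topological_space) measure" where
  "path_space \<equiv> PiM UNIV (\<lambda>_. borel)"

context bounded_density
begin

definition step :: "'a option \<Rightarrow> 'a measure" where
  "step x = density lborel (\<lambda>y. ennreal (\<rho> x y))"

lemma measurable_step [measurable]: "step \<in> borel \<rightarrow>\<^sub>M prob_algebra borel"
proof (rule measurable_prob_algebraI)
  show p: "prob_space (step x)" for x
    by (rule prob_spaceI) (simp add: step_def emeasure_density rho_prob)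
  show "step \<in> borel \<rightarrow>\<^sub>M subprob_algebra borel"
  proof (rule measurable_subprob_algebra)
    fix B :: "'a set" assume [measurable]: "B \<in> sets borel"
    have "(\<lambda>x. \<integral>\<^sup>+y. ennreal (\<rho> x y) * indicator B y \<partial>(lborel :: 'a measure)) \<in> borel_measurable borel"
      by measurable
    then show "(\<lambda>x. emeasure (step x) B) \<in> borel_measurable borel"
      by (simp add: step_def emeasure_density)
  qed (use p in \<open>auto simp: step_def intro: prob_space_imp_subprob_space\<close>)
qed

text \<open>The starting point is not recorded, and coordinates beyond the last step are 0, in
  agreement with the padding of \<open>chain_path\<close>.\<close>

primrec path_law :: "nat \<Rightarrow> 'a option \<Rightarrow> (nat \<Rightarrow> 'a) measure" where
  "path_law 0 = (\<lambda>x. return path_space (\<lambda>_. 0))"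
| "path_law (Suc n) = (\<lambda>x. step x \<bind> (\<lambda>y. distr (path_law n (Some y)) path_space (case_nat y)))"

lemma measurable_case_nat_pair [measurable]:
  "(\<lambda>(y, \<eta>). case_nat y \<eta>) \<in> borel \<Otimes>\<^sub>M path_space \<rightarrow>\<^sub>M (path_space :: (nat \<Rightarrow> 'a) measure)"
  unfolding split_beta by (rule measurable_case_nat') measurable

lemma measurable_path_law [measurable]: "path_law n \<in> borel \<rightarrow>\<^sub>M prob_algebra path_space"
proof (induction n)
  case 0
  have "return path_space (\<lambda>_. 0 :: 'a) \<in> space (prob_algebra path_space)"
    by (simp add: space_prob_algebra prob_space_return space_PiM)
  then show ?case by simp
next
  case (Suc n)
  note [measurable] = Suc
  show ?case unfolding path_law.simps by measurable
qed

lemma nn_integral_step: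
  assumes "f \<in> borel_measurable borel"
  shows "(\<integral>\<^sup>+y. f y \<partial>step x) = (\<integral>\<^sup>+y. ennreal (\<rho> x y) * f y \<partial>lborel)"
  unfolding step_def using assms by (intro nn_integral_density) measurable

lemma nn_integral_path_law_0:
  assumes "F \<in> borel_measurable path_space"
  shows "(\<integral>\<^sup>+\<eta>. F \<eta> \<partial>path_law 0 x) = F (\<lambda>_. 0)"
  using assms by (simp add: nn_integral_return space_PiM)

lemma measurable_nn_integral_path_law [measurable (raw)]:
  assumes "(\<lambda>(z, \<eta>). F z \<eta>) \<in> borel_measurable (N \<Otimes>\<^sub>M path_space)" "g \<in> N \<rightarrow>\<^sub>M borel"
  shows "(\<lambda>z. \<integral>\<^sup>+\<eta>. F z \<eta> \<partial>path_law n (g z)) \<in> borel_measurable N"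
  by (rule nn_integral_measurable_subprob_algebra2[OF assms(1)]
      measurable_prob_algebraD[OF measurable_compose[OF assms(2) measurable_path_law]])+

lemma nn_integral_path_law_Suc:
  assumes F[measurable]: "F \<in> borel_measurable path_space"
  shows "(\<integral>\<^sup>+\<eta>. F \<eta> \<partial>path_law (Suc n) x) =
    (\<integral>\<^sup>+y. ennreal (\<rho> x y) * (\<integral>\<^sup>+\<eta>. F (case_nat y \<eta>) \<partial>path_law n (Some y)) \<partial>lborel)"
proof -
  have s: "sets (step x) = sets borel" by (simp add: step_def)
  have pl: "sets (path_law n z) = sets path_space" for z
    using measurable_space[OF measurable_path_law, of z n] by (simp add: space_prob_algebra)
  have m: "(\<lambda>y. distr (path_law n (Some y)) path_space (case_nat y)) \<in> step x \<rightarrow>\<^sub>M subprob_algebra path_space"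
    unfolding measurable_cong_sets[OF s refl] by (rule measurable_prob_algebraD) measurable
  have "(\<integral>\<^sup>+\<eta>. F \<eta> \<partial>path_law (Suc n) x) = (\<integral>\<^sup>+y. \<integral>\<^sup>+\<eta>. F \<eta> \<partial>distr (path_law n (Some y)) path_space (case_nat y) \<partial>step x)"
    unfolding path_law.simps by (rule nn_integral_bind[OF F m])
  also have "\<dots> = (\<integral>\<^sup>+y. \<integral>\<^sup>+\<eta>. F (case_nat y \<eta>) \<partial>path_law n (Some y) \<partial>step x)"
  proof (intro nn_integral_cong nn_integral_distr)
    fix y
    show "case_nat y \<in> path_law n (Some y) \<rightarrow>\<^sub>M path_space"
      unfolding measurable_cong_sets[OF pl refl] by measurable
  qed measurable
  also have "\<dots> = (\<integral>\<^sup>+y. ennreal (\<rho> x y) * (\<integral>\<^sup>+\<eta>. F (case_nat y \<eta>) \<partial>path_law n (Some y)) \<partial>lborel)"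
    by (intro nn_integral_step) measurable
  finally show ?thesis .
qed

text \<open>Here \<open>l\<close> counts steps: the block consists of \<open>y\<close> and \<open>l\<close> further points.\<close>

definition start_prob :: "nat \<Rightarrow> (nat \<Rightarrow> 'a) set \<Rightarrow> 'a \<Rightarrow> ennreal" where
  "start_prob l G y = (\<integral>\<^sup>+\<eta>. indicator G (case_nat y \<eta>) \<partial>path_law l (Some y))"

text \<open>Neither the time nor the point from which the block is entered appears, which is what
  allows a block to be moved and repeated. By \<open>ennreal_mass\<close> no infinite value is lost
  when the starting points lie in a set of finite measure.\<close>

definition mass :: "nat \<Rightarrow> (nat \<Rightarrow> 'a) set \<Rightarrow> real" where
  "mass l G = enn2real (\<integral>\<^sup>+y. start_prob l G y \<partial>lborel)"

definition block_set :: "'a set \<Rightarrow> (nat \<Rightarrow> 'a) set \<Rightarrow> bool" where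
  "block_set U G \<longleftrightarrow> emeasure lborel U < \<infinity> \<and> U \<in> sets borel \<and> G \<in> sets path_space \<and> (\<forall>\<eta>\<in>G. \<eta> 0 \<in> U)"

lemma mass_nonneg: "0 \<le> mass l G"
  by (simp add: mass_def)

lemma measurable_start_prob [measurable]:
  assumes [measurable]: "G \<in> sets path_space"
  shows "start_prob l G \<in> borel_measurable borel"
  unfolding start_prob_def[abs_def] by measurable

lemma start_prob_le:
  assumes "block_set U G"
  shows "start_prob l G y \<le> indicator U y"
proof -
  have [measurable]: "G \<in> sets path_space" using assms by (simp add: block_set_def)
  interpret prob_space "path_law l (Some y)"
    using measurable_space[OF measurable_path_law, of "Some y" l] by (simp add: space_prob_algebra)
  have "start_prob l G y \<le> (\<integral>\<^sup>+\<eta>. indicator U y \<partial>path_law l (Some y))"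
    unfolding start_prob_def using assms
    by (intro nn_integral_mono) (auto simp: block_set_def indicator_def)
  also have "\<dots> = indicator U y" using emeasure_space_1 by simp
  finally show ?thesis .
qed

lemma ennreal_mass:
  assumes "block_set U G"
  shows "ennreal (mass l G) = (\<integral>\<^sup>+y. start_prob l G y \<partial>lborel)"
proof -
  have "(\<integral>\<^sup>+y. start_prob l G y \<partial>lborel) \<le> (\<integral>\<^sup>+y. indicator U y \<partial>lborel)"
    by (intro nn_integral_mono start_prob_le[OF assms])
  also have "\<dots> < \<infinity>" using assms by (simp add: block_set_def)
  finally show ?thesis unfolding mass_def by simp
qed

end

section \<open>The Markov property\<close>

definition chain_path :: "(nat \<Rightarrow> 'w \<Rightarrow> 'a::zero) \<Rightarrow> nat \<Rightarrow> nat \<Rightarrow> 'w \<Rightarrow> nat \<Rightarrow> 'a" where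
  "chain_path X t n \<omega> = (\<lambda>i. if i < n then X (Suc (t + i)) \<omega> else 0)"

lemma chain_path_0: "chain_path X t 0 \<omega> = (\<lambda>_. 0)"
  by (simp add: chain_path_def)

lemma chain_path_Suc: "chain_path X t (Suc n) \<omega> = case_nat (X (Suc t) \<omega>) (chain_path X (Suc t) n \<omega>)"
  by (auto simp: chain_path_def fun_eq_iff split: nat.split)

lemma space_past [simp]: "space (past M X t) = space M"
  by (simp add: past_def space_measure_of_conv)

lemma sets_past: "sets (past M X t) = sigma_sets (space M) {X i -` B \<inter> space M | i B. 1 \<le> i \<and> i \<le> t \<and> B \<in> sets borel}"
  unfolding past_def by (rule sets_measure_of) auto

lemma past_subalgebra:
  assumes "\<And>n. n \<ge> 1 \<Longrightarrow> X n \<in> M \<rightarrow>\<^sub>M borel"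
  shows "subalgebra M (past M X t)"
  unfolding subalgebra_def space_past
proof (intro conjI refl)
  show "sets (past M X t) \<subseteq> sets M"
    unfolding sets_past using assms by (intro sets.sigma_sets_subset) (auto intro: measurable_sets)
qed

text \<open>State \<open>None\<close> at time 0 makes the initial law one more transition. The
  Markov property is recorded as an identity of measures on rectangles of past events and Borel
  sets, the form in which it extends to all functions of the past and the next point.\<close>

locale density_chain = bounded_density \<rho> R + prob_space M
  for \<rho> :: "'a::euclidean_space option \<Rightarrow> 'a \<Rightarrow> real" and R and M :: "'w measure" +
  fixes X :: "nat \<Rightarrow> 'w \<Rightarrow> 'a" and Y :: "nat \<Rightarrow> 'w \<Rightarrow> 'a option"
  assumes X_measurable [measurable]: "\<And>n. n \<ge> 1 \<Longrightarrow> X n \<in> M \<rightarrow>\<^sub>M borel"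
    and Y_eq: "\<And>t. Y t = (\<lambda>\<omega>. if t = 0 then None else Some (X t \<omega>))"
    and one_step: "\<And>t A B. A \<in> sets (past M X t) \<Longrightarrow> B \<in> sets borel \<Longrightarrow>
      emeasure M {\<omega>\<in>A. X (Suc t) \<omega> \<in> B} =
      (\<integral>\<^sup>+\<omega>. indicator A \<omega> * (\<integral>\<^sup>+y. ennreal (\<rho> (Y t \<omega>) y) * indicator B y \<partial>lborel) \<partial>M)"
begin

lemma past_mono: "s \<le> t \<Longrightarrow> sets (past M X s) \<subseteq> sets (past M X t)"
  unfolding sets_past by (rule sigma_sets_mono') (blast intro: le_trans)

lemma subalgebra_past: "subalgebra M (past M X t)"
  by (rule past_subalgebra) (rule X_measurable)

lemma sets_past_sets: "A \<in> sets (past M X t) \<Longrightarrow> A \<in> sets M"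
  using subalgebra_past by (auto simp: subalgebra_def)

lemma measurable_X_past: "1 \<le> i \<Longrightarrow> i \<le> t \<Longrightarrow> X i \<in> past M X t \<rightarrow>\<^sub>M borel"
  by (rule measurableI) (auto simp: sets_past intro!: sigma_sets.Basic)

lemma measurable_Y_past [measurable]: "Y t \<in> past M X t \<rightarrow>\<^sub>M borel"
  using measurable_X_past[of t t] unfolding Y_eq by (cases "t = 0") auto

lemma measurable_past_pair_mono:
  assumes "f \<in> past M X s \<Otimes>\<^sub>M K \<rightarrow>\<^sub>M N" "s \<le> t"
  shows "f \<in> past M X t \<Otimes>\<^sub>M K \<rightarrow>\<^sub>M N"
proof -
  have [measurable]: "(\<lambda>\<omega>. \<omega>) \<in> past M X t \<rightarrow>\<^sub>M past M X s"
    using past_mono[OF assms(2)] by (auto simp: measurable_def)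
  have "(\<lambda>(\<omega>, y). (\<omega>, y)) \<in> past M X t \<Otimes>\<^sub>M K \<rightarrow>\<^sub>M past M X s \<Otimes>\<^sub>M K"
    by measurable
  from measurable_compose[OF this assms(1)] show ?thesis by simp
qed

lemma measurable_chain_path_past: "t + n \<le> s \<Longrightarrow> chain_path X t n \<in> past M X s \<rightarrow>\<^sub>M path_space"
  unfolding chain_path_def
proof (rule measurable_PiM_single')
  fix i assume "t + n \<le> s"
  then show "(\<lambda>\<omega>. if i < n then X (Suc (t + i)) \<omega> else 0) \<in> past M X s \<rightarrow>\<^sub>M borel"
    using measurable_X_past[of "Suc (t + i)" s] by (cases "i < n") auto
qed auto

text \<open>Both sides integrate \<open>H\<close> against measures on pairs of past and next point.
  These measures agree on rectangles by \<open>one_step\<close>, hence everywhere.\<close>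

lemma nn_integral_one_step:
  assumes H: "(\<lambda>(\<omega>, y). H \<omega> y) \<in> borel_measurable (past M X t \<Otimes>\<^sub>M borel)"
  shows "(\<integral>\<^sup>+\<omega>. H \<omega> (X (Suc t) \<omega>) \<partial>M) = (\<integral>\<^sup>+\<omega>. \<integral>\<^sup>+y. ennreal (\<rho> (Y t \<omega>) y) * H \<omega> y \<partial>lborel \<partial>M)"
proof -
  let ?P = "past M X t" and ?E = "{a \<times> b | a b. a \<in> sets (past M X t) \<and> b \<in> sets (borel :: 'a measure)}"
  \<comment> \<open>The product with Lebesgue measure has to live on the sigma-algebra of the past,
    so \<open>M\<close> is restricted to it first.\<close>
  define P where "P = restr_to_subalg M ?P"
  have sP[measurable_cong]: "sets P = sets ?P" and spP: "space P = space M"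
    using subalgebra_past by (auto simp: P_def sets_restr_to_subalg space_restr_to_subalg)
  have id[measurable]: "(\<lambda>\<omega>. \<omega>) \<in> M \<rightarrow>\<^sub>M ?P"
    using subalgebra_past by (auto simp: measurable_def subalgebra_def)
  have pair[measurable]: "(\<lambda>\<omega>. (\<omega>, X (Suc t) \<omega>)) \<in> M \<rightarrow>\<^sub>M ?P \<Otimes>\<^sub>M borel"
    by measurable
  have nnP: "(\<integral>\<^sup>+\<omega>. f \<omega> \<partial>P) = (\<integral>\<^sup>+\<omega>. f \<omega> \<partial>M)" if "f \<in> borel_measurable ?P" for f
    unfolding P_def by (rule nn_integral_subalgebra2[OF subalgebra_past that])
  define m1 where "m1 = distr M (?P \<Otimes>\<^sub>M borel) (\<lambda>\<omega>. (\<omega>, X (Suc t) \<omega>))"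
  define m2 where "m2 = density (P \<Otimes>\<^sub>M (lborel :: 'a measure)) (\<lambda>(\<omega>, y). ennreal (\<rho> (Y t \<omega>) y))"
  have s2: "sets m2 = sets (?P \<Otimes>\<^sub>M borel)" unfolding m2_def using sP by (simp cong: sets_pair_measure_cong)
  have m2: "(\<integral>\<^sup>+z. f z \<partial>m2) = (\<integral>\<^sup>+\<omega>. \<integral>\<^sup>+y. ennreal (\<rho> (Y t \<omega>) y) * f (\<omega>, y) \<partial>lborel \<partial>M)"
    if f[measurable]: "f \<in> borel_measurable (?P \<Otimes>\<^sub>M borel)" for f
  proof -
    have "(\<integral>\<^sup>+z. f z \<partial>m2) = (\<integral>\<^sup>+z. (case z of (\<omega>, y) \<Rightarrow> ennreal (\<rho> (Y t \<omega>) y)) * f z \<partial>(P \<Otimes>\<^sub>M lborel))"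
      unfolding m2_def by (intro nn_integral_density) measurable
    also have "\<dots> = (\<integral>\<^sup>+\<omega>. \<integral>\<^sup>+y. ennreal (\<rho> (Y t \<omega>) y) * f (\<omega>, y) \<partial>lborel \<partial>P)"
    proof -
      have "(\<lambda>z. (case z of (\<omega>, y) \<Rightarrow> ennreal (\<rho> (Y t \<omega>) y)) * f z) \<in> borel_measurable (P \<Otimes>\<^sub>M lborel)"
        by measurable
      from lborel.nn_integral_fst[OF this] show ?thesis by simp
    qed
    also have "\<dots> = (\<integral>\<^sup>+\<omega>. \<integral>\<^sup>+y. ennreal (\<rho> (Y t \<omega>) y) * f (\<omega>, y) \<partial>lborel \<partial>M)"
      by (intro nnP) measurable
    finally show ?thesis .
  qed
  have "m1 = m2"
  proof (rule measure_eqI_generator_eq[OF Int_stable_pair_measure_generator[of ?P borel], where \<Omega> = "space ?P \<times> space borel" and A = "\<lambda>_. space ?P \<times> space borel"])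
    show "?E \<subseteq> Pow (space ?P \<times> space borel)"
      using sets.space_closed[of ?P] by auto
    show "sets m1 = sigma_sets (space ?P \<times> space borel) ?E" by (simp add: m1_def sets_pair_measure)
    show "sets m2 = sigma_sets (space ?P \<times> space borel) ?E" by (simp add: s2 sets_pair_measure)
    show "range (\<lambda>_::nat. space ?P \<times> space borel) \<subseteq> ?E"
      using sets.top[of ?P] sets.top[of "borel :: 'a measure"] by (blast intro: image_subsetI)
    interpret m1: prob_space m1 unfolding m1_def using pair by (rule prob_space_distr)
    show "emeasure m1 (space ?P \<times> space borel) \<noteq> \<infinity>"
      using m1.emeasure_finite by simp
    fix E assume "E \<in> ?E"
    then obtain A B where E: "E = A \<times> B" and [measurable]: "A \<in> sets ?P" "B \<in> sets borel" by auto
    have "emeasure m1 E = emeasure M {\<omega>\<in>A. X (Suc t) \<omega> \<in> B}"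
    proof -
      have "(\<lambda>\<omega>. (\<omega>, X (Suc t) \<omega>)) -` (A \<times> B) \<inter> space M = {\<omega>\<in>A. X (Suc t) \<omega> \<in> B}"
        using sets.sets_into_space[OF sets_past_sets[OF \<open>A \<in> sets ?P\<close>]] by auto
      then show ?thesis unfolding m1_def E by (subst emeasure_distr[OF pair]) auto
    qed
    also have "\<dots> = (\<integral>\<^sup>+\<omega>. indicator A \<omega> * (\<integral>\<^sup>+y. ennreal (\<rho> (Y t \<omega>) y) * indicator B y \<partial>lborel) \<partial>M)"
      by (rule one_step) fact+
    also have "\<dots> = (\<integral>\<^sup>+\<omega>. \<integral>\<^sup>+y. ennreal (\<rho> (Y t \<omega>) y) * indicator E (\<omega>, y) \<partial>lborel \<partial>M)"
      by (rule nn_integral_cong) (simp add: E indicator_def)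
    also have "\<dots> = (\<integral>\<^sup>+z. indicator E z \<partial>m2)"
      by (rule m2[symmetric]) (simp add: E)
    also have "\<dots> = emeasure m2 E"
      by (rule nn_integral_indicator) (auto simp: s2 E)
    finally show "emeasure m1 E = emeasure m2 E" .
  qed auto
  have "(\<integral>\<^sup>+\<omega>. H \<omega> (X (Suc t) \<omega>) \<partial>M) = (\<integral>\<^sup>+z. (case z of (\<omega>, y) \<Rightarrow> H \<omega> y) \<partial>m1)"
    unfolding m1_def by (subst nn_integral_distr[OF pair]) (use H in simp_all)
  also have "\<dots> = (\<integral>\<^sup>+\<omega>. \<integral>\<^sup>+y. ennreal (\<rho> (Y t \<omega>) y) * H \<omega> y \<partial>lborel \<partial>M)"
    unfolding \<open>m1 = m2\<close> by (subst m2[OF H]) simp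
  finally show ?thesis .
qed

text \<open>The last step is integrated out first; the induction hypothesis applies to the resulting
  function of the point before it, and Tonelli recovers the iterated density.\<close>

lemma nn_integral_iter_step:
  assumes H: "(\<lambda>(\<omega>, y). H \<omega> y) \<in> borel_measurable (past M X t \<Otimes>\<^sub>M borel)"
  shows "(\<integral>\<^sup>+\<omega>. H \<omega> (X (Suc (t + k)) \<omega>) \<partial>M) = (\<integral>\<^sup>+\<omega>. \<integral>\<^sup>+y. rho_iter \<rho> k (Y t \<omega>) y * H \<omega> y \<partial>lborel \<partial>M)"
  using H
proof (induction k arbitrary: H)
  case 0
  then show ?case using nn_integral_one_step[OF 0] by simp
next
  case (Suc k)
  note H[measurable] = Suc.prems
  have "(\<integral>\<^sup>+\<omega>. H \<omega> (X (Suc (t + Suc k)) \<omega>) \<partial>M) =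
      (\<integral>\<^sup>+\<omega>. \<integral>\<^sup>+y. ennreal (\<rho> (Y (Suc (t + k)) \<omega>) y) * H \<omega> y \<partial>lborel \<partial>M)"
    using nn_integral_one_step[OF measurable_past_pair_mono[OF H], of "Suc (t + k)"] by simp
  also have "\<dots> = (\<integral>\<^sup>+\<omega>. (\<lambda>\<omega> z. \<integral>\<^sup>+y. ennreal (\<rho> (Some z) y) * H \<omega> y \<partial>lborel) \<omega> (X (Suc (t + k)) \<omega>) \<partial>M)"
    by (simp add: Y_eq)
  also have "\<dots> = (\<integral>\<^sup>+\<omega>. \<integral>\<^sup>+z. rho_iter \<rho> k (Y t \<omega>) z * (\<integral>\<^sup>+y. ennreal (\<rho> (Some z) y) * H \<omega> y \<partial>lborel) \<partial>lborel \<partial>M)"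
    by (intro Suc.IH) measurable
  also have "\<dots> = (\<integral>\<^sup>+\<omega>. \<integral>\<^sup>+y. rho_iter \<rho> (Suc k) (Y t \<omega>) y * H \<omega> y \<partial>lborel \<partial>M)"
  proof (rule nn_integral_cong)
    fix \<omega> assume "\<omega> \<in> space M"
    then have [measurable]: "(\<lambda>y. H \<omega> y) \<in> borel_measurable borel"
      using measurable_compose[OF measurable_Pair1' H, of \<omega>] by simp
    have "(\<integral>\<^sup>+z. rho_iter \<rho> k (Y t \<omega>) z * (\<integral>\<^sup>+y. ennreal (\<rho> (Some z) y) * H \<omega> y \<partial>lborel) \<partial>lborel)
        = (\<integral>\<^sup>+z. \<integral>\<^sup>+y. rho_iter \<rho> k (Y t \<omega>) z * (ennreal (\<rho> (Some z) y) * H \<omega> y) \<partial>lborel \<partial>lborel)"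
      by (intro nn_integral_cong nn_integral_cmult[symmetric]) measurable
    also have "\<dots> = (\<integral>\<^sup>+y. \<integral>\<^sup>+z. rho_iter \<rho> k (Y t \<omega>) z * (ennreal (\<rho> (Some z) y) * H \<omega> y) \<partial>lborel \<partial>lborel)"
      by (rule lborel_pair.Fubini') measurable
    also have "\<dots> = (\<integral>\<^sup>+y. rho_iter \<rho> (Suc k) (Y t \<omega>) y * H \<omega> y \<partial>lborel)"
      by (simp add: nn_integral_multc flip: mult.assoc)
    finally show "(\<integral>\<^sup>+z. rho_iter \<rho> k (Y t \<omega>) z * (\<integral>\<^sup>+y. ennreal (\<rho> (Some z) y) * H \<omega> y \<partial>lborel) \<partial>lborel)
        = (\<integral>\<^sup>+y. rho_iter \<rho> (Suc k) (Y t \<omega>) y * H \<omega> y \<partial>lborel)" .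
  qed
  finally show ?case .
qed

text \<open>Since \<open>F\<close> may depend on the past, the induction can absorb the first new
  point into the past and advance \<open>t\<close>.\<close>

lemma nn_integral_path:
  assumes "(\<lambda>(\<omega>, \<eta>). F \<omega> \<eta>) \<in> borel_measurable (past M X t \<Otimes>\<^sub>M path_space)"
  shows "(\<integral>\<^sup>+\<omega>. F \<omega> (chain_path X t n \<omega>) \<partial>M) = (\<integral>\<^sup>+\<omega>. \<integral>\<^sup>+\<eta>. F \<omega> \<eta> \<partial>path_law n (Y t \<omega>) \<partial>M)"
  using assms
proof (induction n arbitrary: t F)
  case 0
  have "F \<omega> \<in> borel_measurable path_space" if "\<omega> \<in> space M" for \<omega>
    using measurable_compose[OF measurable_Pair1' 0, of \<omega>] that by simp
  then show ?case by (auto simp: chain_path_0 nn_integral_path_law_0 simp del: path_law.simps intro!: nn_integral_cong)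
next
  case (Suc n)
  note F[measurable] = Suc.prems
  have F'[measurable]: "(\<lambda>(\<omega>, \<eta>). F \<omega> \<eta>) \<in> borel_measurable (past M X (Suc t) \<Otimes>\<^sub>M path_space)"
    by (rule measurable_past_pair_mono[OF F]) simp
  have [measurable]: "X (Suc t) \<in> past M X (Suc t) \<rightarrow>\<^sub>M borel" by (rule measurable_X_past) auto
  have "(\<integral>\<^sup>+\<omega>. F \<omega> (chain_path X t (Suc n) \<omega>) \<partial>M) = 
     (\<integral>\<^sup>+\<omega>. (\<lambda>\<omega> \<eta>. F \<omega> (case_nat (X (Suc t) \<omega>) \<eta>)) \<omega> (chain_path X (Suc t) n \<omega>) \<partial>M)"
    by (simp add: chain_path_Suc)
  also have "\<dots> = (\<integral>\<^sup>+\<omega>. \<integral>\<^sup>+\<eta>. F \<omega> (case_nat (X (Suc t) \<omega>) \<eta>) \<partial>path_law n (Y (Suc t) \<omega>) \<partial>M)"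
    by (intro Suc.IH) measurable
  also have "\<dots> = (\<integral>\<^sup>+\<omega>. (\<lambda>\<omega> y. \<integral>\<^sup>+\<eta>. F \<omega> (case_nat y \<eta>) \<partial>path_law n (Some y)) \<omega> (X (Suc t) \<omega>) \<partial>M)"
    by (simp add: Y_eq)
  also have "\<dots> = (\<integral>\<^sup>+\<omega>. \<integral>\<^sup>+y. ennreal (\<rho> (Y t \<omega>) y) * (\<integral>\<^sup>+\<eta>. F \<omega> (case_nat y \<eta>) \<partial>path_law n (Some y)) \<partial>lborel \<partial>M)"
    by (intro nn_integral_one_step) measurable
  also have "\<dots> = (\<integral>\<^sup>+\<omega>. \<integral>\<^sup>+\<eta>. F \<omega> \<eta> \<partial>path_law (Suc n) (Y t \<omega>) \<partial>M)"
  proof (intro nn_integral_cong nn_integral_path_law_Suc[symmetric])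
    fix \<omega> assume "\<omega> \<in> space M"
    then show "F \<omega> \<in> borel_measurable path_space"
      using measurable_compose[OF measurable_Pair1' F, of \<omega>] by simp
  qed
  finally show ?case .
qed

definition block_event :: "nat \<Rightarrow> nat \<Rightarrow> (nat \<Rightarrow> 'a) set \<Rightarrow> 'w set" where
  "block_event t l G = {\<omega> \<in> space M. chain_path X t (Suc l) \<omega> \<in> G}"

lemma block_event_past:
  assumes "G \<in> sets path_space" "t + l < s"
  shows "block_event t l G \<in> sets (past M X s)"
proof -
  have "chain_path X t (Suc l) -` G \<inter> space (past M X s) \<in> sets (past M X s)"
    using assms by (intro measurable_sets[OF measurable_chain_path_past]) auto
  then show ?thesis by (simp add: block_event_def vimage_def Int_def conj_commute)
qed

text \<open>The \<open>k\<close> free points before the block enter only through the iterated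
  density, the block only through its first point.\<close>

lemma emeasure_block:
  assumes A[measurable]: "A \<in> sets (past M X t)" and G[measurable]: "G \<in> sets path_space"
  shows "emeasure M (A \<inter> block_event (t + k) l G) =
    (\<integral>\<^sup>+\<omega>. indicator A \<omega> * (\<integral>\<^sup>+y. rho_iter \<rho> k (Y t \<omega>) y * start_prob l G y \<partial>lborel) \<partial>M)"
proof -
  let ?s = "Suc (t + k)"
  have A'[measurable]: "A \<in> sets (past M X ?s)" using past_mono[of t ?s] A by auto
  have [measurable]: "X ?s \<in> past M X ?s \<rightarrow>\<^sub>M borel" by (rule measurable_X_past) auto
  have AM: "A \<in> sets M" using A by (rule sets_past_sets)
  have B: "block_event (t + k) l G \<in> sets M"
    by (rule sets_past_sets[OF block_event_past[OF G, of _ _ "Suc (t + k + l)"]]) simp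
  have "emeasure M (A \<inter> block_event (t + k) l G) = (\<integral>\<^sup>+\<omega>. indicator (A \<inter> block_event (t + k) l G) \<omega> \<partial>M)"
    using AM B by simp
  also have "\<dots> = (\<integral>\<^sup>+\<omega>. (\<lambda>\<omega> \<eta>. indicator A \<omega> * indicator G (case_nat (X ?s \<omega>) \<eta>)) \<omega> (chain_path X ?s l \<omega>) \<partial>M)"
    by (intro nn_integral_cong) (auto simp: block_event_def chain_path_Suc split: split_indicator)
  also have "\<dots> = (\<integral>\<^sup>+\<omega>. \<integral>\<^sup>+\<eta>. indicator A \<omega> * indicator G (case_nat (X ?s \<omega>) \<eta>) \<partial>path_law l (Y ?s \<omega>) \<partial>M)"
    by (intro nn_integral_path) measurable
  also have "\<dots> = (\<integral>\<^sup>+\<omega>. (\<lambda>\<omega> y. indicator A \<omega> * start_prob l G y) \<omega> (X ?s \<omega>) \<partial>M)"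
    by (intro nn_integral_cong) (auto simp: Y_eq start_prob_def split: split_indicator)
  also have "\<dots> = (\<integral>\<^sup>+\<omega>. \<integral>\<^sup>+y. rho_iter \<rho> k (Y t \<omega>) y * (indicator A \<omega> * start_prob l G y) \<partial>lborel \<partial>M)"
    by (intro nn_integral_iter_step) measurable
  also have "\<dots> = (\<integral>\<^sup>+\<omega>. indicator A \<omega> * (\<integral>\<^sup>+y. rho_iter \<rho> k (Y t \<omega>) y * start_prob l G y \<partial>lborel) \<partial>M)"
    by (intro nn_integral_cong) (auto split: split_indicator)
  finally show ?thesis .
qed

text \<open>Bounding the density of the first point by \<open>R\<close> replaces its law by Lebesgue
  measure, whatever the past.\<close>

lemma block_upper:
  assumes A: "A \<in> sets (past M X t)" and G: "block_set U G"
  shows "prob (A \<inter> block_event t l G) \<le> R * mass l G * prob A"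
proof -
  have Gm[measurable]: "G \<in> sets path_space" using G by (simp add: block_set_def)
  have AM[measurable]: "A \<in> sets M" using A by (rule sets_past_sets)
  have "emeasure M (A \<inter> block_event (t + 0) l G) =
    (\<integral>\<^sup>+\<omega>. indicator A \<omega> * (\<integral>\<^sup>+y. rho_iter \<rho> 0 (Y t \<omega>) y * start_prob l G y \<partial>lborel) \<partial>M)"
    by (rule emeasure_block[OF A Gm])
  also have "\<dots> \<le> (\<integral>\<^sup>+\<omega>. indicator A \<omega> * (\<integral>\<^sup>+y. ennreal R * start_prob l G y \<partial>lborel) \<partial>M)"
    by (intro nn_integral_mono mult_left_mono mult_right_mono) (auto intro: ennreal_leI rho_le)
  also have "\<dots> = ennreal R * ennreal (mass l G) * emeasure M A"
    by (simp add: nn_integral_cmult nn_integral_multc ennreal_mass[OF G] mult_ac)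
  also have "\<dots> = ennreal (R * mass l G * prob A)"
    using R_pos mass_nonneg by (simp add: emeasure_eq_measure ennreal_mult)
  finally show ?thesis
    using R_pos mass_nonneg by (simp add: emeasure_eq_measure)
qed

text \<open>For each state and each first point in \<open>U\<close>, one of the \<open>N\<close>
  iterated densities is at least \<open>1 / N\<close>, hence so is their sum. The best single
  \<open>k\<close> keeps at least a further fraction \<open>1 / N\<close> of that sum; this accounts
  for the square.\<close>

lemma block_lower:
  assumes A: "A \<in> sets (past M X t)" and G: "block_set U G"
    and S: "\<And>\<omega>. \<omega> \<in> A \<Longrightarrow> Y t \<omega> \<in> S" and N: "links N S U" "0 < N"
  shows "\<exists>k<N. mass l G / (real N)\<^sup>2 * prob A \<le> prob (A \<inter> block_event (t + k) l G)"
proof (rule ccontr)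
  assume neg: "\<not> ?thesis"
  have Gm[measurable]: "G \<in> sets path_space" using G by (simp add: block_set_def)
  have AM[measurable]: "A \<in> sets M" using A by (rule sets_past_sets)
  have [measurable]: "Y t \<in> M \<rightarrow>\<^sub>M borel" by (rule measurable_from_subalg[OF subalgebra_past measurable_Y_past])
  have start: "ennreal (1 / real N) * start_prob l G y \<le> (\<Sum>k<N. rho_iter \<rho> k x y * start_prob l G y)"
    if x: "x \<in> S" for x y
  proof (cases "y \<in> U")
    case True
    then obtain k where k: "k < N" "ennreal (1 / real N) \<le> rho_iter \<rho> k x y"
      using N(1) x by (auto simp: links_def)
    have "rho_iter \<rho> k x y * start_prob l G y \<le> (\<Sum>k<N. rho_iter \<rho> k x y * start_prob l G y)"
      using k(1) by (intro member_le_sum) auto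
    with mult_right_mono[OF k(2), of "start_prob l G y"] show ?thesis by simp
  next
    case False
    then have "start_prob l G y = 0" using start_prob_le[OF G, of l y] by simp
    then show ?thesis by simp
  qed
  have "ennreal (1 / real N) * ennreal (mass l G) * emeasure M A =
      (\<integral>\<^sup>+\<omega>. indicator A \<omega> * (\<integral>\<^sup>+y. ennreal (1 / real N) * start_prob l G y \<partial>lborel) \<partial>M)"
    by (simp add: nn_integral_cmult nn_integral_multc ennreal_mass[OF G] mult_ac)
  also have "\<dots> \<le> (\<integral>\<^sup>+\<omega>. indicator A \<omega> * (\<integral>\<^sup>+y. (\<Sum>k<N. rho_iter \<rho> k (Y t \<omega>) y * start_prob l G y) \<partial>lborel) \<partial>M)"
    using start S by (intro nn_integral_mono) (auto intro!: nn_integral_mono split: split_indicator)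
  also have "\<dots> = (\<integral>\<^sup>+\<omega>. (\<Sum>k<N. indicator A \<omega> * (\<integral>\<^sup>+y. rho_iter \<rho> k (Y t \<omega>) y * start_prob l G y \<partial>lborel)) \<partial>M)"
    by (intro nn_integral_cong, subst nn_integral_sum) (measurable, rule sum_distrib_left)
  also have "\<dots> = (\<Sum>k<N. emeasure M (A \<inter> block_event (t + k) l G))"
    unfolding emeasure_block[OF A Gm] by (rule nn_integral_sum) measurable
  also have "\<dots> = ennreal (\<Sum>k<N. prob (A \<inter> block_event (t + k) l G))"
    by (simp add: emeasure_eq_measure)
  finally have "ennreal (1 / real N * mass l G * prob A) \<le> ennreal (\<Sum>k<N. prob (A \<inter> block_event (t + k) l G))"
    using mass_nonneg[of l G] by (simp add: emeasure_eq_measure ennreal_mult[symmetric])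
  then have "1 / real N * mass l G * prob A \<le> (\<Sum>k<N. prob (A \<inter> block_event (t + k) l G))"
    by (subst (asm) ennreal_le_iff) (auto intro: sum_nonneg)
  also have "\<dots> < (\<Sum>k<N. mass l G / (real N)\<^sup>2 * prob A)"
    using neg N(2) by (intro sum_strict_mono) (auto simp: not_le)
  also have "\<dots> = 1 / real N * mass l G * prob A"
    using N(2) by (simp add: power2_eq_square)
  finally show False by simp
qed

text \<open>A point with vanishing iterated density is almost surely avoided: the indicator of the
  zero set is integrated against that very density. Every statement about the order of visits comes
  from here.\<close>

lemma AE_arrow: "AE \<omega> in M. \<forall>s k. arrow (Y s \<omega>) (X (Suc (s + k)) \<omega>)"
  unfolding AE_all_countable
proof (intro allI)
  fix s k
  let ?H = "\<lambda>\<omega> y. indicator {0} (rho_iter \<rho> k (Y s \<omega>) y) :: ennreal"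
  have [measurable]: "Y s \<in> M \<rightarrow>\<^sub>M borel" by (rule measurable_from_subalg[OF subalgebra_past measurable_Y_past])
  have "(\<integral>\<^sup>+\<omega>. ?H \<omega> (X (Suc (s + k)) \<omega>) \<partial>M) = (\<integral>\<^sup>+\<omega>. \<integral>\<^sup>+y. rho_iter \<rho> k (Y s \<omega>) y * ?H \<omega> y \<partial>lborel \<partial>M)"
    by (rule nn_integral_iter_step) measurable
  also have "\<dots> = (\<integral>\<^sup>+\<omega>. \<integral>\<^sup>+y. 0 \<partial>(lborel :: 'a measure) \<partial>M)"
    by (intro nn_integral_cong) (auto split: split_indicator)
  also have "\<dots> = 0" by simp
  finally have "AE \<omega> in M. ?H \<omega> (X (Suc (s + k)) \<omega>) = 0"
    by (subst (asm) nn_integral_0_iff_AE) auto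
  then show "AE \<omega> in M. arrow (Y s \<omega>) (X (Suc (s + k)) \<omega>)"
    by eventually_elim (auto simp: arrow_def indicator_def zero_less_iff_neq_zero split: if_splits)
qed

end

section \<open>Chains of blocks\<close>

text \<open>A timed block \<open>(t, l, G)\<close> occupies the times \<open>t + 1, \<dots>, t + l + 1\<close>.\<close>

definition before :: "nat \<times> nat \<times> 'g \<Rightarrow> nat \<times> nat \<times> 'g \<Rightarrow> bool" where
  "before b b' \<longleftrightarrow> fst b + fst (snd b) < fst b'"

definition block_length :: "nat \<times> nat \<times> 'g \<Rightarrow> nat" where
  "block_length b = Suc (fst (snd b))"

definition block_sum :: "(nat \<Rightarrow> real) \<Rightarrow> nat \<times> nat \<times> 'g \<Rightarrow> real" where
  "block_sum g b = (\<Sum>i\<le>fst (snd b). g (Suc (fst b + i)))"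

lemma block_sum_eq: "block_sum g (t, l, G) = sum g {t<..t + Suc l}"
proof -
  have "sum g {t<..t + Suc l} = (\<Sum>i\<in>(\<lambda>i. Suc (t + i)) ` {..l}. g i)"
  proof (rule arg_cong[where f="sum g"], rule set_eqI)
    fix k show "k \<in> {t<..t + Suc l} \<longleftrightarrow> k \<in> (\<lambda>i. Suc (t + i)) ` {..l}"
      by (auto simp: image_iff intro!: bexI[of _ "k - Suc t"])
  qed
  also have "\<dots> = (\<Sum>i\<le>l. g (Suc (t + i)))"
    by (subst sum.reindex) (auto simp: inj_on_def)
  finally show ?thesis by (simp add: block_sum_def)
qed

text \<open>Times outside the blocks contribute at most 1 each. Removing the last block lowers the
  horizon from \<open>n\<close> to the time \<open>t\<close> before that block, which is why
  \<open>n\<close> is arbitrary in the induction.\<close>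

lemma sum_blocks:
  assumes "\<And>k. \<bar>g k\<bar> \<le> 1" "sorted_wrt before bs" "\<And>t l G. (t, l, G) \<in> set bs \<Longrightarrow> t + l < n"
  shows "\<bar>(\<Sum>k=1..n. g k) - (\<Sum>b\<leftarrow>bs. block_sum g b)\<bar> \<le> real n - real (\<Sum>b\<leftarrow>bs. block_length b)"
  using assms(2,3)
proof (induction bs arbitrary: n rule: rev_induct)
  case Nil
  have "\<bar>\<Sum>k=1..n. g k\<bar> \<le> (\<Sum>k=1..n. \<bar>g k\<bar>)" by (rule sum_abs)
  also have "\<dots> \<le> (\<Sum>k=1..n. 1)" using assms(1) by (intro sum_mono) auto
  finally show ?case by simp
next
  case (snoc b bs)
  obtain t l G where b: "b = (t, l, G)" by (cases b)
  have n: "t + l < n" using snoc.prems(2) b by auto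
  have IH: "\<bar>(\<Sum>k=1..t. g k) - (\<Sum>b\<leftarrow>bs. block_sum g b)\<bar> \<le> real t - real (\<Sum>b\<leftarrow>bs. block_length b)"
  proof (rule snoc.IH)
    show "sorted_wrt before bs" using snoc.prems(1) by (simp add: sorted_wrt_append)
    fix t' l' G' assume "(t', l', G') \<in> set bs"
    then show "t' + l' < t" using snoc.prems(1) b by (auto simp: sorted_wrt_append before_def)
  qed
  have "{1..n} = ({1..t} \<union> {t<..t + Suc l}) \<union> {t + Suc l<..n}" using n by auto
  then have "(\<Sum>k=1..n. g k) = sum g ({1..t} \<union> {t<..t + Suc l}) + sum g {t + Suc l<..n}"
    by (simp only:) (rule sum.union_disjoint, auto)
  also have "sum g ({1..t} \<union> {t<..t + Suc l}) = sum g {1..t} + sum g {t<..t + Suc l}"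
    by (rule sum.union_disjoint) auto
  finally have eq: "(\<Sum>k=1..n. g k) = (\<Sum>k=1..t. g k) + block_sum g b + sum g {t + Suc l<..n}"
    by (simp add: b block_sum_eq)
  have "\<bar>sum g {t + Suc l<..n}\<bar> \<le> (\<Sum>k\<in>{t + Suc l<..n}. \<bar>g k\<bar>)" by (rule sum_abs)
  also have "\<dots> \<le> (\<Sum>k\<in>{t + Suc l<..n}. 1)" using assms(1) by (intro sum_mono) auto
  also have "\<dots> = real n - real t - real (Suc l)" using n by (simp add: of_nat_diff)
  finally have "\<bar>sum g {t + Suc l<..n}\<bar> \<le> real n - real t - real (Suc l)" .
  with IH eq show ?case by (simp add: b block_length_def)
qed

lemma sum_blocks_weak:
  assumes "\<And>k. 0 \<le> g k" "sorted_wrt before bs" "\<And>t l G. (t, l, G) \<in> set bs \<Longrightarrow> t + l < n"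
  shows "(\<Sum>b\<leftarrow>bs. block_sum g b) \<le> (\<Sum>k=1..n. g k)"
  using assms(2,3)
proof (induction bs arbitrary: n rule: rev_induct)
  case Nil
  then show ?case using assms(1) by (simp add: sum_nonneg)
next
  case (snoc b bs)
  obtain t l G where b: "b = (t, l, G)" by (cases b)
  have n: "t + l < n" using snoc.prems(2) b by auto
  have IH: "(\<Sum>b\<leftarrow>bs. block_sum g b) \<le> (\<Sum>k=1..t. g k)"
  proof (rule snoc.IH)
    show "sorted_wrt before bs" using snoc.prems(1) by (simp add: sorted_wrt_append)
    fix t' l' G' assume "(t', l', G') \<in> set bs"
    then show "t' + l' < t" using snoc.prems(1) b by (auto simp: sorted_wrt_append before_def)
  qed
  have "(\<Sum>k=1..t. g k) + block_sum g b = sum g ({1..t} \<union> {t<..t + Suc l})"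
    unfolding b block_sum_eq by (subst sum.union_disjoint) auto
  also have "\<dots> \<le> (\<Sum>k=1..n. g k)"
    using n assms(1) by (intro sum_mono2) auto
  finally show ?case using IH by simp
qed

context density_chain
begin

definition chain_event :: "(nat \<times> nat \<times> (nat \<Rightarrow> 'a) set) list \<Rightarrow> 'w set" where
  "chain_event bs = {\<omega> \<in> space M. \<forall>(t, l, G)\<in>set bs. \<omega> \<in> block_event t l G}"

lemma chain_event_snoc: "chain_event (bs @ [(t, l, G)]) = chain_event bs \<inter> block_event t l G"
  by (auto simp: chain_event_def block_event_def)

lemma chain_event_past:
  assumes "\<And>t l G. (t, l, G) \<in> set bs \<Longrightarrow> t + l < s \<and> G \<in> sets path_space"
  shows "chain_event bs \<in> sets (past M X s)"
  using assms
proof (induction bs rule: rev_induct)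
  case Nil
  then show ?case using sets.top[of "past M X s"] by (simp add: chain_event_def)
next
  case (snoc b bs)
  obtain t l G where b: "b = (t, l, G)" by (cases b)
  have "chain_event bs \<in> sets (past M X s)" "t + l < s" "G \<in> sets path_space"
    using snoc.IH snoc.prems[of t l G] snoc.prems b by auto
  then show ?case unfolding b chain_event_snoc by (intro sets.Int block_event_past)
qed

lemma block_event_measurable: "G \<in> sets path_space \<Longrightarrow> block_event t l G \<in> events"
  by (rule sets_past_sets[OF block_event_past[of G t l "Suc (t + l)"]]) auto

lemma chain_event_measurable:
  assumes "\<And>t l G. (t, l, G) \<in> set bs \<Longrightarrow> G \<in> sets path_space"
  shows "chain_event bs \<in> events"
  using assms
proof (induction bs rule: rev_induct)
  case Nil
  then show ?case by (simp add: chain_event_def)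
next
  case (snoc b bs)
  obtain t l G where b: "b = (t, l, G)" by (cases b)
  have "chain_event bs \<in> events" "G \<in> sets path_space" using snoc b by auto
  then show ?case unfolding b chain_event_snoc by (intro sets.Int block_event_measurable)
qed

text \<open>When a block is appended, all earlier blocks belong to the past at its time
  \<open>t\<close>, so \<open>block_upper\<close> contributes one factor per block.\<close>

lemma chain_upper:
  assumes "sorted_wrt before bs" "\<And>t l G. (t, l, G) \<in> set bs \<Longrightarrow> \<exists>U. block_set U G"
  shows "prob (chain_event bs) \<le> (\<Prod>(t, l, G)\<leftarrow>bs. R * mass l G)"
  using assms
proof (induction bs rule: rev_induct)
  case Nil
  then show ?case by simp
next
  case (snoc b bs)
  obtain t l G where b: "b = (t, l, G)" by (cases b)
  obtain U where U: "block_set U G" using snoc.prems(2)[of t l G] b by auto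
  have "chain_event bs \<in> sets (past M X t)"
  proof (rule chain_event_past)
    fix t' l' G' assume m: "(t', l', G') \<in> set bs"
    obtain U' where "block_set U' G'" using snoc.prems(2)[of t' l' G'] m by auto
    moreover have "before (t', l', G') b" using snoc.prems(1) m by (simp add: sorted_wrt_append)
    ultimately show "t' + l' < t \<and> G' \<in> sets path_space" by (simp add: b before_def block_set_def)
  qed
  then have "prob (chain_event (bs @ [b])) \<le> R * mass l G * prob (chain_event bs)"
    unfolding b chain_event_snoc by (rule block_upper[OF _ U])
  also have "\<dots> \<le> R * mass l G * (\<Prod>(t, l, G)\<leftarrow>bs. R * mass l G)"
  proof (intro mult_left_mono snoc.IH)
    show "sorted_wrt before bs" using snoc.prems(1) by (simp add: sorted_wrt_append)
    show "0 \<le> R * mass l G" using R_pos mass_nonneg[of l G] by simp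
  qed (use snoc.prems(2) in auto)
  finally show ?case by (simp add: b mult_ac)
qed

text \<open>The gaps between consecutive blocks are chosen by pigeonhole among the \<open>N\<close> lengths
  provided by \<^const>\<open>links\<close>.\<close>

lemma chain_lower:
  fixes V :: "'i \<Rightarrow> 'a set" and bs :: "('i \<times> nat \<times> (nat \<Rightarrow> 'a) set) list"
  assumes "0 < N"
    and "\<And>i l G. (i, l, G) \<in> set bs \<Longrightarrow> block_set (V i) G \<and> (\<forall>\<eta>\<in>G. \<eta> l \<in> V i) \<and> links N {None} (V i)"
    and "sorted_wrt (\<lambda>b b'. links N (Some ` V (fst b)) (V (fst b'))) bs"
  shows "\<exists>tbs e. map snd tbs = map snd bs \<and> sorted_wrt before tbs \<and> e \<le> (\<Sum>(i, l, G)\<leftarrow>bs. Suc l + N) \<and>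
      (\<forall>(t, l, G)\<in>set tbs. t + l < e) \<and>
      (\<forall>\<omega>\<in>chain_event tbs. Y e \<omega> \<in> (if bs = [] then {None} else Some ` V (fst (last bs)))) \<and>
      (\<Prod>(i, l, G)\<leftarrow>bs. mass l G / (real N)\<^sup>2) \<le> prob (chain_event tbs)"
  using assms(2,3)
proof (induction bs rule: rev_induct)
  case Nil
  then show ?case
    \<comment> \<open>At time 0 the state is \<open>None\<close>, so the first block is reached by
      the same argument as the later ones.\<close>
    by (intro exI[of _ "[]"] exI[of _ 0]) (auto simp: chain_event_def Y_eq prob_space)
next
  case (snoc b bs)
  obtain i l G where b: "b = (i, l, G)" by (cases b)
  have sw: "sorted_wrt (\<lambda>b b'. links N (Some ` V (fst b)) (V (fst b'))) bs"
    using snoc.prems(2) by (simp add: sorted_wrt_append)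
  have pr: "block_set (V i) G \<and> (\<forall>\<eta>\<in>G. \<eta> l \<in> V i) \<and> links N {None} (V i)" if "(i, l, G) \<in> set bs" for i l G
    using snoc.prems(1)[of i l G] that by simp
  from snoc.IH[OF pr sw] obtain tbs e where tbs: "map snd tbs = map snd bs" "sorted_wrt before tbs"
      "e \<le> (\<Sum>(i, l, G)\<leftarrow>bs. Suc l + N)" "\<forall>(t, l, G)\<in>set tbs. t + l < e"
      "\<forall>\<omega>\<in>chain_event tbs. Y e \<omega> \<in> (if bs = [] then {None} else Some ` V (fst (last bs)))"
      "(\<Prod>(i, l, G)\<leftarrow>bs. mass l G / (real N)\<^sup>2) \<le> prob (chain_event tbs)"
    by blast
  have G: "block_set (V i) G" "\<And>\<eta>. \<eta> \<in> G \<Longrightarrow> \<eta> l \<in> V i" "links N {None} (V i)"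
    using snoc.prems(1)[of i l G] b by auto
  have bsG: "G' \<in> sets path_space" if "(t', l', G') \<in> set tbs" for t' l' G'
  proof -
    have "(l', G') \<in> set (map snd tbs)" using that by force
    then obtain i' where "(i', l', G') \<in> set bs" unfolding tbs(1) by force
    then show ?thesis using snoc.prems(1)[of i' l' G'] by (auto simp: block_set_def)
  qed
  have past: "chain_event tbs \<in> sets (past M X e)"
    using tbs(4) bsG by (intro chain_event_past) auto
  have "links N (Some ` V (fst (last bs))) (V i)" if "bs \<noteq> []"
    using snoc.prems(2) b last_in_set[OF that] by (simp add: sorted_wrt_append)
  then have "links N (if bs = [] then {None} else Some ` V (fst (last bs))) (V i)"
    using G(3) by simp
  from block_lower[OF past G(1) _ this assms(1)] tbs(5)
  obtain k where k: "k < N" "mass l G / (real N)\<^sup>2 * prob (chain_event tbs) \<le> prob (chain_event tbs \<inter> block_event (e + k) l G)"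
    by blast
  have "(\<Prod>(i, l, G)\<leftarrow>bs @ [b]. mass l G / (real N)\<^sup>2) = mass l G / (real N)\<^sup>2 * (\<Prod>(i, l, G)\<leftarrow>bs. mass l G / (real N)\<^sup>2)"
    by (simp add: b)
  also have "\<dots> \<le> mass l G / (real N)\<^sup>2 * prob (chain_event tbs)"
    using tbs(6) mass_nonneg by (intro mult_left_mono) auto
  also have "\<dots> \<le> prob (chain_event (tbs @ [(e + k, l, G)]))"
    using k(2) by (simp add: chain_event_snoc)
  finally have prob: "(\<Prod>(i, l, G)\<leftarrow>bs @ [b]. mass l G / (real N)\<^sup>2) \<le> prob (chain_event (tbs @ [(e + k, l, G)]))" .
  have fin: "Y (e + k + l + 1) \<omega> \<in> Some ` V i" if "\<omega> \<in> chain_event (tbs @ [(e + k, l, G)])" for \<omega>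
  proof -
    have "chain_path X (e + k) (Suc l) \<omega> \<in> G" using that by (auto simp: chain_event_snoc block_event_def)
    from G(2)[OF this] show ?thesis by (simp add: Y_eq chain_path_def)
  qed
  \<comment> \<open>After time \<open>e\<close> come \<open>k\<close> free points and then the
    \<open>l + 1\<close> points of the block.\<close>
  show ?case
  proof (intro exI[of _ "tbs @ [(e + k, l, G)]"] exI[of _ "e + k + l + 1"] conjI)
    show "map snd (tbs @ [(e + k, l, G)]) = map snd (bs @ [b])" using tbs(1) b by simp
    show "sorted_wrt before (tbs @ [(e + k, l, G)])"
      using tbs(2,4) by (auto simp: sorted_wrt_append before_def dest!: bspec)
    show "e + k + l + 1 \<le> (\<Sum>(i, l, G)\<leftarrow>bs @ [b]. Suc l + N)" using tbs(3) k(1) b by simp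
    show "\<forall>(t', l', G')\<in>set (tbs @ [(e + k, l, G)]). t' + l' < e + k + l + 1"
      using tbs(4) by (auto dest!: bspec)
    show "\<forall>\<omega>\<in>chain_event (tbs @ [(e + k, l, G)]). Y (e + k + l + 1) \<omega> \<in> (if bs @ [b] = [] then {None} else Some ` V (fst (last (bs @ [b]))))"
      using fin b by auto
  qed (rule prob)
qed

end

section \<open>Decomposition of a path into blocks\<close>

text \<open>\<open>h\<close> will be proportional to the length of the path: the number of cells
  then stays bounded while every sum is known up to \<open>h\<close>. Both ends lie in
  \<open>U\<close>, so that links between the sets \<open>U\<close> can join such blocks.\<close>

definition cell_block :: "('a \<Rightarrow> real) set \<Rightarrow> real \<Rightarrow> 'a set \<Rightarrow> nat \<Rightarrow> (('a \<Rightarrow> real) \<Rightarrow> int) \<Rightarrow> (nat \<Rightarrow> 'a) set" where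
  "cell_block Fs h U l c = {\<eta>. \<eta> 0 \<in> U \<and> \<eta> l \<in> U \<and> (\<forall>f\<in>Fs. \<lfloor>(\<Sum>i\<le>l. f (\<eta> i)) / h\<rfloor> = c f)}"

lemma sets_cell_block:
  assumes "finite Fs" "\<And>f. f \<in> Fs \<Longrightarrow> f \<in> borel_measurable borel" "U \<in> sets borel"
  shows "cell_block Fs h U l c \<in> sets (path_space :: (nat \<Rightarrow> 'a::euclidean_space) measure)"
proof -
  have comp[measurable]: "(\<lambda>\<eta>. \<eta> i) \<in> path_space \<rightarrow>\<^sub>M (borel :: 'a measure)" for i :: nat by simp
  have "{\<eta> \<in> space path_space. \<forall>f\<in>Fs. \<lfloor>(\<Sum>i\<le>l. f (\<eta> i)) / h\<rfloor> = c f} \<in> sets (path_space :: (nat \<Rightarrow> 'a) measure)"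
  proof (rule sets.sets_Collect_finite_All)
    fix f assume "f \<in> Fs"
    then have [measurable]: "f \<in> borel_measurable borel" using assms(2) by simp
    show "{\<eta> \<in> space path_space. \<lfloor>(\<Sum>i\<le>l. f (\<eta> i)) / h\<rfloor> = c f} \<in> sets (path_space :: (nat \<Rightarrow> 'a) measure)"
      by measurable
  qed (use assms in auto)
  moreover note [measurable] = assms(3)
  have "{\<eta> \<in> space path_space. \<eta> 0 \<in> U \<and> \<eta> l \<in> U} \<in> sets (path_space :: (nat \<Rightarrow> 'a) measure)"
    by measurable
  ultimately have "{\<eta> \<in> space path_space. \<forall>f\<in>Fs. \<lfloor>(\<Sum>i\<le>l. f (\<eta> i)) / h\<rfloor> = c f} \<inter> {\<eta> \<in> space path_space. \<eta> 0 \<in> U \<and> \<eta> l \<in> U}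
     \<in> sets (path_space :: (nat \<Rightarrow> 'a) measure)" by (rule sets.Int)
  also have "{\<eta> \<in> space path_space. \<forall>f\<in>Fs. \<lfloor>(\<Sum>i\<le>l. f (\<eta> i)) / h\<rfloor> = c f} \<inter> {\<eta> \<in> space path_space. \<eta> 0 \<in> U \<and> \<eta> l \<in> U}
      = cell_block Fs h U l c"
    by (auto simp: cell_block_def space_PiM)
  finally show ?thesis .
qed

context density_chain
begin

text \<open>The interval of a class runs from the first to the last visit of its part. If the
  interval of a later class \<open>B\<close> began before that of \<open>A\<close> ended, there
  would be an arrow from \<open>B\<close> to \<open>A\<close>, and antisymmetry would identify the
  two classes.\<close>

lemma visit_intervals:
  fixes x :: "nat \<Rightarrow> 'a"
  assumes classes: "set ys \<subseteq> comm_classes \<rho>" "distinct ys" "sorted_wrt (leads_to \<rho>) ys"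
    and V: "\<And>A. A \<in> set ys \<Longrightarrow> V A \<subseteq> A"
    and arrow: "\<And>s t. 1 \<le> s \<Longrightarrow> s < t \<Longrightarrow> arrow (Some (x s)) (x t)"
    and visit: "\<And>A. A \<in> set ys \<Longrightarrow> \<exists>k\<in>{1..n}. x k \<in> V A"
  shows "\<exists>t l. (\<forall>A\<in>set ys. t A + l A < n \<and> x (Suc (t A)) \<in> V A \<and> x (Suc (t A + l A)) \<in> V A \<and>
      (\<forall>k\<in>{1..n}. x k \<in> V A \<longrightarrow> t A < k \<and> k \<le> Suc (t A + l A))) \<and>
    sorted_wrt (\<lambda>A B. t A + l A < t B) ys"
proof -
  define K where "K A = {k\<in>{1..n}. x k \<in> V A}" for A
  have K: "finite (K A)" "Min (K A) \<in> K A" "Max (K A) \<in> K A" "Min (K A) \<le> Max (K A)" if "A \<in> set ys" for A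
  proof -
    show fin: "finite (K A)" by (simp add: K_def)
    have "K A \<noteq> {}" using visit[OF that] by (auto simp: K_def)
    then show "Min (K A) \<in> K A" "Max (K A) \<in> K A" using fin by auto
    then show "Min (K A) \<le> Max (K A)" using fin by simp
  qed
  have KD: "1 \<le> k" "k \<le> n" "x k \<in> V A" if "k \<in> K A" for k A
    using that by (auto simp: K_def)
  \<comment> \<open>A block occupies the times after its \<open>t\<close>, hence the shift by
    1.\<close>
  define t where "t A = Min (K A) - 1" for A
  define l where "l A = Max (K A) - Min (K A)" for A
  have tl: "Suc (t A) = Min (K A)" "Suc (t A + l A) = Max (K A)" if "A \<in> set ys" for A
    using K(4)[OF that] KD(1)[OF K(2)[OF that]] by (simp_all add: t_def l_def)
  have ord: "Max (K A) < Min (K B)" if AB: "A \<in> set ys" "B \<in> set ys" "A \<noteq> B" "leads_to \<rho> A B" for A B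
  proof (rule ccontr)
    assume "\<not> ?thesis"
    then have le: "Min (K B) \<le> Max (K A)" by simp
    have xA: "x (Max (K A)) \<in> A" and xB: "x (Min (K B)) \<in> B"
      using KD(3)[OF K(3)[OF AB(1)]] KD(3)[OF K(2)[OF AB(2)]] V[OF AB(1)] V[OF AB(2)] by auto
    have cl: "A \<in> comm_classes \<rho>" "B \<in> comm_classes \<rho>" using AB classes by auto
    show False
    proof (cases "Min (K B) = Max (K A)")
      case True
      with xB have "x (Max (K A)) \<in> B" by simp
      from class_disjoint[OF cl xA this] AB(3) show False by simp
    next
      case False
      then have "arrow (Some (x (Min (K B)))) (x (Max (K A)))"
        using le KD(1)[OF K(2)[OF AB(2)]] by (intro arrow) auto
      from leads_toI[OF cl(2,1) xB xA this] leads_to_antisym[OF cl AB(4)] AB(3) show False by simp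
    qed
  qed
  have "t A + l A < t B" if "A \<in> set ys" "B \<in> set ys" "A \<noteq> B" "leads_to \<rho> A B" for A B
    using ord[OF that] tl(2)[OF that(1)] tl(1)[OF that(2)] by simp
  then have "sorted_wrt (\<lambda>A B. t A + l A < t B) ys"
    using classes(2,3) unfolding sorted_wrt_iff_nth_less by (simp add: nth_eq_iff_index_eq)
  moreover have "t A + l A < n \<and> x (Suc (t A)) \<in> V A \<and> x (Suc (t A + l A)) \<in> V A \<and>
      (\<forall>k\<in>{1..n}. x k \<in> V A \<longrightarrow> t A < k \<and> k \<le> Suc (t A + l A))" if A: "A \<in> set ys" for A
  proof (intro conjI ballI impI)
    show "x (Suc (t A)) \<in> V A" "x (Suc (t A + l A)) \<in> V A"
      using KD(3)[OF K(2)[OF A]] KD(3)[OF K(3)[OF A]] by (simp_all only: tl[OF A])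
    show "t A + l A < n" using KD(2)[OF K(3)[OF A]] tl(2)[OF A] by simp
    fix k assume "k \<in> {1..n}" "x k \<in> V A"
    then have k: "k \<in> K A" by (simp add: K_def)
    show "t A < k" using Min_le[OF K(1)[OF A] k] tl(1)[OF A] by simp
    show "k \<le> Suc (t A + l A)" using Max_ge[OF K(1)[OF A] k] tl(2)[OF A] by simp
  qed
  ultimately show ?thesis by blast
qed

text \<open>The factor in front of the product counts the possible positions of the blocks and the cells
  of their sums; it is subexponential in \<open>n\<close>.\<close>

lemma path_decomposition:
  fixes V :: "'a set \<Rightarrow> 'a set"
  assumes classes: "set ys \<subseteq> comm_classes \<rho>" "distinct ys" "sorted_wrt (leads_to \<rho>) ys"
    and V: "\<And>A. A \<in> set ys \<Longrightarrow> V A \<subseteq> A" "\<And>A. A \<in> set ys \<Longrightarrow> V A \<in> sets borel"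
      "\<And>A. A \<in> set ys \<Longrightarrow> emeasure lborel (V A) < \<infinity>"
    and Fs: "finite Fs" "\<And>f. f \<in> Fs \<Longrightarrow> f \<in> borel_measurable borel" "\<And>f x. f \<in> Fs \<Longrightarrow> \<bar>f x\<bar> \<le> (1::real)"
    and h: "0 < \<theta>" "0 < n" "h = \<theta> * real n"
    and W: "W \<in> events" "0 < prob W" "\<And>\<omega> A. \<omega> \<in> W \<Longrightarrow> A \<in> set ys \<Longrightarrow> \<exists>k\<in>{1..n}. X k \<omega> \<in> V A"
  obtains \<omega> t l c where "\<omega> \<in> W"
    "sorted_wrt (\<lambda>A B. t A + l A < t B) ys"
    "\<And>A. A \<in> set ys \<Longrightarrow> t A + l A < n"
    "\<And>A. A \<in> set ys \<Longrightarrow> chain_path X (t A) (Suc (l A)) \<omega> \<in> cell_block Fs h (V A) (l A) (c A)"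
    "\<And>A k. A \<in> set ys \<Longrightarrow> k \<in> {1..n} \<Longrightarrow> X k \<omega> \<in> V A \<Longrightarrow> t A < k \<and> k \<le> Suc (t A + l A)"
    "prob W \<le> (real ((n + 1)\<^sup>2 * (2 * nat \<lceil>1 / \<theta>\<rceil> + 1) ^ card Fs)) ^ length ys *
      (\<Prod>A\<leftarrow>ys. R * mass (l A) (cell_block Fs h (V A) (l A) (c A)))"
\<comment> \<open>Averaging: if every datum realized by a path of \<open>W\<close> had a bound
  \<open>q d\<close> below \<open>prob W / card D\<close>, the union bound over the data would make
  \<open>prob W\<close> smaller than itself.\<close>
proof (rule ccontr)
  assume neg: "\<not> thesis"
  note choose = that
  \<comment> \<open>Block sums are at most \<open>n\<close> in absolute value and
    \<open>h = \<theta> * n\<close>, so all cell indices lie between \<open>-m\<close> and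
    \<open>m\<close>, a range independent of \<open>n\<close>.\<close>
  define m where "m = \<lceil>1 / \<theta>\<rceil>"
  define D where "D = (set ys \<rightarrow>\<^sub>E ({..n} \<times> {..n} \<times> (Fs \<rightarrow>\<^sub>E {- m..m})))"
  define G where "G d A = cell_block Fs h (V A) (fst (snd (d A))) (snd (snd (d A)))" for d :: "'a set \<Rightarrow> nat \<times> nat \<times> (('a \<Rightarrow> real) \<Rightarrow> int)" and A
  define bs where "bs d = map (\<lambda>A. (fst (d A), fst (snd (d A)), G d A)) ys" for d
  define good where "good \<omega> d \<longleftrightarrow> \<omega> \<in> W \<and> sorted_wrt (\<lambda>A B. fst (d A) + fst (snd (d A)) < fst (d B)) ys \<and>
    (\<forall>A\<in>set ys. fst (d A) + fst (snd (d A)) < n \<and>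
      chain_path X (fst (d A)) (Suc (fst (snd (d A)))) \<omega> \<in> G d A \<and>
      (\<forall>k\<in>{1..n}. X k \<omega> \<in> V A \<longrightarrow> fst (d A) < k \<and> k \<le> Suc (fst (d A) + fst (snd (d A)))))" for \<omega> d
  define q where "q d = (\<Prod>A\<leftarrow>ys. R * mass (fst (snd (d A))) (G d A))" for d
  \<comment> \<open>Only data realized by a path of \<open>W\<close> compete, because such a path
    has to be returned together with the datum.\<close>
  define D' where "D' = {d \<in> D. \<exists>\<omega>. good \<omega> d}"
  have "0 < 1 / \<theta>" using h(1) by simp
  then have "- 1 < 1 / \<theta>" by linarith
  then have m0: "0 \<le> m" unfolding m_def zero_le_ceiling .
  have finD: "finite D" using Fs(1) by (auto simp: D_def intro!: finite_PiE)
  have cardD: "real (card D) = (real ((n + 1)\<^sup>2 * (2 * nat m + 1) ^ card Fs)) ^ length ys"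
  proof -
    have "card {- m..m} = 2 * nat m + 1" using m0 by simp
    then have "card (Fs \<rightarrow>\<^sub>E {- m..m}) = (2 * nat m + 1) ^ card Fs"
      using card_PiE[OF Fs(1), of "\<lambda>_. {- m..m}"] by (simp only: prod_constant)
    then have "card ({..n} \<times> {..n} \<times> (Fs \<rightarrow>\<^sub>E {- m..m})) = (n + 1)\<^sup>2 * (2 * nat m + 1) ^ card Fs"
      by (simp only: card_cartesian_product card_atMost power2_eq_square Suc_eq_plus1 mult.assoc)
    then have "card D = ((n + 1)\<^sup>2 * (2 * nat m + 1) ^ card Fs) ^ length ys"
      unfolding D_def by (simp only: card_PiE[OF finite_set] prod_constant distinct_card[OF classes(2)])
    then show ?thesis by (simp only: of_nat_power)
  qed
  have small: "real (card D) * q d < prob W" if d: "good \<omega> d" for \<omega> d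
  proof (rule ccontr)
    assume "\<not> ?thesis"
    then have le: "prob W \<le> real (card D) * q d" by simp
    show False
      by (rule notE[OF neg], rule choose[of \<omega> "\<lambda>A. fst (d A)" "\<lambda>A. fst (snd (d A))" "\<lambda>A. snd (snd (d A))"])
        (use d le cardD in \<open>auto simp: good_def q_def G_def m_def\<close>)
  qed
  have Gset: "G d A \<in> sets path_space" if "A \<in> set ys" for d A
    unfolding G_def by (intro sets_cell_block Fs V that)
  have Gblock: "block_set (V A) (G d A)" if "A \<in> set ys" for d A
    unfolding block_set_def using Gset[OF that] V[OF that] by (auto simp: G_def cell_block_def)
  have ev: "chain_event (bs d) \<in> events" for d
    using Gset by (intro chain_event_measurable) (auto simp: bs_def)
  have up: "prob (chain_event (bs d)) \<le> q d" if "d \<in> D'" for d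
  proof -
    from that obtain \<omega> where "good \<omega> d" by (auto simp: D'_def)
    then have "sorted_wrt before (bs d)"
      by (simp add: bs_def sorted_wrt_map before_def good_def)
    from chain_upper[OF this] Gblock have "prob (chain_event (bs d)) \<le> (\<Prod>(t, l, G)\<leftarrow>bs d. R * mass l G)"
      by (fastforce simp: bs_def)
    also have "\<dots> = q d" by (simp add: bs_def q_def o_def)
    finally show ?thesis .
  qed
  \<comment> \<open>Off the null set of \<open>AE_arrow\<close>, the first and last visits and the
    floors of the block sums provide a datum for every path of \<open>W\<close>.\<close>
  have cover: "AE \<omega> in M. \<omega> \<in> W \<longrightarrow> \<omega> \<in> (\<Union>d\<in>D'. chain_event (bs d))"
    using AE_arrow AE_space
  proof eventually_elim
    case (elim \<omega>)
    show ?case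
    proof
      assume w: "\<omega> \<in> W"
      have arr: "arrow (Some (X s \<omega>)) (X t \<omega>)" if "1 \<le> s" "s < t" for s t
        using elim(1)[rule_format, of s "t - s - 1"] that by (simp add: Y_eq)
      obtain t l where tl: "\<forall>A\<in>set ys. t A + l A < n \<and> X (Suc (t A)) \<omega> \<in> V A \<and> X (Suc (t A + l A)) \<omega> \<in> V A \<and>
          (\<forall>k\<in>{1..n}. X k \<omega> \<in> V A \<longrightarrow> t A < k \<and> k \<le> Suc (t A + l A))"
        "sorted_wrt (\<lambda>A B. t A + l A < t B) ys"
        using visit_intervals[OF classes V(1) arr W(3)[OF w]] by blast
      define c where "c A = (\<lambda>f\<in>Fs. \<lfloor>(\<Sum>i\<le>l A. f (X (Suc (t A + i)) \<omega>)) / h\<rfloor>)" for A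
      have cb: "c A \<in> Fs \<rightarrow>\<^sub>E {- m..m}" if A: "A \<in> set ys" for A
      proof (rule PiE_I)
        fix f assume f: "f \<in> Fs"
        have "\<bar>\<Sum>i\<le>l A. f (X (Suc (t A + i)) \<omega>)\<bar> \<le> (\<Sum>i\<le>l A. \<bar>f (X (Suc (t A + i)) \<omega>)\<bar>)" by (rule sum_abs)
        also have "\<dots> \<le> (\<Sum>i\<le>l A. 1)" using Fs(3)[OF f] by (intro sum_mono) auto
        also have "\<dots> \<le> real n" using tl(1) A by auto
        finally have le: "\<bar>\<Sum>i\<le>l A. f (X (Suc (t A + i)) \<omega>)\<bar> \<le> real n" .
        have hpos: "0 < h" using h by simp
        have "\<bar>(\<Sum>i\<le>l A. f (X (Suc (t A + i)) \<omega>)) / h\<bar> \<le> real n / h"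
          using le hpos by (simp add: divide_right_mono)
        also have "real n / h = 1 / \<theta>" using h by simp
        also have "\<dots> \<le> of_int m" by (simp add: m_def)
        finally have "\<bar>(\<Sum>i\<le>l A. f (X (Suc (t A + i)) \<omega>)) / h\<bar> \<le> of_int m" .
        then have "- of_int m \<le> (\<Sum>i\<le>l A. f (X (Suc (t A + i)) \<omega>)) / h" "(\<Sum>i\<le>l A. f (X (Suc (t A + i)) \<omega>)) / h \<le> of_int m"
          unfolding abs_le_iff by linarith+
        then have "- m \<le> \<lfloor>(\<Sum>i\<le>l A. f (X (Suc (t A + i)) \<omega>)) / h\<rfloor>" "\<lfloor>(\<Sum>i\<le>l A. f (X (Suc (t A + i)) \<omega>)) / h\<rfloor> \<le> m"
          by (simp_all add: le_floor_iff floor_le_iff)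
        then show "c A f \<in> {- m..m}" using f by (simp add: c_def)
      qed (simp add: c_def)
      define d where "d = (\<lambda>A\<in>set ys. (t A, l A, c A))"
      have d: "d \<in> D" using cb tl(1) by (fastforce simp: D_def d_def)
      have path: "chain_path X (t A) (Suc (l A)) \<omega> \<in> cell_block Fs h (V A) (l A) (c A)" if A: "A \<in> set ys" for A
        using tl(1) A by (auto simp: cell_block_def chain_path_def c_def)
      have dA: "d A = (t A, l A, c A)" if "A \<in> set ys" for A using that by (simp add: d_def)
      have "sorted_wrt (\<lambda>A B. fst (d A) + fst (snd (d A)) < fst (d B)) ys"
        using tl(2) by (rule sorted_wrt_mono_rel[rotated]) (simp add: dA)
      then have "good \<omega> d"
        unfolding good_def using w tl(1) path by (simp add: dA G_def)
      moreover have "\<omega> \<in> chain_event (bs d)"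
        using elim(2) path by (auto simp: chain_event_def bs_def block_event_def G_def dA)
      ultimately show "\<omega> \<in> (\<Union>d\<in>D'. chain_event (bs d))" using d by (auto simp: D'_def)
    qed
  qed
  have finD': "finite D'" using finD by (simp add: D'_def)
  have "prob W \<le> prob (\<Union>d\<in>D'. chain_event (bs d))"
    by (rule finite_measure_mono_AE[OF cover]) (use finD' ev in auto)
  also have "\<dots> \<le> (\<Sum>d\<in>D'. prob (chain_event (bs d)))"
    by (rule finite_measure_subadditive_finite[OF finD']) (use ev in auto)
  also have "\<dots> \<le> (\<Sum>d\<in>D'. q d)" using up by (rule sum_mono)
  finally have le: "prob W \<le> (\<Sum>d\<in>D'. q d)" .
  have "D' \<noteq> {}" using le W(2) by auto
  then have "card D > 0" using finD by (auto simp: D'_def card_gt_0_iff)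
  have "(\<Sum>d\<in>D'. q d) < (\<Sum>d\<in>D'. prob W / real (card D))"
    using small \<open>card D > 0\<close> \<open>D' \<noteq> {}\<close> finD'
    by (intro sum_strict_mono) (auto simp: D'_def field_simps)
  also have "\<dots> = real (card D') * (prob W / real (card D))" by simp
  also have "\<dots> \<le> real (card D) * (prob W / real (card D))"
    using card_mono[OF finD, of D'] by (intro mult_right_mono) (auto simp: D'_def)
  also have "\<dots> = prob W" using \<open>card D > 0\<close> by simp
  finally show False using le by simp
qed

end

section \<open>Local rates\<close>

context density_chain
begin

abbreviation emp_event :: "'a measure set \<Rightarrow> nat \<Rightarrow> 'w set" where
  "emp_event V n \<equiv> {\<omega> \<in> space M. empirical X n \<omega> \<in> V}"

definition upper_rate :: "'a measure \<Rightarrow> ereal" where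
  "upper_rate \<mu> = (INF V\<in>{V. openin weak_topology V \<and> \<mu> \<in> V}. limsup (log_rate M X V))"

definition lower_rate :: "'a measure \<Rightarrow> ereal" where
  "lower_rate \<mu> = (INF V\<in>{V. openin weak_topology V \<and> \<mu> \<in> V}. liminf (log_rate M X V))"

lemma emp_event_measurable:
  "n \<ge> 1 \<Longrightarrow> openin weak_topology V \<Longrightarrow> emp_event V n \<in> events"
  by (intro measurable_empirical X_measurable)

lemma log_rate_ge_iff:
  assumes "n \<ge> 1"
  shows "ereal r \<le> log_rate M X V n \<longleftrightarrow> exp (real n * r) \<le> prob (emp_event V n)"
proof (cases "prob (emp_event V n) \<le> 0")
  case True
  then have "prob (emp_event V n) = 0" using measure_nonneg[of M] by (simp add: antisym)
  then show ?thesis using assms by (simp add: log_rate_def elog_def not_le)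
next
  case False
  then have "ereal r \<le> log_rate M X V n \<longleftrightarrow> real n * r \<le> ln (prob (emp_event V n))"
    using assms by (simp add: log_rate_def elog_def field_simps)
  also have "\<dots> \<longleftrightarrow> exp (real n * r) \<le> prob (emp_event V n)"
    using False by (simp add: ln_ge_iff not_le)
  finally show ?thesis .
qed

lemma log_rate_le_iff:
  assumes "n \<ge> 1"
  shows "log_rate M X V n \<le> ereal r \<longleftrightarrow> prob (emp_event V n) \<le> exp (real n * r)"
proof (cases "prob (emp_event V n) \<le> 0")
  case True
  then have "prob (emp_event V n) = 0" using measure_nonneg[of M] by (simp add: antisym)
  then show ?thesis using assms by (simp add: log_rate_def elog_def)
next
  case False
  then have "log_rate M X V n \<le> ereal r \<longleftrightarrow> ln (prob (emp_event V n)) \<le> real n * r"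
    using assms by (simp add: log_rate_def elog_def field_simps)
  also have "\<dots> \<longleftrightarrow> ln (prob (emp_event V n)) \<le> ln (exp (real n * r))" by simp
  also have "\<dots> \<longleftrightarrow> prob (emp_event V n) \<le> exp (real n * r)"
    using False by (subst ln_le_cancel_iff) (auto simp: not_le)
  finally show ?thesis .
qed

lemma log_rate_nonpos: "log_rate M X V n \<le> 0"
proof (cases "n \<ge> 1")
  case True
  then show ?thesis using log_rate_le_iff[OF True, of V 0] by (simp add: zero_ereal_def)
next
  case False
  then have "real n = 0" by simp
  then show ?thesis unfolding log_rate_def by (simp add: zero_ereal_def[symmetric])
qed

lemma upper_rate_nonpos: "\<mu> \<in> prob_measures \<Longrightarrow> upper_rate \<mu> \<le> 0"
  unfolding upper_rate_def
proof (rule INF_lower2[of "prob_measures"])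
  show "limsup (log_rate M X prob_measures) \<le> 0"
    by (intro Limsup_bounded always_eventually allI log_rate_nonpos)
qed (simp add: openin_weak_prob_measures)

lemma lower_le_upper: "lower_rate \<mu> \<le> upper_rate \<mu>"
  unfolding lower_rate_def upper_rate_def
  by (intro INF_mono' Liminf_le_Limsup) simp

lemma upper_rate_lessD:
  assumes "upper_rate \<mu> < ereal r"
  obtains V where "openin weak_topology V" "\<mu> \<in> V" "\<forall>\<^sub>F n in sequentially. prob (emp_event V n) \<le> exp (real n * r)"
proof -
  obtain V where V: "openin weak_topology V" "\<mu> \<in> V" "limsup (log_rate M X V) < ereal r"
    using assms unfolding upper_rate_def by (auto simp: INF_less_iff)
  from Limsup_lessD[OF V(3)] have "\<forall>\<^sub>F n in sequentially. prob (emp_event V n) \<le> exp (real n * r)"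
    using eventually_ge_at_top[of 1] by eventually_elim (simp add: log_rate_le_iff[symmetric])
  then show thesis using that V by blast
qed

lemma upper_rate_greaterD:
  assumes "ereal s < upper_rate \<mu>" "openin weak_topology V" "\<mu> \<in> V"
  shows "\<exists>\<^sub>F n in sequentially. exp (real n * s) \<le> prob (emp_event V n)"
proof (rule ccontr)
  assume "\<not> ?thesis"
  then have "\<forall>\<^sub>F n in sequentially. log_rate M X V n \<le> ereal s"
    unfolding not_frequently using eventually_ge_at_top[of 1]
    by eventually_elim (simp add: log_rate_le_iff)
  then have "limsup (log_rate M X V) \<le> ereal s" by (rule Limsup_bounded)
  moreover have "upper_rate \<mu> \<le> limsup (log_rate M X V)"
    unfolding upper_rate_def using assms by (intro INF_lower) auto
  ultimately show False using assms(1) by simp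
qed

lemma upper_rate_leI:
  assumes "openin weak_topology V" "\<mu> \<in> V" "\<forall>\<^sub>F n in sequentially. prob (emp_event V n) \<le> exp (real n * r)"
  shows "upper_rate \<mu> \<le> ereal r"
proof -
  have "\<forall>\<^sub>F n in sequentially. log_rate M X V n \<le> ereal r"
    using assms(3) eventually_ge_at_top[of 1] by eventually_elim (simp add: log_rate_le_iff)
  then have "limsup (log_rate M X V) \<le> ereal r" by (rule Limsup_bounded)
  moreover have "upper_rate \<mu> \<le> limsup (log_rate M X V)"
    unfolding upper_rate_def using assms by (intro INF_lower) auto
  ultimately show ?thesis by simp
qed

section \<open>Realizing prescribed blocks\<close>

lemma cell_sum:
  assumes "chain_path X t (Suc l) \<omega> \<in> cell_block Fs h U l c" "f \<in> Fs" "0 < h"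
  shows "\<bar>block_sum (\<lambda>k. f (X k \<omega>)) (t, l, G) - h * of_int (c f)\<bar> \<le> h"
proof -
  let ?S = "\<Sum>i\<le>l. f (X (Suc (t + i)) \<omega>)"
  have "(\<Sum>i\<le>l. f (chain_path X t (Suc l) \<omega> i)) = ?S"
    by (intro sum.cong) (auto simp: chain_path_def)
  then have "\<lfloor>?S / h\<rfloor> = c f" using assms by (auto simp: cell_block_def)
  then have "of_int (c f) \<le> ?S / h" "?S / h < of_int (c f) + 1" by linarith+
  then have "h * of_int (c f) \<le> ?S" "?S < h * of_int (c f) + h"
    using assms(3) by (simp_all add: field_simps)
  then show ?thesis by (simp add: block_sum_def)
qed

lemma realize_sum:
  assumes "map snd tbs = map (\<lambda>(A, l, h, c). (l, cell_block Fs h (V A) l c)) bs"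
    and "\<And>t l G. (t, l, G) \<in> set tbs \<Longrightarrow> \<omega> \<in> block_event t l G"
    and "f \<in> Fs" "\<And>A l h c. (A, l, h, c) \<in> set bs \<Longrightarrow> 0 < h"
  shows "\<bar>(\<Sum>b\<leftarrow>tbs. block_sum (\<lambda>k. f (X k \<omega>)) b) - (\<Sum>(A, l, h, c)\<leftarrow>bs. h * of_int (c f))\<bar> \<le> (\<Sum>(A, l, h, c)\<leftarrow>bs. h)"
  using assms(1,2,4)
proof (induction bs arbitrary: tbs)
  case Nil
  then show ?case by simp
next
  case (Cons b bs)
  obtain A l h c where b: "b = (A, l, h, c)" by (cases b)
  obtain tb tbs' where tbs: "tbs = tb # tbs'" using Cons.prems(1) by (cases tbs) auto
  obtain t where tb: "tb = (t, l, cell_block Fs h (V A) l c)"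
    using Cons.prems(1) by (cases tb) (auto simp: tbs b)
  have "chain_path X t (Suc l) \<omega> \<in> cell_block Fs h (V A) l c"
    using Cons.prems(2)[of t l "cell_block Fs h (V A) l c"] by (simp add: tbs tb block_event_def)
  from cell_sum[OF this assms(3)] have 1: "\<bar>block_sum (\<lambda>k. f (X k \<omega>)) tb - h * of_int (c f)\<bar> \<le> h"
    using Cons.prems(3)[of A l h c] by (simp add: tb b)
  have "\<bar>(\<Sum>b\<leftarrow>tbs'. block_sum (\<lambda>k. f (X k \<omega>)) b) - (\<Sum>(A, l, h, c)\<leftarrow>bs. h * of_int (c f))\<bar> \<le> (\<Sum>(A, l, h, c)\<leftarrow>bs. h)"
  proof (rule Cons.IH)
    show "map snd tbs' = map (\<lambda>(A, l, h, c). (l, cell_block Fs h (V A) l c)) bs"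
      using Cons.prems(1) by (simp add: tbs)
    show "\<omega> \<in> block_event t l G" if "(t, l, G) \<in> set tbs'" for t l G
      using Cons.prems(2)[of t l G] that by (simp add: tbs)
    show "0 < h" if "(A, l, h, c) \<in> set bs" for A l h c
      using Cons.prems(3)[of A l h c] that by simp
  qed
  with 1 show ?case by (simp add: tbs b)
qed

text \<open>The error has two sources: each of the \<open>n\<close> times outside the blocks costs
  at most 1, and each block sum is known only up to its \<open>h\<close>. Every block carries its
  own \<open>h\<close>, because blocks found at different path lengths will be mixed.\<close>

lemma realize:
  fixes bs :: "('a set \<times> nat \<times> real \<times> (('a \<Rightarrow> real) \<Rightarrow> int)) list"
  assumes Fs: "finite Fs" "\<And>f. f \<in> Fs \<Longrightarrow> f \<in> borel_measurable borel" "\<And>f x. f \<in> Fs \<Longrightarrow> \<bar>f x\<bar> \<le> (1::real)"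
    and L: "0 < L" "\<And>A. A \<in> F \<Longrightarrow> links L {None} (V A)"
      "\<And>A B. A \<in> F \<Longrightarrow> B \<in> F \<Longrightarrow> leads_to \<rho> A B \<Longrightarrow> links L (Some ` V A) (V B)"
    and V: "\<And>A. A \<in> F \<Longrightarrow> V A \<in> sets borel" "\<And>A. A \<in> F \<Longrightarrow> emeasure lborel (V A) < \<infinity>"
    and bs: "\<And>A l h c. (A, l, h, c) \<in> set bs \<Longrightarrow> A \<in> F \<and> 0 < h" "sorted_wrt (\<lambda>b b'. leads_to \<rho> (fst b) (fst b')) bs"
    and n: "(\<Sum>(A, l, h, c)\<leftarrow>bs. Suc l + L) \<le> n"
  shows "(\<Prod>(A, l, h, c)\<leftarrow>bs. mass l (cell_block Fs h (V A) l c) / (real L)\<^sup>2) \<le>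
    prob {\<omega> \<in> space M. \<forall>f\<in>Fs. \<bar>(\<Sum>k=1..n. f (X k \<omega>)) - (\<Sum>(A, l, h, c)\<leftarrow>bs. h * of_int (c f))\<bar> \<le>
      real n - real (\<Sum>(A, l, h, c)\<leftarrow>bs. Suc l) + (\<Sum>(A, l, h, c)\<leftarrow>bs. h)}"
proof -
  define bs' where "bs' = map (\<lambda>(A, l, h, c). (A, l, cell_block Fs h (V A) l c)) bs"
  have cb: "cell_block Fs h (V A) l c \<in> sets path_space" if "A \<in> F" for A h l c
    by (intro sets_cell_block Fs V that)
  have 1: "block_set (V A) G \<and> (\<forall>\<eta>\<in>G. \<eta> l \<in> V A) \<and> links L {None} (V A)" if "(A, l, G) \<in> set bs'" for A l G
    using that bs(1) V L cb by (fastforce simp: bs'_def block_set_def cell_block_def)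
  have 2: "sorted_wrt (\<lambda>b b'. links L (Some ` V (fst b)) (V (fst b'))) bs'"
    unfolding bs'_def sorted_wrt_map
    by (rule sorted_wrt_mono_rel[OF _ bs(2)]) (auto dest!: bs(1) intro: L(3))
  from chain_lower[OF L(1) 1 2] obtain tbs e where tbs: "map snd tbs = map snd bs'" "sorted_wrt before tbs"
      "e \<le> (\<Sum>(A, l, G)\<leftarrow>bs'. Suc l + L)" "\<forall>(t, l, G)\<in>set tbs. t + l < e"
      "(\<Prod>(A, l, G)\<leftarrow>bs'. mass l G / (real L)\<^sup>2) \<le> prob (chain_event tbs)"
    by blast
  have "map (\<lambda>(A, l, G). Suc l + L) bs' = map (\<lambda>(A, l, h, c). Suc l + L) bs"
    by (auto simp: bs'_def)
  with tbs(3) n have en: "e \<le> n" by simp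
  have snd_bs': "map snd bs' = map (\<lambda>(A, l, h, c). (l, cell_block Fs h (V A) l c)) bs"
    by (simp add: bs'_def o_def split_beta)
  have len: "(\<Sum>b\<leftarrow>tbs. block_length b) = (\<Sum>(A, l, h, c)\<leftarrow>bs. Suc l)"
  proof -
    have "map block_length tbs = map (\<lambda>x. Suc (fst x)) (map snd tbs)"
      by (simp add: block_length_def o_def)
    also have "\<dots> = map (\<lambda>(A, l, h, c). Suc l) bs"
      unfolding tbs(1) snd_bs' by (simp add: o_def split_beta)
    finally show ?thesis by simp
  qed
  let ?E = "{\<omega> \<in> space M. \<forall>f\<in>Fs. \<bar>(\<Sum>k=1..n. f (X k \<omega>)) - (\<Sum>(A, l, h, c)\<leftarrow>bs. h * of_int (c f))\<bar> \<le>
      real n - real (\<Sum>(A, l, h, c)\<leftarrow>bs. Suc l) + (\<Sum>(A, l, h, c)\<leftarrow>bs. h)}"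
  have "chain_event tbs \<subseteq> ?E"
  proof (intro subsetI CollectI conjI ballI)
    fix \<omega> f assume w: "\<omega> \<in> chain_event tbs" and f: "f \<in> Fs"
    have "\<bar>(\<Sum>b\<leftarrow>tbs. block_sum (\<lambda>k. f (X k \<omega>)) b) - (\<Sum>(A, l, h, c)\<leftarrow>bs. h * of_int (c f))\<bar> \<le> (\<Sum>(A, l, h, c)\<leftarrow>bs. h)"
    proof (rule realize_sum[OF _ _ f])
      show "map snd tbs = map (\<lambda>(A, l, h, c). (l, cell_block Fs h (V A) l c)) bs" using tbs(1) snd_bs' by simp
      show "\<omega> \<in> block_event t l G" if "(t, l, G) \<in> set tbs" for t l G
        using w that by (auto simp: chain_event_def)
    qed (use bs(1) in blast)
    moreover have "\<bar>(\<Sum>k=1..n. f (X k \<omega>)) - (\<Sum>b\<leftarrow>tbs. block_sum (\<lambda>k. f (X k \<omega>)) b)\<bar> \<le> real n - real (\<Sum>b\<leftarrow>tbs. block_length b)"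
      using tbs(2,4) en Fs(3)[OF f] by (intro sum_blocks) fastforce+
    ultimately show "\<bar>(\<Sum>k=1..n. f (X k \<omega>)) - (\<Sum>(A, l, h, c)\<leftarrow>bs. h * of_int (c f))\<bar> \<le>
      real n - real (\<Sum>(A, l, h, c)\<leftarrow>bs. Suc l) + (\<Sum>(A, l, h, c)\<leftarrow>bs. h)" unfolding len by linarith
  qed (auto simp: chain_event_def)
  moreover have "?E \<in> events"
  proof (rule sets.sets_Collect_finite_All[OF _ Fs(1)])
    fix f assume "f \<in> Fs"
    then have [measurable]: "f \<in> borel_measurable borel" using Fs(2) by simp
    have [measurable]: "(\<lambda>\<omega>. \<Sum>k=1..n. f (X k \<omega>)) \<in> borel_measurable M"
      by (intro borel_measurable_sum measurable_compose[OF X_measurable]) auto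
    show "{\<omega> \<in> space M. \<bar>(\<Sum>k=1..n. f (X k \<omega>)) - (\<Sum>(A, l, h, c)\<leftarrow>bs. h * of_int (c f))\<bar> \<le>
      real n - real (\<Sum>(A, l, h, c)\<leftarrow>bs. Suc l) + (\<Sum>(A, l, h, c)\<leftarrow>bs. h)} \<in> events"
      by measurable
  qed
  ultimately have "prob (chain_event tbs) \<le> prob ?E" by (rule finite_measure_mono)
  moreover have "map (\<lambda>(A, l, G). mass l G / (real L)\<^sup>2) bs' = map (\<lambda>(A, l, h, c). mass l (cell_block Fs h (V A) l c) / (real L)\<^sup>2) bs"
    by (auto simp: bs'_def)
  ultimately show ?thesis using tbs(5) by simp
qed

section \<open>Frames\<close>

text \<open>What the block constructions need of a measure: full mass on the classes and the
  reachability conditions of admissibility.\<close>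

definition orderly :: "'a measure \<Rightarrow> bool" where
  "orderly \<mu> \<longleftrightarrow> \<mu> \<in> prob_measures \<and> measure \<mu> (\<Union> (comm_classes \<rho>)) = 1 \<and>
    (\<forall>A\<in>charged_classes \<rho> \<mu>. init_leads_to \<rho> A) \<and>
    (\<forall>A\<in>charged_classes \<rho> \<mu>. \<forall>B\<in>charged_classes \<rho> \<mu>. leads_to \<rho> A B \<or> leads_to \<rho> B A)"

text \<open>Finitely many classes, in the order in which the chain has to visit them, with relatively
  compact open parts carrying most of the mass; \<open>L\<close> bounds the gaps needed to connect the parts.\<close>

definition frame :: "'a measure \<Rightarrow> real \<Rightarrow> 'a set list \<Rightarrow> ('a set \<Rightarrow> 'a set) \<Rightarrow> nat \<Rightarrow> bool" where
  "frame \<mu> \<epsilon> xs V L \<longleftrightarrow> set xs \<subseteq> comm_classes \<rho> \<and> distinct xs \<and> sorted_wrt (leads_to \<rho>) xs \<and> 0 < L \<and>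
    (\<forall>A\<in>set xs. open (V A) \<and> compact (closure (V A)) \<and> closure (V A) \<subseteq> A \<and> 0 < measure \<mu> (V A) \<and> links L {None} (V A)) \<and>
    (\<forall>A\<in>set xs. \<forall>B\<in>set xs. leads_to \<rho> A B \<longrightarrow> links L (Some ` V A) (V B)) \<and>
    1 - \<epsilon> < measure \<mu> (\<Union>A\<in>set xs. V A)"

lemma links_mono: "links L S T \<Longrightarrow> S' \<subseteq> S \<Longrightarrow> T' \<subseteq> T \<Longrightarrow> links L S' T'"
  unfolding links_def by blast

text \<open>By transitivity a finite set of pairwise comparable classes has a first element; the
  rest is sorted by induction.\<close>

lemma sort_classes:
  assumes "finite S" "S \<subseteq> comm_classes \<rho>" "\<And>A B. A \<in> S \<Longrightarrow> B \<in> S \<Longrightarrow> leads_to \<rho> A B \<or> leads_to \<rho> B A"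
  shows "\<exists>xs. set xs = S \<and> distinct xs \<and> sorted_wrt (leads_to \<rho>) xs"
  using assms
proof (induction "card S" arbitrary: S)
  case 0
  then show ?case by (intro exI[of _ "[]"]) auto
next
  case (Suc n)
  have "\<exists>A\<in>T. \<forall>B\<in>T. leads_to \<rho> A B" if "finite T" "T \<noteq> {}" "T \<subseteq> S" for T
    using that
  proof (induction T rule: finite_ne_induct)
    case (singleton A)
    then show ?case using Suc.prems(2) leads_to_refl by auto
  next
    case (insert A T)
    then obtain B where B: "B \<in> T" "\<forall>D\<in>T. leads_to \<rho> B D" by auto
    have c: "A \<in> comm_classes \<rho>" "B \<in> comm_classes \<rho>" using insert B Suc.prems(2) by auto
    show ?case
    proof (cases "leads_to \<rho> A B")
      case True
      have "leads_to \<rho> A D" if "D \<in> T" for D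
        using leads_to_trans[OF c _ True] B(2) that insert.prems Suc.prems(2) by blast
      then show ?thesis using leads_to_refl[OF c(1)] by auto
    next
      case False
      then have "leads_to \<rho> B A" using Suc.prems(3) insert B by blast
      then show ?thesis using B by auto
    qed
  qed
  moreover have "S \<noteq> {}" using Suc.hyps(2) by auto
  ultimately obtain A where A: "A \<in> S" "\<forall>B\<in>S. leads_to \<rho> A B" using Suc.prems(1) by blast
  have "n = card (S - {A})" using Suc A by simp
  from Suc.hyps(1)[OF this] Suc.prems obtain xs where xs: "set xs = S - {A}" "distinct xs" "sorted_wrt (leads_to \<rho>) xs"
    by (metis (no_types, lifting) Diff_iff Diff_subset finite_Diff order_trans)
  then show ?case using A by (intro exI[of _ "A # xs"]) auto
qed

text \<open>Inner regularity gives a compact set with most of the mass, and since the classes are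
  open, finitely many of them cover it. Its trace on each class is compact and can be thickened
  inside the class; compactness of the closures then makes reachability uniform.\<close>

lemma frame_exists:
  assumes "orderly \<mu>" "0 < \<epsilon>"
  obtains xs V L where "frame \<mu> \<epsilon> xs V L"
proof -
  have mu: "\<mu> \<in> prob_measures" and C1: "measure \<mu> (\<Union> (comm_classes \<rho>)) = 1"
    using assms(1) by (auto simp: orderly_def)
  interpret mu: prob_space \<mu> using mu by (rule prob_measuresD)
  note smu[measurable_cong] = prob_measuresD(2)[OF mu]
  let ?C = "\<Union> (comm_classes \<rho>)"
  have oC: "open ?C" using class_open by auto
  have "emeasure \<mu> ?C = (SUP K\<in>{K. K \<subseteq> ?C \<and> compact K}. emeasure \<mu> K)"
    by (rule inner_regular[OF smu]) (use oC mu.emeasure_finite in auto)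
  moreover have "ennreal (1 - \<epsilon>) < emeasure \<mu> ?C"
    using assms(2) C1 by (simp add: mu.emeasure_eq_measure ennreal_lessI)
  ultimately obtain K where K: "K \<subseteq> ?C" "compact K" "ennreal (1 - \<epsilon>) < emeasure \<mu> K"
    by (auto simp: less_SUP_iff)
  have mK: "1 - \<epsilon> < measure \<mu> K"
  proof (rule ccontr)
    assume "\<not> ?thesis"
    then have "ennreal (measure \<mu> K) \<le> ennreal (1 - \<epsilon>)" by (intro ennreal_leI) simp
    then show False using K(3) by (simp add: mu.emeasure_eq_measure)
  qed
  obtain D where D: "D \<subseteq> comm_classes \<rho>" "finite D" "K \<subseteq> \<Union> D"
    by (rule compactE[OF K(2,1)]) (use class_open in auto)
  \<comment> \<open>Comparability and reachability from the initial point are known only for charged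
    classes, so classes that carry no mass of \<open>K\<close> are dropped.\<close>
  define S where "S = {A \<in> D. 0 < measure \<mu> (K \<inter> A)}"
  have Kb: "K \<in> sets borel" using K(2) by (rule borel_compact)
  have KA[measurable]: "K \<inter> A \<in> sets borel" if "A \<in> D" for A
    using D(1) that by (intro sets.Int Kb borel_open class_open) auto
  have compKA: "compact (K \<inter> A)" if "A \<in> D" for A
  proof -
    \<comment> \<open>Classes are disjoint, so the trace of \<open>K\<close> on \<open>A\<close>
      arises by removing the other open classes of the cover; this keeps it compact.\<close>
    have "K \<inter> A = K - \<Union> (D - {A})"
    proof (intro equalityI subsetI)
      fix x assume x: "x \<in> K \<inter> A"
      have "x \<notin> B" if "B \<in> D - {A}" for B
        using class_disjoint[of A B x] D(1) x that \<open>A \<in> D\<close> by auto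
      then show "x \<in> K - \<Union> (D - {A})" using x by auto
    qed (use D(3) in auto)
    moreover have "compact (K - \<Union> (D - {A}))"
      using class_open D(1) by (intro compact_diff K(2) open_Union) auto
    ultimately show ?thesis by simp
  qed
  have SC: "S \<subseteq> charged_classes \<rho> \<mu>"
  proof
    fix A assume A: "A \<in> S"
    then have "measure \<mu> (K \<inter> A) \<le> measure \<mu> A"
      using D(1) class_open by (intro mu.finite_measure_mono) (auto simp: S_def smu)
    then show "A \<in> charged_classes \<rho> \<mu>" using A D(1) by (auto simp: charged_classes_def S_def)
  qed
  obtain xs where xs: "set xs = S" "distinct xs" "sorted_wrt (leads_to \<rho>) xs"
  proof -
    have "finite S" using D(2) by (simp add: S_def)
    moreover have "S \<subseteq> comm_classes \<rho>" using SC by (auto simp: charged_classes_def)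
    moreover have "leads_to \<rho> A B \<or> leads_to \<rho> B A" if "A \<in> S" "B \<in> S" for A B
      using assms(1) SC that unfolding orderly_def by blast
    ultimately show thesis using sort_classes[of S] that by blast
  qed
  have "\<exists>U. open U \<and> K \<inter> A \<subseteq> U \<and> compact (closure U) \<and> closure U \<subseteq> A" if A: "A \<in> S" for A
  proof -
    have A': "A \<in> D" "open A" using A D(1) class_open by (auto simp: S_def)
    have ne: "K \<inter> A \<noteq> {}" using A by (auto simp: S_def)
    obtain e where e: "0 < e" "{x. infdist x (K \<inter> A) \<le> e} \<subseteq> A"
      using compact_in_open_separated[OF ne compKA[OF A'(1)] A'(2)] by blast
    let ?U = "{x. infdist x (K \<inter> A) < e}" and ?F = "{x. infdist x (K \<inter> A) \<le> e}"
    have F: "compact ?F" by (rule compact_infdist_le[OF ne compKA[OF A'(1)] e(1)])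
    have cl: "closure ?U \<subseteq> ?F"
      by (rule closure_minimal[OF _ compact_imp_closed[OF F]]) auto
    show ?thesis
    proof (intro exI[of _ ?U] conjI)
      show "open ?U" by (intro open_Collect_less continuous_intros)
      show "K \<inter> A \<subseteq> ?U" using e(1) by (auto simp: infdist_zero)
      show "compact (closure ?U)" using cl F by (meson bounded_subset closed_closure compact_eq_bounded_closed)
      show "closure ?U \<subseteq> A" using cl e(2) by blast
    qed
  qed
  then obtain V where V: "\<And>A. A \<in> S \<Longrightarrow> open (V A) \<and> K \<inter> A \<subseteq> V A \<and> compact (closure (V A)) \<and> closure (V A) \<subseteq> A"
    by metis
  have SCl: "A \<in> comm_classes \<rho>" if "A \<in> S" for A using SC that by (auto simp: charged_classes_def)
  have VA: "V A \<in> sets borel" if "A \<in> S" for A using V[OF that] by auto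
  \<comment> \<open>Links are obtained between the closures, which are compact, and then restricted
    to the open parts.\<close>
  have "\<forall>\<^sub>F L in sequentially. \<forall>A\<in>S. links L {None} (V A)"
  proof (rule eventually_ball_finite)
    show "finite S" using D(2) by (simp add: S_def)
    show "\<forall>A\<in>S. \<forall>\<^sub>F L in sequentially. links L {None} (V A)"
    proof
      fix A assume A: "A \<in> S"
      then have "init_leads_to \<rho> A" using assms(1) SC by (auto simp: orderly_def)
      then have "\<forall>\<^sub>F L in sequentially. links L {None} (closure (V A))"
        using V[OF A] unfolding init_leads_to_iff[OF SCl[OF A]] by (intro links_None) blast+
      then show "\<forall>\<^sub>F L in sequentially. links L {None} (V A)"
        by eventually_elim (rule links_mono[OF _ subset_refl closure_subset])
    qed
  qed
  moreover have "\<forall>\<^sub>F L in sequentially. \<forall>A\<in>S. \<forall>B\<in>S. leads_to \<rho> A B \<longrightarrow> links L (Some ` V A) (V B)"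
  proof (intro eventually_ball_finite ballI)
    show "finite S" "finite S" using D(2) by (simp_all add: S_def)
    fix A B assume AB: "A \<in> S" "B \<in> S"
    show "\<forall>\<^sub>F L in sequentially. leads_to \<rho> A B \<longrightarrow> links L (Some ` V A) (V B)"
    proof (cases "leads_to \<rho> A B")
      case True
      then have "\<forall>\<^sub>F L in sequentially. links L (Some ` closure (V A)) (closure (V B))"
        using V[OF AB(1)] V[OF AB(2)] unfolding leads_to_iff[OF SCl[OF AB(1)] SCl[OF AB(2)]]
        by (intro links_Some) blast+
      then show ?thesis
        by eventually_elim (intro impI, erule links_mono, intro image_mono closure_subset, rule closure_subset)
    qed simp
  qed
  moreover have "\<forall>\<^sub>F L in sequentially. (0::nat) < L" by (rule eventually_gt_at_top)
  ultimately have "\<forall>\<^sub>F L in sequentially. 0 < L \<and> (\<forall>A\<in>S. links L {None} (V A)) \<and>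
      (\<forall>A\<in>S. \<forall>B\<in>S. leads_to \<rho> A B \<longrightarrow> links L (Some ` V A) (V B))"
    by eventually_elim auto
  from eventually_happens[OF this] obtain L where L: "0 < L" "\<forall>A\<in>S. links L {None} (V A)"
      "\<forall>A\<in>S. \<forall>B\<in>S. leads_to \<rho> A B \<longrightarrow> links L (Some ` V A) (V B)"
    by auto
  have finS: "finite S" using D(2) by (simp add: S_def)
  have U1: "(\<Union>A\<in>S. V A) \<in> sets \<mu>" unfolding smu by (rule sets.finite_UN[OF finS VA])
  have U2: "(\<Union>A\<in>D - S. K \<inter> A) \<in> sets \<mu>"
    unfolding smu by (rule sets.finite_UN) (use D(2) KA in auto)
  have "measure \<mu> K \<le> measure \<mu> ((\<Union>A\<in>S. V A) \<union> (\<Union>A\<in>D - S. K \<inter> A))"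
  proof (rule mu.finite_measure_mono)
    show "K \<subseteq> (\<Union>A\<in>S. V A) \<union> (\<Union>A\<in>D - S. K \<inter> A)"
    proof
      fix x assume x: "x \<in> K"
      then obtain A where "A \<in> D" "x \<in> A" using D(3) by auto
      then show "x \<in> (\<Union>A\<in>S. V A) \<union> (\<Union>A\<in>D - S. K \<inter> A)"
        using V[of A] x by (cases "A \<in> S") auto
    qed
    show "(\<Union>A\<in>S. V A) \<union> (\<Union>A\<in>D - S. K \<inter> A) \<in> sets \<mu>"
      using U1 U2 by (rule sets.Un)
  qed
  also have "\<dots> \<le> measure \<mu> (\<Union>A\<in>S. V A) + measure \<mu> (\<Union>A\<in>D - S. K \<inter> A)"
    using U1 U2 by (rule measure_Un_le)
  also have "measure \<mu> (\<Union>A\<in>D - S. K \<inter> A) \<le> (\<Sum>A\<in>D - S. measure \<mu> (K \<inter> A))"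
    using D(2) KA by (intro mu.finite_measure_subadditive_finite) (auto simp: smu)
  also have "\<dots> = 0"
    using measure_nonneg[of \<mu>] by (intro sum.neutral) (auto simp: S_def not_less intro: antisym)
  finally have "1 - \<epsilon> < measure \<mu> (\<Union>A\<in>S. V A)" using mK by simp
  moreover have "0 < measure \<mu> (V A)" if "A \<in> S" for A
  proof -
    have "measure \<mu> (K \<inter> A) \<le> measure \<mu> (V A)"
      using V[OF that] VA[OF that] by (intro mu.finite_measure_mono) (auto simp: smu)
    then show ?thesis using that by (auto simp: S_def)
  qed
  ultimately have "frame \<mu> \<epsilon> xs V L"
    unfolding frame_def xs(1) using xs(2,3) SCl V L by auto
  then show thesis by (rule that)
qed

end

section \<open>Lower bounds by concatenation\<close>

text \<open>Any strict increase of the exponential rate absorbs a polynomial factor. This pays for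
  the choice of cells and positions, for the densities and for the gaps.\<close>

lemma subexponential:
  fixes s s' :: real
  assumes "s < s'"
  shows "\<forall>\<^sub>F n in sequentially. (real ((n + 1)\<^sup>2 * B)) ^ r * C * exp (real n * s) \<le> exp (real n * s')"
proof -
  define d where "d = s' - s"
  have d: "0 < d" using assms by (simp add: d_def)
  have "filterlim (\<lambda>n. d * (real n + 1)) at_top sequentially"
    by (intro filterlim_tendsto_pos_mult_at_top[OF tendsto_const d]
        filterlim_at_top_mono[OF filterlim_real_sequentially] always_eventually) simp
  then have "((\<lambda>n. (d * (real n + 1)) ^ (2 * r) / exp (d * (real n + 1))) \<longlongrightarrow> 0) sequentially"
    by (rule filterlim_compose[OF tendsto_power_div_exp_0])
  \<comment> \<open>The constant undoes the substitution of \<open>d * (n + 1)\<close> for the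
    variable: \<open>exp d\<close> for the shift by 1 and \<open>d ^ (2 * r)\<close> for the
    scaling.\<close>
  then have "(\<lambda>n. real B ^ r * C * exp d / d ^ (2 * r) * ((d * (real n + 1)) ^ (2 * r) / exp (d * (real n + 1)))) \<longlonglongrightarrow> 0"
    by (rule tendsto_mult_right_zero)
  from order_tendstoD(2)[OF this, of 1]
  have "\<forall>\<^sub>F n in sequentially. real B ^ r * C * exp d / d ^ (2 * r) * ((d * (real n + 1)) ^ (2 * r) / exp (d * (real n + 1))) < 1"
    by simp
  then show ?thesis
  proof eventually_elim
    case (elim n)
    have "real B ^ r * C * exp d / d ^ (2 * r) * ((d * (real n + 1)) ^ (2 * r) / exp (d * (real n + 1)))
        = real B ^ r * C * (real n + 1) ^ (2 * r) * (exp d / exp (d * (real n + 1)))"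
      using d by (simp add: power_mult_distrib)
    also have "exp d / exp (d * (real n + 1)) = exp (real n * s) / exp (real n * s')"
      by (simp add: exp_diff[symmetric] d_def algebra_simps)
    also have "real B ^ r * C * (real n + 1) ^ (2 * r) * (exp (real n * s) / exp (real n * s'))
        = (real ((n + 1)\<^sup>2 * B)) ^ r * C * exp (real n * s) / exp (real n * s')"
      by (simp add: power_mult_distrib power_mult[symmetric] add.commute)
    finally have "(real ((n + 1)\<^sup>2 * B)) ^ r * C * exp (real n * s) / exp (real n * s') < 1"
      using elim by (simp only:)
    then show ?case by (simp only: divide_less_eq_1_pos[OF exp_gt_zero] less_imp_le)
  qed
qed

text \<open>All repetitions belonging to one class are placed together before the next class.
  Repeating whole passes through the classes would require returning to a class already
  left.\<close>

definition interleave :: "('i \<Rightarrow> bool) \<Rightarrow> ('i \<Rightarrow> bool) \<Rightarrow> nat \<Rightarrow> nat \<Rightarrow> ('i \<Rightarrow> 'b) \<Rightarrow> ('i \<Rightarrow> 'b) \<Rightarrow> 'i list \<Rightarrow> 'b list" where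
  "interleave P Q p q F G xs = concat (map (\<lambda>A. (if P A then replicate p (F A) else []) @ (if Q A then replicate q (G A) else [])) xs)"

lemma sum_interleave:
  fixes \<phi> :: "'b \<Rightarrow> 'c::comm_semiring_1"
  shows "(\<Sum>b\<leftarrow>interleave P Q p q F G xs. \<phi> b) =
    of_nat p * (\<Sum>A\<leftarrow>filter P xs. \<phi> (F A)) + of_nat q * (\<Sum>A\<leftarrow>filter Q xs. \<phi> (G A))"
  by (induction xs) (auto simp: interleave_def sum_list_replicate algebra_simps)

lemma prod_interleave:
  fixes \<phi> :: "'b \<Rightarrow> 'c::comm_semiring_1"
  shows "(\<Prod>b\<leftarrow>interleave P Q p q F G xs. \<phi> b) =
    (\<Prod>A\<leftarrow>filter P xs. \<phi> (F A)) ^ p * (\<Prod>A\<leftarrow>filter Q xs. \<phi> (G A)) ^ q"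
  by (induction xs) (auto simp: interleave_def prod_list_replicate power_mult_distrib mult_ac)

lemma set_interleave: "b \<in> set (interleave P Q p q F G xs) \<Longrightarrow> \<exists>A\<in>set xs. b = F A \<or> b = G A"
  by (auto simp: interleave_def split: if_splits)

lemma sorted_interleave:
  fixes F G :: "'i \<Rightarrow> 'i \<times> 'b"
  assumes "sorted_wrt r xs" "\<And>A. A \<in> set xs \<Longrightarrow> r A A" "\<And>A. fst (F A) = A" "\<And>A. fst (G A) = A"
  shows "sorted_wrt (\<lambda>b b'. r (fst b) (fst b')) (interleave P Q p q F G xs)"
  using assms(1,2)
proof (induction xs)
  case Nil
  then show ?case by (simp add: interleave_def)
next
  case (Cons A xs)
  have rep: "sorted_wrt (\<lambda>b b'. r (fst b) (fst b')) (replicate n b)" if "fst b = A" for n and b :: "'i \<times> 'b"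
    using that Cons.prems(2)[of A] by (induction n) auto
  have "r A (fst b)" if "b \<in> set (interleave P Q p q F G xs)" for b
    using set_interleave[OF that] Cons.prems(1) assms(3,4) by auto
  then show ?case
    using Cons rep assms(3,4) by (auto simp: interleave_def sorted_wrt_append)
qed

lemma openin_weak_positive:
  fixes V :: "'i \<Rightarrow> 'a::metric_space set"
  assumes "finite S" "\<And>A. A \<in> S \<Longrightarrow> open (V A)"
  shows "openin weak_topology {\<nu> \<in> prob_measures. \<forall>A\<in>S. 0 < measure \<nu> (V A)}"
  using assms
proof (induction S)
  case empty
  then show ?case by (simp add: openin_weak_prob_measures)
next
  case (insert A S)
  have "openin weak_topology ({\<nu> \<in> prob_measures. \<forall>A\<in>S. 0 < measure \<nu> (V A)} \<inter> {\<nu> \<in> prob_measures. 0 < measure \<nu> (V A)})"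
    using insert by (intro openin_Int openin_weak_open_set) auto
  also have "\<dots> = {\<nu> \<in> prob_measures. \<forall>A\<in>insert A S. 0 < measure \<nu> (V A)}" by auto
  finally show ?case .
qed

text \<open>The intervals are recast as timed blocks; \<open>()\<close> fills the slot of the path
  set, as only positions enter.\<close>

lemma block_cover:
  fixes V :: "'i \<Rightarrow> 'b set" and x :: "nat \<Rightarrow> 'b"
  assumes "distinct ys" "sorted_wrt (\<lambda>A B. t A + l A < t B) ys" "\<forall>A\<in>set ys. t A + l A < n"
  shows "\<forall>A\<in>set ys. \<forall>k\<in>{1..n}. x k \<in> V A \<longrightarrow> t A < k \<and> k \<le> Suc (t A + l A) \<Longrightarrow>
      card {k\<in>{1..n}. x k \<in> (\<Union>A\<in>set ys. V A)} \<le> (\<Sum>A\<leftarrow>ys. Suc (l A))"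
    and "\<forall>k. \<bar>g k\<bar> \<le> 1 \<Longrightarrow> \<bar>(\<Sum>k=1..n. g k) - (\<Sum>A\<leftarrow>ys. block_sum g (t A, l A, ()))\<bar> \<le> real n - real (\<Sum>A\<leftarrow>ys. Suc (l A))"
    and "\<forall>k. 0 \<le> g k \<Longrightarrow> (\<Sum>A\<leftarrow>ys. block_sum g (t A, l A, ())) \<le> (\<Sum>k=1..n. g k)"
    and "(\<Sum>A\<leftarrow>ys. Suc (l A)) \<le> n"
proof -
  define bs where "bs = map (\<lambda>A. (t A, l A, ())) ys"
  have bs: "sorted_wrt before bs" "\<And>t l G. (t, l, G) \<in> set bs \<Longrightarrow> t + l < n"
    using assms(2,3) by (auto simp: bs_def sorted_wrt_map before_def)
  have len: "(\<Sum>b\<leftarrow>bs. block_length b) = (\<Sum>A\<leftarrow>ys. Suc (l A))"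
    by (simp add: bs_def block_length_def o_def)
  have sum: "(\<Sum>b\<leftarrow>bs. block_sum g b) = (\<Sum>A\<leftarrow>ys. block_sum g (t A, l A, ()))" for g
    by (simp add: bs_def o_def)
  have 2: "\<bar>(\<Sum>k=1..n. g k) - (\<Sum>A\<leftarrow>ys. block_sum g (t A, l A, ()))\<bar> \<le> real n - real (\<Sum>A\<leftarrow>ys. Suc (l A))"
    if "\<forall>k. \<bar>g k\<bar> \<le> 1" for g
    using sum_blocks[of g bs n] that bs by (simp only: len sum)
  then show "\<forall>k. \<bar>g k\<bar> \<le> 1 \<Longrightarrow> \<bar>(\<Sum>k=1..n. g k) - (\<Sum>A\<leftarrow>ys. block_sum g (t A, l A, ()))\<bar> \<le> real n - real (\<Sum>A\<leftarrow>ys. Suc (l A))" .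
  show "\<forall>k. 0 \<le> g k \<Longrightarrow> (\<Sum>A\<leftarrow>ys. block_sum g (t A, l A, ())) \<le> (\<Sum>k=1..n. g k)"
    using sum_blocks_weak[of g bs n] bs by (simp only: sum)
  have "0 \<le> real n - real (\<Sum>A\<leftarrow>ys. Suc (l A))"
    by (rule order_trans[OF abs_ge_zero 2[of "\<lambda>_. 0"]]) simp
  then show "(\<Sum>A\<leftarrow>ys. Suc (l A)) \<le> n" by linarith
  assume cov: "\<forall>A\<in>set ys. \<forall>k\<in>{1..n}. x k \<in> V A \<longrightarrow> t A < k \<and> k \<le> Suc (t A + l A)"
  have "card {k\<in>{1..n}. x k \<in> (\<Union>A\<in>set ys. V A)} \<le> card (\<Union>A\<in>set ys. {t A<..t A + Suc (l A)})"
    using cov by (intro card_mono) fastforce+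
  also have "\<dots> \<le> (\<Sum>A\<in>set ys. card {t A<..t A + Suc (l A)})"
    by (rule card_UN_le) simp
  also have "\<dots> = (\<Sum>A\<leftarrow>ys. Suc (l A))"
    using assms(1) by (simp add: sum_list_distinct_conv_sum_set)
  finally show "card {k\<in>{1..n}. x k \<in> (\<Union>A\<in>set ys. V A)} \<le> (\<Sum>A\<leftarrow>ys. Suc (l A))" .
qed

lemma sum_list_abs_diff_le:
  fixes u v w :: "'i \<Rightarrow> real"
  assumes "\<And>i. i \<in> set is \<Longrightarrow> \<bar>u i - v i\<bar> \<le> w i"
  shows "\<bar>(\<Sum>i\<leftarrow>is. u i) - (\<Sum>i\<leftarrow>is. v i)\<bar> \<le> (\<Sum>i\<leftarrow>is. w i)"
  using assms
proof (induction "is")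
  case (Cons i "is")
  from Cons.IH Cons.prems have "\<bar>(\<Sum>i\<leftarrow>is. u i) - (\<Sum>i\<leftarrow>is. v i)\<bar> \<le> (\<Sum>i\<leftarrow>is. w i)" by simp
  with Cons.prems[of i] show ?case by simp
qed simp

section \<open>Blocks extracted at one large time\<close>

context density_chain
begin

text \<open>The limsup provides arbitrarily large \<open>N\<close> at which a neighbourhood has
  probability at least \<open>exp (N * s')\<close>, with \<open>s'\<close> slightly above
  \<open>s\<close>. The slack pays in advance for the number of data, for \<open>R\<close>, and for
  the factor \<open>L\<^sup>2\<close> of each later gap.\<close>

lemma extraction:
  fixes V :: "'a set \<Rightarrow> 'a set"
  assumes ys: "set ys \<subseteq> comm_classes \<rho>" "distinct ys" "sorted_wrt (leads_to \<rho>) ys"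
    and V: "\<And>A. A \<in> set ys \<Longrightarrow> V A \<subseteq> A" "\<And>A. A \<in> set ys \<Longrightarrow> open (V A)"
      "\<And>A. A \<in> set ys \<Longrightarrow> emeasure lborel (V A) < \<infinity>"
    and nu: "\<nu> \<in> prob_measures" "\<And>A. A \<in> set ys \<Longrightarrow> 0 < measure \<nu> (V A)" "1 - \<epsilon> < measure \<nu> (\<Union>A\<in>set ys. V A)"
    and Fs: "finite Fs" "\<And>f. f \<in> Fs \<Longrightarrow> continuous_on UNIV f" "\<And>f x. f \<in> Fs \<Longrightarrow> \<bar>f x\<bar> \<le> (1::real)"
    and pos: "0 < \<epsilon>" "0 < \<theta>" "0 < L"
    and s: "ereal s < upper_rate \<nu>"
  obtains N l c where "N0 \<le> N" "0 < N"
    "exp (real N * s) \<le> (\<Prod>A\<leftarrow>ys. mass (l A) (cell_block Fs (\<theta> * real N) (V A) (l A) (c A)) / (real L)\<^sup>2)"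
    "(1 - \<epsilon>) * real N \<le> real (\<Sum>A\<leftarrow>ys. Suc (l A))" "(\<Sum>A\<leftarrow>ys. Suc (l A)) \<le> N"
    "\<And>f. f \<in> Fs \<Longrightarrow> \<bar>(\<Sum>A\<leftarrow>ys. \<theta> * real N * of_int (c A f)) - real N * (\<integral>x. f x \<partial>\<nu>)\<bar> \<le> (2 * \<epsilon> + real (length ys) * \<theta>) * real N"
proof -
  note choose = that
  define U where "U = (\<Union>A\<in>set ys. V A)"
  \<comment> \<open>Membership forces the path to spend most of its time in the parts, to visit each
    of them, and to have nearly the averages of \<nu>. The first two conditions are open because the
    parts are.\<close>
  define V' where "V' = {\<nu> \<in> prob_measures. 1 - \<epsilon> < measure \<nu> U} \<inter> {\<nu> \<in> prob_measures. \<forall>A\<in>set ys. 0 < measure \<nu> (V A)} \<inter>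
    {\<nu>' \<in> prob_measures. \<forall>f\<in>Fs. \<bar>(\<integral>x. f x \<partial>\<nu>') - (\<integral>x. f x \<partial>\<nu>)\<bar> < \<epsilon>}"
  have U: "open U" using V(2) by (auto simp: U_def)
  have V': "openin weak_topology V'"
    unfolding V'_def using U V(2) Fs
    by (intro openin_Int openin_weak_open_set openin_weak_positive openin_weak_ball) auto
  have nuV: "\<nu> \<in> V'" using nu pos by (auto simp: V'_def U_def)
  obtain s' where s': "s < s'" "ereal s' < upper_rate \<nu>"
    using ereal_dense2[OF s] by auto
  let ?B = "(2 * nat \<lceil>1 / \<theta>\<rceil> + 1) ^ card Fs"
  let ?K = "\<lambda>n. (real ((n + 1)\<^sup>2 * ?B)) ^ length ys"
  \<comment> \<open>The cost, per block, of passing from the factor \<open>R * mass\<close> of the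
    upper bound to the factor \<open>mass / L\<^sup>2\<close> of the lower bound.\<close>
  let ?C = "(R * (real L)\<^sup>2) ^ length ys"
  have "\<forall>\<^sub>F n in sequentially. ?K n * ?C * exp (real n * s) \<le> exp (real n * s') \<and> N0 \<le> n \<and> 0 < n"
    by (intro eventually_conj subexponential s'(1) eventually_ge_at_top eventually_gt_at_top)
  then obtain N where N: "exp (real N * s') \<le> prob (emp_event V' N)" "?K N * ?C * exp (real N * s) \<le> exp (real N * s')" "N0 \<le> N" "0 < N"
    using frequently_eventually_conj[OF upper_rate_greaterD[OF s'(2) V' nuV]] by (auto dest!: frequently_ex)
  have W: "emp_event V' N \<in> events" "0 < prob (emp_event V' N)"
    using emp_event_measurable[OF _ V'] N(1,4) less_le_trans[OF exp_gt_zero N(1)] by auto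
  have emp: "1 - \<epsilon> < real (card {i\<in>{1..N}. X i \<omega> \<in> U}) / real N"
    "\<And>A. A \<in> set ys \<Longrightarrow> \<exists>k\<in>{1..N}. X k \<omega> \<in> V A"
    "\<And>f. f \<in> Fs \<Longrightarrow> \<bar>(\<Sum>i=1..N. f (X i \<omega>)) - real N * (\<integral>x. f x \<partial>\<nu>)\<bar> \<le> \<epsilon> * real N"
    if w: "\<omega> \<in> emp_event V' N" for \<omega>
  proof -
    have N1: "1 \<le> N" using N(4) by simp
    show "1 - \<epsilon> < real (card {i\<in>{1..N}. X i \<omega> \<in> U}) / real N"
      using w U by (auto simp: V'_def measure_empirical[OF N1])
    show "\<exists>k\<in>{1..N}. X k \<omega> \<in> V A" if A: "A \<in> set ys" for A
    proof -
      have "0 < measure (empirical X N \<omega>) (V A)" using w A by (auto simp: V'_def)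
      then have "{i\<in>{1..N}. X i \<omega> \<in> V A} \<noteq> {}"
        using V(2)[OF A] by (simp add: measure_empirical[OF N1] zero_less_divide_iff card_gt_0_iff)
      then show ?thesis by auto
    qed
    fix f assume f: "f \<in> Fs"
    then have [measurable]: "f \<in> borel_measurable borel" using Fs(2) by (simp add: borel_measurable_continuous_onI)
    have "\<bar>(\<Sum>i=1..N. f (X i \<omega>)) / real N - (\<integral>x. f x \<partial>\<nu>)\<bar> < \<epsilon>"
      using w f by (auto simp: V'_def integral_empirical[OF N1])
    also have "(\<Sum>i=1..N. f (X i \<omega>)) / real N - (\<integral>x. f x \<partial>\<nu>) = ((\<Sum>i=1..N. f (X i \<omega>)) - real N * (\<integral>x. f x \<partial>\<nu>)) / real N"
      using N(4) by (simp add: field_simps)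
    finally show "\<bar>(\<Sum>i=1..N. f (X i \<omega>)) - real N * (\<integral>x. f x \<partial>\<nu>)\<bar> \<le> \<epsilon> * real N"
      using N(4) by (simp add: field_simps)
  qed
  have meas: "f \<in> borel_measurable borel" if "f \<in> Fs" for f
    using Fs(2)[OF that] by (rule borel_measurable_continuous_onI)
  have Vb: "V A \<in> sets borel" if "A \<in> set ys" for A using V(2)[OF that] by (rule borel_open)
  obtain \<omega> t l c where dec: "\<omega> \<in> emp_event V' N"
    "sorted_wrt (\<lambda>A B. t A + l A < t B) ys"
    "\<And>A. A \<in> set ys \<Longrightarrow> t A + l A < N"
    "\<And>A. A \<in> set ys \<Longrightarrow> chain_path X (t A) (Suc (l A)) \<omega> \<in> cell_block Fs (\<theta> * real N) (V A) (l A) (c A)"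
    "\<And>A k. A \<in> set ys \<Longrightarrow> k \<in> {1..N} \<Longrightarrow> X k \<omega> \<in> V A \<Longrightarrow> t A < k \<and> k \<le> Suc (t A + l A)"
    "prob (emp_event V' N) \<le> ?K N * (\<Prod>A\<leftarrow>ys. R * mass (l A) (cell_block Fs (\<theta> * real N) (V A) (l A) (c A)))"
  proof -
    note obt = that
    show thesis
    proof (rule path_decomposition[where ys = ys and V = V and Fs = Fs and \<theta> = \<theta> and n = N
          and h = "\<theta> * real N" and W = "emp_event V' N"])
      show "V A \<subseteq> A" "V A \<in> sets borel" "emeasure lborel (V A) < \<infinity>" if "A \<in> set ys" for A
        using V Vb that by auto
      show "f \<in> borel_measurable borel" if "f \<in> Fs" for f using that by (rule meas)
      show "\<bar>f x\<bar> \<le> 1" if "f \<in> Fs" for f x using that by (rule Fs(3))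
      show "\<exists>k\<in>{1..N}. X k \<omega> \<in> V A" if "\<omega> \<in> emp_event V' N" "A \<in> set ys" for \<omega> A using that by (rule emp(2))
    qed (fact ys Fs(1) pos N W refl obt)+
  qed
  have "\<forall>A\<in>set ys. t A + l A < N" using dec(3) by blast
  note cov = block_cover[OF ys(2) dec(2) this]
  let ?m = "\<lambda>A. mass (l A) (cell_block Fs (\<theta> * real N) (V A) (l A) (c A))"
  have KC: "0 < ?K N * ?C" using R_pos pos(3) by (intro mult_pos_pos zero_less_power) auto
  have "?K N * ?C * exp (real N * s) \<le> ?K N * (\<Prod>A\<leftarrow>ys. R * ?m A)"
    using N(1,2) dec(6) by linarith
  also have "(\<Prod>A\<leftarrow>ys. R * ?m A) = ?C * (\<Prod>A\<leftarrow>ys. ?m A / (real L)\<^sup>2)"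
    using pos(3) by (induction ys) (simp_all add: field_simps)
  finally have "?K N * ?C * exp (real N * s) \<le> ?K N * ?C * (\<Prod>A\<leftarrow>ys. ?m A / (real L)\<^sup>2)"
    by (simp only: mult.assoc)
  then have 1: "exp (real N * s) \<le> (\<Prod>A\<leftarrow>ys. ?m A / (real L)\<^sup>2)"
    using KC by (subst (asm) mult_le_cancel_left_pos)
  have "real (card {k\<in>{1..N}. X k \<omega> \<in> U}) \<le> real (\<Sum>A\<leftarrow>ys. Suc (l A))"
    unfolding U_def of_nat_le_iff by (rule cov(1)) (use dec(5) in blast)
  moreover have "(1 - \<epsilon>) * real N < real (card {k\<in>{1..N}. X k \<omega> \<in> U})"
    using emp(1)[OF dec(1)] N(4) by (simp add: field_simps)
  ultimately have 2: "(1 - \<epsilon>) * real N \<le> real (\<Sum>A\<leftarrow>ys. Suc (l A))" by linarith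
  \<comment> \<open>One \<epsilon> comes from the neighbourhood, one from the times outside the
    blocks, and each block adds \<theta> through its cell.\<close>
  have 3: "\<bar>(\<Sum>A\<leftarrow>ys. \<theta> * real N * of_int (c A f)) - real N * (\<integral>x. f x \<partial>\<nu>)\<bar> \<le> (2 * \<epsilon> + real (length ys) * \<theta>) * real N"
    if f: "f \<in> Fs" for f
  proof -
    have "\<bar>(\<Sum>A\<leftarrow>ys. block_sum (\<lambda>k. f (X k \<omega>)) (t A, l A, ())) - (\<Sum>A\<leftarrow>ys. \<theta> * real N * of_int (c A f))\<bar> \<le> (\<Sum>A\<leftarrow>ys. \<theta> * real N)"
      using pos(2) N(4) f by (intro sum_list_abs_diff_le cell_sum[OF dec(4)]) auto
    moreover have "(\<Sum>A\<leftarrow>ys. \<theta> * real N) = real (length ys) * \<theta> * real N"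
      by (simp add: sum_list_triv)
    moreover have "\<bar>(\<Sum>k=1..N. f (X k \<omega>)) - (\<Sum>A\<leftarrow>ys. block_sum (\<lambda>k. f (X k \<omega>)) (t A, l A, ()))\<bar> \<le> real N - real (\<Sum>A\<leftarrow>ys. Suc (l A))"
      by (rule cov(2)) (use Fs(3)[OF f] in blast)
    ultimately show ?thesis
      using emp(3)[OF dec(1) f] 2 by (simp add: algebra_simps)
  qed
  show thesis by (rule choose[OF N(3,4) 1 2 cov(4) 3])
qed

end

text \<open>\<open>q\<close> rounds fit into time \<open>n * w\<close>, each with \<open>N\<close>
  points of blocks and \<open>K\<close> of gaps. Rounding loses less than one round and the gaps
  lose a fraction \<epsilon> of the time; each is at most \<open>\<epsilon> * n\<close>.\<close>

lemma floor_quotient_bounds: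
  fixes w \<epsilon> :: real
  assumes "0 \<le> w" "w \<le> 1" "0 < \<epsilon>" "0 < N" "real K \<le> \<epsilon> * real N" "real (N + K) \<le> \<epsilon> * real n"
    and q: "q = nat \<lfloor>real n * w / real (N + K)\<rfloor>"
  shows "real q * real (N + K) \<le> real n * w" "real q * real N \<le> real n * w" "real n * w - 2 * \<epsilon> * real n \<le> real q * real N"
proof -
  have T: "0 < real (N + K)" using assms(4) by simp
  have nn: "0 \<le> real n * w / real (N + K)" using assms(1) by simp
  have "real q \<le> real n * w / real (N + K)" using nn by (simp add: q)
  then show 1: "real q * real (N + K) \<le> real n * w" using T by (simp add: field_simps)
  have "real q * real N \<le> real q * real (N + K)" by (intro mult_left_mono) auto
  with 1 show 2: "real q * real N \<le> real n * w" by linarith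
  have "real n * w / real (N + K) < real q + 1" unfolding q using nn by linarith
  then have "real n * w < real q * real (N + K) + real (N + K)" using T by (simp add: field_simps)
  moreover have "real q * real (N + K) = real q * real N + real q * real K" by (simp add: algebra_simps)
  moreover have "real q * real K \<le> \<epsilon> * real n"
  proof -
    have "real q * real K \<le> real q * (\<epsilon> * real N)" using assms(5) by (intro mult_left_mono) auto
    also have "\<dots> = \<epsilon> * (real q * real N)" by simp
    also have "\<dots> \<le> \<epsilon> * (real n * w)" using 2 assms(3) by (intro mult_left_mono) auto
    also have "\<dots> \<le> \<epsilon> * (real n * 1)" using assms(2,3) by (intro mult_left_mono) auto
    finally show ?thesis by simp
  qed
  ultimately show "real n * w - 2 * \<epsilon> * real n \<le> real q * real N" using assms(6) by linarith
qed

lemma abs_integral_le_1: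
  fixes f :: "'a::topological_space \<Rightarrow> real"
  assumes "\<nu> \<in> prob_measures" "f \<in> borel_measurable borel" "\<And>x. \<bar>f x\<bar> \<le> 1"
  shows "\<bar>\<integral>x. f x \<partial>\<nu>\<bar> \<le> 1"
proof -
  interpret prob_space \<nu> using assms(1) by (rule prob_measuresD)
  have "\<bar>\<integral>x. f x \<partial>\<nu>\<bar> \<le> (\<integral>x. \<bar>f x\<bar> \<partial>\<nu>)" by (rule integral_abs_bound)
  also have "\<dots> \<le> (\<integral>x. 1 \<partial>\<nu>)"
    using assms(3) by (intro integral_mono integrable_abs integrable_bounded_borel[OF assms]) auto
  finally show ?thesis by (simp add: prob_space)
qed

text \<open>Dropping null parts lets one frame of a mixture serve each component, whose typical
  paths need not visit all of its parts.\<close>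

lemma charged_parts:
  fixes V :: "'i \<Rightarrow> 'a::topological_space set"
  assumes "\<nu> \<in> prob_measures" "finite S" "\<And>A. A \<in> S \<Longrightarrow> open (V A)"
  shows "measure \<nu> (\<Union>A\<in>S. V A) \<le> measure \<nu> (\<Union>A\<in>{A \<in> S. 0 < measure \<nu> (V A)}. V A)"
proof -
  interpret prob_space \<nu> using assms(1) by (rule prob_measuresD)
  note s = prob_measuresD(2)[OF assms(1)]
  let ?P = "{A \<in> S. 0 < measure \<nu> (V A)}" and ?Q = "{A \<in> S. \<not> 0 < measure \<nu> (V A)}"
  have o: "(\<Union>A\<in>?P. V A) \<in> sets \<nu>" "(\<Union>A\<in>?Q. V A) \<in> sets \<nu>"
    unfolding s using assms(3) by (intro borel_open open_UN; simp)+
  have "(\<Union>A\<in>S. V A) = (\<Union>A\<in>?P. V A) \<union> (\<Union>A\<in>?Q. V A)" by auto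
  then have "measure \<nu> (\<Union>A\<in>S. V A) \<le> measure \<nu> (\<Union>A\<in>?P. V A) + measure \<nu> (\<Union>A\<in>?Q. V A)"
    using measure_Un_le[OF o] by simp
  also have "measure \<nu> (\<Union>A\<in>?Q. V A) \<le> (\<Sum>A\<in>?Q. measure \<nu> (V A))"
    using assms(2,3) by (intro finite_measure_subadditive_finite) (auto simp: s)
  also have "\<dots> = 0"
    using measure_nonneg[of \<nu>] by (intro sum.neutral) (auto simp: not_less intro: antisym)
  finally show ?thesis by simp
qed

text \<open>The mass that a mixture misses is at least \<open>t\<close>, respectively
  \<open>1 - t\<close>, times the mass missed by a component; hence the factor
  \<open>min t (1 - t)\<close>.\<close>

lemma mixture_big:
  assumes "\<mu> \<in> prob_measures" "\<nu> \<in> prob_measures" "0 < t" "t < 1" "S \<in> sets borel"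
    and "1 - \<epsilon> * min t (1 - t) < measure (mixture t \<mu> \<nu>) S" "0 < \<epsilon>"
  shows "1 - \<epsilon> < measure \<mu> S" "1 - \<epsilon> < measure \<nu> S"
proof -
  interpret mu: prob_space \<mu> using assms(1) by (rule prob_measuresD)
  interpret nu: prob_space \<nu> using assms(2) by (rule prob_measuresD)
  have m: "1 - \<epsilon> * min t (1 - t) < t * measure \<mu> S + (1 - t) * measure \<nu> S"
    using assms(6) measure_mixture[OF assms(1,2) _ assms(5), of t] assms(3,4) by simp
  have le: "t * measure \<mu> S \<le> t * 1" "(1 - t) * measure \<nu> S \<le> (1 - t) * 1"
    using assms(3,4) mu.prob_le_1 nu.prob_le_1 by (intro mult_left_mono; simp)+
  have e: "\<epsilon> * min t (1 - t) \<le> \<epsilon> * t" "\<epsilon> * min t (1 - t) \<le> \<epsilon> * (1 - t)"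
    using assms(7) by (intro mult_left_mono; simp)+
  have "t * (1 - \<epsilon>) < t * measure \<mu> S" using m le e by (simp add: algebra_simps)
  then show "1 - \<epsilon> < measure \<mu> S" using assms(3) by simp
  have "(1 - t) * (1 - \<epsilon>) < (1 - t) * measure \<nu> S" using m le e by (simp add: algebra_simps)
  then show "1 - \<epsilon> < measure \<nu> S" using assms(4) by simp
qed

section \<open>Concatenation in prescribed proportions\<close>

context density_chain
begin

lemma frameD:
  assumes "frame \<mu> \<epsilon> xs V L"
  shows "set xs \<subseteq> comm_classes \<rho>" "distinct xs" "sorted_wrt (leads_to \<rho>) xs" "0 < L"
    "A \<in> set xs \<Longrightarrow> open (V A)" "A \<in> set xs \<Longrightarrow> V A \<subseteq> A" "A \<in> set xs \<Longrightarrow> emeasure lborel (V A) < \<infinity>"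
    "A \<in> set xs \<Longrightarrow> 0 < measure \<mu> (V A)" "A \<in> set xs \<Longrightarrow> links L {None} (V A)"
    "A \<in> set xs \<Longrightarrow> B \<in> set xs \<Longrightarrow> leads_to \<rho> A B \<Longrightarrow> links L (Some ` V A) (V B)"
    "1 - \<epsilon> < measure \<mu> (\<Union>A\<in>set xs. V A)"
    "A \<in> set xs \<Longrightarrow> compact (closure (V A))" "A \<in> set xs \<Longrightarrow> closure (V A) \<subseteq> A"
proof -
  show "A \<in> set xs \<Longrightarrow> V A \<subseteq> A"
    using assms closure_subset[of "V A"] unfolding frame_def by blast
  assume "A \<in> set xs"
  then have "bounded (closure (V A))" using assms unfolding frame_def by (blast intro: compact_imp_bounded)
  then have "bounded (V A)" using closure_subset bounded_subset by blast
  then show "emeasure lborel (V A) < \<infinity>" by (rule emeasure_bounded_finite)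
qed (use assms in \<open>auto simp: frame_def\<close>)

text \<open>Long blocks typical for \<open>\<mu>1\<close> and for \<open>\<mu>2\<close> are repeated in the proportions \<open>t\<close> and
  \<open>1 - t\<close>, class by class.\<close>

lemma lower_rate_mixture:
  assumes mu: "\<mu>1 \<in> prob_measures" "\<mu>2 \<in> prob_measures" and t: "0 < t" "t < 1"
    and ord: "orderly (mixture t \<mu>1 \<mu>2)"
    and s: "ereal s1 < upper_rate \<mu>1" "ereal s2 < upper_rate \<mu>2"
  shows "ereal (t * s1 + (1 - t) * s2) \<le> lower_rate (mixture t \<mu>1 \<mu>2)"
  unfolding lower_rate_def
proof (rule INF_greatest)
  let ?\<mu> = "mixture t \<mu>1 \<mu>2"
  fix W assume "W \<in> {V. openin weak_topology V \<and> ?\<mu> \<in> V}"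
  then have W: "openin weak_topology W" "?\<mu> \<in> W" by auto
  obtain Fs \<delta> where Fs: "finite Fs" "0 < \<delta>" "\<And>f. f \<in> Fs \<Longrightarrow> continuous_on UNIV f" "\<And>f x. f \<in> Fs \<Longrightarrow> \<bar>f x\<bar> \<le> (1::real)"
    and FsW: "\<And>\<nu>. \<nu> \<in> prob_measures \<Longrightarrow> (\<And>f. f \<in> Fs \<Longrightarrow> \<bar>(\<integral>x. f x \<partial>\<nu>) - (\<integral>x. f x \<partial>?\<mu>)\<bar> < \<delta>) \<Longrightarrow> \<nu> \<in> W"
    using weak_topology_nbhd[OF W] by metis
  have meas: "f \<in> borel_measurable borel" if "f \<in> Fs" for f
    using Fs(3)[OF that] by (rule borel_measurable_continuous_onI)
  \<comment> \<open>The errors collected at the end add up to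
    \<open>13 * \<epsilon> * n\<close>.\<close>
  define \<epsilon> where "\<epsilon> = \<delta> / 14"
  have eps: "0 < \<epsilon>" "14 * \<epsilon> = \<delta>" using Fs(2) by (auto simp: \<epsilon>_def)
  have "0 < \<epsilon> * min t (1 - t)" using eps t by simp
  with ord obtain xs V L where fr: "frame ?\<mu> (\<epsilon> * min t (1 - t)) xs V L" by (rule frame_exists)
  note xs = frameD[OF fr]
  have oU: "open (\<Union>A\<in>set xs. V A)" using xs(5) by auto
  note big = mixture_big[OF mu t borel_open[OF oU] xs(11) eps(1)]
  define r where "r = length xs"
  \<comment> \<open>At most \<open>r\<close> blocks occur in a round, so their cells together
    contribute at most \<epsilon>; adding 1 keeps the quotient meaningful for
    \<open>r = 0\<close>.\<close>
  define \<theta> where "\<theta> = \<epsilon> / (real r + 1)"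
  have th: "0 < \<theta>" using eps by (simp add: \<theta>_def)
  have rth: "real (length (filter P xs)) * \<theta> \<le> \<epsilon>" for P
  proof -
    have "real (length (filter P xs)) * \<theta> \<le> (real r + 1) * \<theta>"
    proof (rule mult_right_mono)
      have "real (length (filter P xs)) \<le> real r"
        unfolding r_def of_nat_le_iff by (rule length_filter_le)
      then show "real (length (filter P xs)) \<le> real r + 1" by simp
    qed (use th in simp)
    then show ?thesis by (simp add: \<theta>_def)
  qed
  \<comment> \<open>A bound for the total length of the gaps in one round.\<close>
  define K where "K = r * L"
  have KP: "length (filter P xs) * L \<le> K" for P
    unfolding K_def r_def by (intro mult_right_mono) auto
  \<comment> \<open>Both components use the parts and the link length of one frame of the mixture;
    otherwise their blocks could not be joined to each other.\<close>
  have ext: "\<exists>N l c. real K \<le> \<epsilon> * real N \<and> 0 < N \<and>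
    exp (real N * s) \<le> (\<Prod>A\<leftarrow>filter (\<lambda>A. 0 < measure \<nu> (V A)) xs. mass (l A) (cell_block Fs (\<theta> * real N) (V A) (l A) (c A)) / (real L)\<^sup>2) \<and>
    (1 - \<epsilon>) * real N \<le> real (\<Sum>A\<leftarrow>filter (\<lambda>A. 0 < measure \<nu> (V A)) xs. Suc (l A)) \<and>
    (\<Sum>A\<leftarrow>filter (\<lambda>A. 0 < measure \<nu> (V A)) xs. Suc (l A)) \<le> N \<and>
    (\<forall>f\<in>Fs. \<bar>(\<Sum>A\<leftarrow>filter (\<lambda>A. 0 < measure \<nu> (V A)) xs. \<theta> * real N * of_int (c A f)) - real N * (\<integral>x. f x \<partial>\<nu>)\<bar> \<le> 3 * \<epsilon> * real N)"
    if nu: "\<nu> \<in> prob_measures" "1 - \<epsilon> < measure \<nu> (\<Union>A\<in>set xs. V A)" "ereal s < upper_rate \<nu>" for \<nu> s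
  proof -
    let ?ys = "filter (\<lambda>A. 0 < measure \<nu> (V A)) xs"
    have "measure \<nu> (\<Union>A\<in>set xs. V A) \<le> measure \<nu> (\<Union>A\<in>{A \<in> set xs. 0 < measure \<nu> (V A)}. V A)"
      by (rule charged_parts[OF nu(1)]) (use xs(5) in auto)
    then have big: "1 - \<epsilon> < measure \<nu> (\<Union>A\<in>set ?ys. V A)" using nu(2) by simp
    \<comment> \<open>The lower bound on \<open>N\<close> makes the gaps of a round negligible:
      \<open>K\<close> is at most \<open>\<epsilon> * N\<close>.\<close>
    obtain N l c where ex: "nat \<lceil>real K / \<epsilon>\<rceil> \<le> N" "0 < N"
      "exp (real N * s) \<le> (\<Prod>A\<leftarrow>?ys. mass (l A) (cell_block Fs (\<theta> * real N) (V A) (l A) (c A)) / (real L)\<^sup>2)"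
      "(1 - \<epsilon>) * real N \<le> real (\<Sum>A\<leftarrow>?ys. Suc (l A))" "(\<Sum>A\<leftarrow>?ys. Suc (l A)) \<le> N"
      "\<forall>f\<in>Fs. \<bar>(\<Sum>A\<leftarrow>?ys. \<theta> * real N * of_int (c A f)) - real N * (\<integral>x. f x \<partial>\<nu>)\<bar> \<le> (2 * \<epsilon> + real (length ?ys) * \<theta>) * real N"
    proof -
      note obt = that
      show thesis
      proof (rule extraction[where ys = ?ys and V = V and \<nu> = \<nu> and \<epsilon> = \<epsilon> and \<theta> = \<theta> and Fs = Fs and L = L and s = s and ?N0.0 = "nat \<lceil>real K / \<epsilon>\<rceil>"])
        show "set ?ys \<subseteq> comm_classes \<rho>" using xs(1) by auto
        show "distinct ?ys" using xs(2) by simp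
        show "sorted_wrt (leads_to \<rho>) ?ys" using xs(3) by (rule sorted_wrt_filter)
        show "V A \<subseteq> A" "open (V A)" "emeasure lborel (V A) < \<infinity>" "0 < measure \<nu> (V A)" if "A \<in> set ?ys" for A
          using that xs(5-7) by auto
        show "continuous_on UNIV f" if "f \<in> Fs" for f using that by (rule Fs(3))
        show "\<bar>f x\<bar> \<le> 1" if "f \<in> Fs" for f x using that by (rule Fs(4))
        fix N l c
        assume "nat \<lceil>real K / \<epsilon>\<rceil> \<le> N" "0 < N"
          "exp (real N * s) \<le> (\<Prod>A\<leftarrow>?ys. mass (l A) (cell_block Fs (\<theta> * real N) (V A) (l A) (c A)) / (real L)\<^sup>2)"
          "(1 - \<epsilon>) * real N \<le> real (\<Sum>A\<leftarrow>?ys. Suc (l A))" "(\<Sum>A\<leftarrow>?ys. Suc (l A)) \<le> N"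
          "\<And>f. f \<in> Fs \<Longrightarrow> \<bar>(\<Sum>A\<leftarrow>?ys. \<theta> * real N * of_int (c A f)) - real N * (\<integral>x. f x \<partial>\<nu>)\<bar> \<le> (2 * \<epsilon> + real (length ?ys) * \<theta>) * real N"
        then show thesis by (intro obt) auto
      qed (fact nu big Fs(1) eps(1) th xs(4))+
    qed
    have "real K / \<epsilon> \<le> real N" using ex(1) by linarith
    then have 1: "real K \<le> \<epsilon> * real N" using eps(1) by (simp add: field_simps)
    have 2: "\<bar>(\<Sum>A\<leftarrow>?ys. \<theta> * real N * of_int (c A f)) - real N * (\<integral>x. f x \<partial>\<nu>)\<bar> \<le> 3 * \<epsilon> * real N" if "f \<in> Fs" for f
    proof -
      have "(2 * \<epsilon> + real (length ?ys) * \<theta>) * real N \<le> (3 * \<epsilon>) * real N"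
        using rth[of "\<lambda>A. 0 < measure \<nu> (V A)"] by (intro mult_right_mono) auto
      with ex(6) that show ?thesis by fastforce
    qed
    show ?thesis using ex 1 2 by blast
  qed
  define P1 where "P1 A \<longleftrightarrow> 0 < measure \<mu>1 (V A)" for A
  define P2 where "P2 A \<longleftrightarrow> 0 < measure \<mu>2 (V A)" for A
  obtain N1 l1 c1 where e1: "real K \<le> \<epsilon> * real N1" "0 < N1"
    "exp (real N1 * s1) \<le> (\<Prod>A\<leftarrow>filter P1 xs. mass (l1 A) (cell_block Fs (\<theta> * real N1) (V A) (l1 A) (c1 A)) / (real L)\<^sup>2)"
    "(1 - \<epsilon>) * real N1 \<le> real (\<Sum>A\<leftarrow>filter P1 xs. Suc (l1 A))"
    "(\<Sum>A\<leftarrow>filter P1 xs. Suc (l1 A)) \<le> N1"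
    "\<forall>f\<in>Fs. \<bar>(\<Sum>A\<leftarrow>filter P1 xs. \<theta> * real N1 * of_int (c1 A f)) - real N1 * (\<integral>x. f x \<partial>\<mu>1)\<bar> \<le> 3 * \<epsilon> * real N1"
    using ext[OF mu(1) big(1) s(1)] unfolding P1_def[abs_def] by blast
  obtain N2 l2 c2 where e2: "real K \<le> \<epsilon> * real N2" "0 < N2"
    "exp (real N2 * s2) \<le> (\<Prod>A\<leftarrow>filter P2 xs. mass (l2 A) (cell_block Fs (\<theta> * real N2) (V A) (l2 A) (c2 A)) / (real L)\<^sup>2)"
    "(1 - \<epsilon>) * real N2 \<le> real (\<Sum>A\<leftarrow>filter P2 xs. Suc (l2 A))"
    "(\<Sum>A\<leftarrow>filter P2 xs. Suc (l2 A)) \<le> N2"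
    "\<forall>f\<in>Fs. \<bar>(\<Sum>A\<leftarrow>filter P2 xs. \<theta> * real N2 * of_int (c2 A f)) - real N2 * (\<integral>x. f x \<partial>\<mu>2)\<bar> \<le> 3 * \<epsilon> * real N2"
    using ext[OF mu(2) big(2) s(2)] unfolding P2_def[abs_def] by blast
  \<comment> \<open>Rates are negative, so blocks that fill less than the time \<open>n * t\<close>,
    respectively \<open>n * (1 - t)\<close>, only improve the lower bound.\<close>
  have sneg: "s1 < 0" "s2 < 0"
    using less_le_trans[OF s(1) upper_rate_nonpos[OF mu(1)]] less_le_trans[OF s(2) upper_rate_nonpos[OF mu(2)]]
    by (simp_all add: zero_ereal_def)
  have "\<forall>\<^sub>F n in sequentially. ereal (t * s1 + (1 - t) * s2) \<le> log_rate M X W n"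
    using eventually_ge_at_top[of "nat \<lceil>real (N1 + N2 + K) / \<epsilon>\<rceil>"] eventually_ge_at_top[of 1]
  proof eventually_elim
    case (elim n)
    have "real (N1 + N2 + K) / \<epsilon> \<le> real n" using elim(1) by linarith
    then have nbig: "real (N1 + N2 + K) \<le> \<epsilon> * real n" using eps(1) by (simp add: field_simps)
    \<comment> \<open>The number of rounds that fit into the share of the first component, each with
      at most \<open>N1\<close> points of blocks and \<open>K\<close> of gaps.\<close>
    define q1 where "q1 = nat \<lfloor>real n * t / real (N1 + K)\<rfloor>"
    define q2 where "q2 = nat \<lfloor>real n * (1 - t) / real (N2 + K)\<rfloor>"
    note b1 = floor_quotient_bounds[OF _ _ eps(1) e1(2,1) _ q1_def]
    note b2 = floor_quotient_bounds[OF _ _ eps(1) e2(2,1) _ q2_def]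
    define a where "a = real q1 * real N1"
    define b where "b = real q2 * real N2"
    have ab: "real q1 * real (N1 + K) \<le> real n * t" "a \<le> real n * t" "real n * t - 2 * \<epsilon> * real n \<le> a"
      "real q2 * real (N2 + K) \<le> real n * (1 - t)" "b \<le> real n * (1 - t)" "real n * (1 - t) - 2 * \<epsilon> * real n \<le> b"
      unfolding a_def b_def using b1 b2 t nbig by auto
    have ab0: "0 \<le> a" "0 \<le> b" by (auto simp: a_def b_def)
    have abn: "a + b \<le> real n" using ab(2,5) by (simp add: algebra_simps)
    define F where "F A = (A, l1 A, \<theta> * real N1, c1 A)" for A
    define G where "G A = (A, l2 A, \<theta> * real N2, c2 A)" for A
    define bs where "bs = interleave P1 P2 q1 q2 F G xs"
    have bsx: "A \<in> set xs \<and> 0 < h" if m: "(A, l, h, c) \<in> set bs" for A l h c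
      using set_interleave[OF m[unfolded bs_def]] th e1(2) e2(2) by (auto simp: F_def G_def)
    have sorted: "sorted_wrt (\<lambda>b b'. leads_to \<rho> (fst b) (fst b')) bs"
      unfolding bs_def using xs(1,3) by (intro sorted_interleave) (auto simp: F_def G_def intro: leads_to_refl)
    have len: "(\<Sum>(A, l, h, c)\<leftarrow>bs. Suc l + L) \<le> n"
    proof -
      have "(\<Sum>(A, l, h, c)\<leftarrow>bs. Suc l + L) = q1 * (\<Sum>A\<leftarrow>filter P1 xs. Suc (l1 A) + L) + q2 * (\<Sum>A\<leftarrow>filter P2 xs. Suc (l2 A) + L)"
        unfolding bs_def sum_interleave by (simp add: F_def G_def)
      also have "\<dots> \<le> q1 * (N1 + K) + q2 * (N2 + K)"
      proof -
        have "(\<Sum>A\<leftarrow>filter P1 xs. Suc (l1 A) + L) = (\<Sum>A\<leftarrow>filter P1 xs. Suc (l1 A)) + length (filter P1 xs) * L"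
          by (simp only: sum_list_addf sum_list_triv of_nat_id)
        moreover have "(\<Sum>A\<leftarrow>filter P2 xs. Suc (l2 A) + L) = (\<Sum>A\<leftarrow>filter P2 xs. Suc (l2 A)) + length (filter P2 xs) * L"
          by (simp only: sum_list_addf sum_list_triv of_nat_id)
        ultimately show ?thesis
          using e1(5) e2(5) KP[of P1] KP[of P2] by (intro add_mono mult_left_mono) auto
      qed
      also have "\<dots> \<le> n"
      proof -
        have "real (q1 * (N1 + K) + q2 * (N2 + K)) \<le> real n * t + real n * (1 - t)"
          using ab(1,4) by (simp only: of_nat_add of_nat_mult)
        also have "\<dots> = real n" by (simp add: algebra_simps)
        finally show ?thesis by (simp only: of_nat_le_iff)
      qed
      finally show ?thesis .
    qed
    have S: "(1 - \<epsilon>) * (a + b) \<le> real (\<Sum>(A, l, h, c)\<leftarrow>bs. Suc l)"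
    proof -
      have "(\<Sum>(A, l, h, c)\<leftarrow>bs. Suc l) = q1 * (\<Sum>A\<leftarrow>filter P1 xs. Suc (l1 A)) + q2 * (\<Sum>A\<leftarrow>filter P2 xs. Suc (l2 A))"
        unfolding bs_def sum_interleave by (simp add: F_def G_def)
      then have "real (\<Sum>(A, l, h, c)\<leftarrow>bs. Suc l) = real q1 * real (\<Sum>A\<leftarrow>filter P1 xs. Suc (l1 A)) + real q2 * real (\<Sum>A\<leftarrow>filter P2 xs. Suc (l2 A))"
        by (simp only: of_nat_add of_nat_mult)
      moreover have "real q1 * ((1 - \<epsilon>) * real N1) \<le> real q1 * real (\<Sum>A\<leftarrow>filter P1 xs. Suc (l1 A))"
        using e1(4) by (intro mult_left_mono) auto
      moreover have "real q2 * ((1 - \<epsilon>) * real N2) \<le> real q2 * real (\<Sum>A\<leftarrow>filter P2 xs. Suc (l2 A))"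
        using e2(4) by (intro mult_left_mono) auto
      ultimately show ?thesis by (simp add: a_def b_def algebra_simps)
    qed
    have H: "(\<Sum>(A, l, h, c)\<leftarrow>bs. h) \<le> \<epsilon> * real n"
    proof -
      have "(\<Sum>(A, l, h, c)\<leftarrow>bs. h) = real q1 * (\<Sum>A\<leftarrow>filter P1 xs. \<theta> * real N1) + real q2 * (\<Sum>A\<leftarrow>filter P2 xs. \<theta> * real N2)"
        unfolding bs_def sum_interleave by (simp add: F_def G_def)
      also have "\<dots> = a * (real (length (filter P1 xs)) * \<theta>) + b * (real (length (filter P2 xs)) * \<theta>)"
        by (simp add: sum_list_triv a_def b_def)
      also have "\<dots> \<le> a * \<epsilon> + b * \<epsilon>"
        using rth[of P1] rth[of P2] ab0 by (intro add_mono mult_left_mono) auto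
      also have "\<dots> \<le> \<epsilon> * real n"
        using mult_left_mono[OF abn, of \<epsilon>] eps(1) by (simp add: algebra_simps)
      finally show ?thesis .
    qed
    have prod: "(\<Prod>(A, l, h, c)\<leftarrow>bs. mass l (cell_block Fs h (V A) l c) / (real L)\<^sup>2) =
        (\<Prod>A\<leftarrow>filter P1 xs. mass (l1 A) (cell_block Fs (\<theta> * real N1) (V A) (l1 A) (c1 A)) / (real L)\<^sup>2) ^ q1 *
        (\<Prod>A\<leftarrow>filter P2 xs. mass (l2 A) (cell_block Fs (\<theta> * real N2) (V A) (l2 A) (c2 A)) / (real L)\<^sup>2) ^ q2"
      unfolding bs_def prod_interleave by (simp add: F_def G_def)
    have "exp (real n * (t * s1 + (1 - t) * s2)) \<le> exp (a * s1 + b * s2)"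
    proof -
      have "real n * t * s1 \<le> a * s1" "real n * (1 - t) * s2 \<le> b * s2"
        using ab(2,5) sneg by (intro mult_right_mono_neg; simp)+
      moreover have "real n * (t * s1 + (1 - t) * s2) = real n * t * s1 + real n * (1 - t) * s2"
        by (simp add: algebra_simps)
      ultimately show ?thesis unfolding exp_le_cancel_iff by linarith
    qed
    also have "\<dots> = exp (real N1 * s1) ^ q1 * exp (real N2 * s2) ^ q2"
      by (simp add: a_def b_def exp_add exp_of_nat_mult[symmetric] mult.assoc)
    also have "\<dots> \<le> (\<Prod>(A, l, h, c)\<leftarrow>bs. mass l (cell_block Fs h (V A) l c) / (real L)\<^sup>2)"
      unfolding prod using e1(3) e2(3) by (intro mult_mono power_mono zero_le_power order_trans[OF exp_ge_zero e1(3)]) auto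
    also have "\<dots> \<le> prob {\<omega> \<in> space M. \<forall>f\<in>Fs. \<bar>(\<Sum>k=1..n. f (X k \<omega>)) - (\<Sum>(A, l, h, c)\<leftarrow>bs. h * of_int (c f))\<bar> \<le>
        real n - real (\<Sum>(A, l, h, c)\<leftarrow>bs. Suc l) + (\<Sum>(A, l, h, c)\<leftarrow>bs. h)}"
    proof (rule realize[where F = "set xs"])
      show "finite Fs" "0 < L" by fact+
      show "f \<in> borel_measurable borel" if "f \<in> Fs" for f using that by (rule meas)
      show "\<bar>f x\<bar> \<le> 1" if "f \<in> Fs" for f x using that by (rule Fs(4))
      show "links L {None} (V A)" "emeasure lborel (V A) < \<infinity>" "V A \<in> sets borel" if "A \<in> set xs" for A
        using that xs(5,7,9) by auto
      show "links L (Some ` V A) (V B)" if "A \<in> set xs" "B \<in> set xs" "leads_to \<rho> A B" for A B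
        using that by (rule xs(10))
      show "A \<in> set xs \<and> 0 < h" if "(A, l, h, c) \<in> set bs" for A l h c using that by (rule bsx)
    qed (fact sorted len)+
    also have "\<dots> \<le> prob (emp_event W n)"
    proof (rule finite_measure_mono[OF subsetI emp_event_measurable[OF elim(2) W(1)]])
      fix \<omega> assume w: "\<omega> \<in> {\<omega> \<in> space M. \<forall>f\<in>Fs. \<bar>(\<Sum>k=1..n. f (X k \<omega>)) - (\<Sum>(A, l, h, c)\<leftarrow>bs. h * of_int (c f))\<bar> \<le>
        real n - real (\<Sum>(A, l, h, c)\<leftarrow>bs. Suc l) + (\<Sum>(A, l, h, c)\<leftarrow>bs. h)}"
      have "empirical X n \<omega> \<in> W"
      proof (rule FsW[OF empirical_prob[OF elim(2)]])
        fix f assume f: "f \<in> Fs"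
        let ?I1 = "\<integral>x. f x \<partial>\<mu>1" and ?I2 = "\<integral>x. f x \<partial>\<mu>2" and ?S = "\<Sum>k=1..n. f (X k \<omega>)"
        let ?Z = "\<Sum>(A, l, h, c)\<leftarrow>bs. h * real_of_int (c f)"
        have I: "(\<integral>x. f x \<partial>?\<mu>) = t * ?I1 + (1 - t) * ?I2"
          using t by (intro integral_mixture[OF mu _ meas[OF f] Fs(4)[OF f]]) auto
        have I1: "\<bar>?I1\<bar> \<le> 1" "\<bar>?I2\<bar> \<le> 1"
          using abs_integral_le_1[OF _ meas[OF f] Fs(4)[OF f]] mu by auto
        have Z: "?Z = real q1 * (\<Sum>A\<leftarrow>filter P1 xs. \<theta> * real N1 * of_int (c1 A f)) + real q2 * (\<Sum>A\<leftarrow>filter P2 xs. \<theta> * real N2 * of_int (c2 A f))"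
          unfolding bs_def sum_interleave by (simp add: F_def G_def)
        have scale: "\<bar>real q * z - real q * real N * i\<bar> \<le> 3 * \<epsilon> * (real q * real N)" if "\<bar>z - real N * i\<bar> \<le> 3 * \<epsilon> * real N" for q N :: nat and z i :: real
        proof -
          have "real q * z - real q * real N * i = real q * (z - real N * i)"
            by (simp add: right_diff_distrib mult.assoc)
          then have "\<bar>real q * z - real q * real N * i\<bar> = real q * \<bar>z - real N * i\<bar>"
            by (simp only: abs_mult abs_of_nat)
          also have "\<dots> \<le> real q * (3 * \<epsilon> * real N)" using that by (intro mult_left_mono) auto
          finally show ?thesis by (simp add: algebra_simps)
        qed
        have z1: "\<bar>real q1 * (\<Sum>A\<leftarrow>filter P1 xs. \<theta> * real N1 * of_int (c1 A f)) - a * ?I1\<bar> \<le> 3 * \<epsilon> * a"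
          unfolding a_def using e1(6) f by (intro scale) auto
        have z2: "\<bar>real q2 * (\<Sum>A\<leftarrow>filter P2 xs. \<theta> * real N2 * of_int (c2 A f)) - b * ?I2\<bar> \<le> 3 * \<epsilon> * b"
          unfolding b_def using e2(6) f by (intro scale) auto
        have d1: "\<bar>a * ?I1 - real n * t * ?I1\<bar> \<le> 2 * \<epsilon> * real n"
        proof -
          have "\<bar>a * ?I1 - real n * t * ?I1\<bar> = \<bar>a - real n * t\<bar> * \<bar>?I1\<bar>" by (simp only: abs_mult[symmetric] left_diff_distrib)
          also have "\<dots> \<le> \<bar>a - real n * t\<bar> * 1" using I1(1) by (intro mult_left_mono) auto
          also have "\<bar>a - real n * t\<bar> * 1 \<le> 2 * \<epsilon> * real n"
            using ab(2,3) eps(1) unfolding mult_1_right abs_le_iff by simp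
          finally show ?thesis .
        qed
        have d2: "\<bar>b * ?I2 - real n * (1 - t) * ?I2\<bar> \<le> 2 * \<epsilon> * real n"
        proof -
          have "\<bar>b * ?I2 - real n * (1 - t) * ?I2\<bar> = \<bar>b - real n * (1 - t)\<bar> * \<bar>?I2\<bar>" by (simp only: abs_mult[symmetric] left_diff_distrib)
          also have "\<dots> \<le> \<bar>b - real n * (1 - t)\<bar> * 1" using I1(2) by (intro mult_left_mono) auto
          also have "\<bar>b - real n * (1 - t)\<bar> * 1 \<le> 2 * \<epsilon> * real n"
            using ab(5,6) eps(1) unfolding mult_1_right abs_le_iff by simp
          finally show ?thesis .
        qed
        have eab: "\<epsilon> * (a + b) \<le> \<epsilon> * real n" using abn eps(1) by (intro mult_left_mono) auto
        have "\<bar>?S - ?Z\<bar> \<le> real n - (1 - \<epsilon>) * (a + b) + \<epsilon> * real n"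
          using w f S H by fastforce
        moreover have "real n - (a + b) \<le> 4 * \<epsilon> * real n" using ab(3,6) by (simp add: algebra_simps)
        moreover have "\<bar>?Z - (a * ?I1 + b * ?I2)\<bar> \<le> 3 * (\<epsilon> * (a + b))"
          using z1 z2 unfolding Z by (simp add: algebra_simps)
        moreover have "real n * (\<integral>x. f x \<partial>?\<mu>) = real n * t * ?I1 + real n * (1 - t) * ?I2"
          unfolding I by (simp add: algebra_simps)
        moreover have "(1 - \<epsilon>) * (a + b) = (a + b) - \<epsilon> * (a + b)" by (simp add: algebra_simps)
        \<comment> \<open>In units of \<open>\<epsilon> * n\<close>: time not filled by rounds 4,
          time outside blocks within rounds 1, cells 1, averages of the extracted blocks 3, and the
          rounding of \<open>a\<close> and \<open>b\<close> 2 each.\<close>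
        ultimately have "\<bar>?S - real n * (\<integral>x. f x \<partial>?\<mu>)\<bar> \<le> 13 * (\<epsilon> * real n)"
          using d1 d2 eab by linarith
        also have "\<dots> < \<delta> * real n" using eps elim(2) by (simp add: mult.assoc[symmetric])
        finally have "\<bar>?S - real n * (\<integral>x. f x \<partial>?\<mu>)\<bar> / real n < \<delta>"
          using elim(2) by (simp add: field_simps)
        also have "\<bar>?S - real n * (\<integral>x. f x \<partial>?\<mu>)\<bar> / real n = \<bar>?S / real n - (\<integral>x. f x \<partial>?\<mu>)\<bar>"
        proof -
          have "?S / real n - (\<integral>x. f x \<partial>?\<mu>) = (?S - real n * (\<integral>x. f x \<partial>?\<mu>)) / real n"
            using elim(2) by (simp add: diff_divide_distrib)
          then show ?thesis by (simp only: abs_divide abs_of_nat)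
        qed
        finally show "\<bar>(\<integral>x. f x \<partial>empirical X n \<omega>) - (\<integral>x. f x \<partial>?\<mu>)\<bar> < \<delta>"
          by (simp add: integral_empirical[OF elim(2) meas[OF f]])
      qed
      then show "\<omega> \<in> emp_event W n" using w by simp
    qed
    finally show ?case by (simp add: log_rate_ge_iff[OF elim(2)])
  qed
  then show "ereal (t * s1 + (1 - t) * s2) \<le> liminf (log_rate M X W)"
    by (rule Liminf_bounded)
qed

end

section \<open>Measures without common classes\<close>

lemma integral_small_off:
  fixes u :: "'a::topological_space \<Rightarrow> real"
  assumes "\<nu> \<in> prob_measures" "S \<in> sets borel" "1 - \<epsilon> < measure \<nu> S"
    and u: "u \<in> borel_measurable borel" "\<And>x. \<bar>u x\<bar> \<le> 1" "\<And>x. x \<in> S \<Longrightarrow> u x = 0"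
  shows "\<bar>\<integral>x. u x \<partial>\<nu>\<bar> \<le> \<epsilon>"
proof -
  interpret prob_space \<nu> using assms(1) by (rule prob_measuresD)
  note [measurable_cong] = prob_measuresD(2)[OF assms(1)]
  note [measurable] = assms(2) u(1)
  have S: "S \<in> events" using assms(2) by (simp add: prob_measuresD(2)[OF assms(1)])
  have i: "integrable \<nu> (indicator S :: 'a \<Rightarrow> real)"
    by (rule integrable_bounded_borel[OF assms(1), where B = 1]) (auto simp: indicator_def)
  have "\<bar>\<integral>x. u x \<partial>\<nu>\<bar> \<le> (\<integral>x. \<bar>u x\<bar> \<partial>\<nu>)" by (rule integral_abs_bound)
  also have "\<dots> \<le> (\<integral>x. 1 - indicator S x \<partial>\<nu>)"
  proof (rule integral_mono)
    show "integrable \<nu> (\<lambda>x. \<bar>u x\<bar>)" by (intro integrable_abs integrable_bounded_borel[OF assms(1) u(1,2)])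
    show "integrable \<nu> (\<lambda>x. 1 - indicator S x :: real)" using i by (intro Bochner_Integration.integrable_diff) auto
    show "\<bar>u x\<bar> \<le> 1 - indicator S x" for x using u(2)[of x] u(3)[of x] by (auto simp: indicator_def)
  qed
  also have "\<dots> = 1 - measure \<nu> S"
    using i S by (subst Bochner_Integration.integral_diff) (auto simp: prob_space)
  finally show ?thesis using assms(3) by linarith
qed

lemma sorted_wrt_either:
  assumes "sorted_wrt r xs" "x \<in> set xs" "y \<in> set xs" "x \<noteq> y"
  shows "r x y \<or> r y x"
  using assms by (induction xs) auto

lemma prod_list_filter_split:
  fixes \<phi> :: "'i \<Rightarrow> real"
  shows "(\<Prod>A\<leftarrow>xs. \<phi> A) = (\<Prod>A\<leftarrow>filter P xs. \<phi> A) * (\<Prod>A\<leftarrow>filter (\<lambda>A. \<not> P A) xs. \<phi> A)"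
  by (induction xs) auto

lemma sum_list_filter_if:
  fixes \<phi> :: "'i \<Rightarrow> real"
  shows "(\<Sum>A\<leftarrow>filter P xs. \<phi> A) = (\<Sum>A\<leftarrow>xs. if P A then \<phi> A else 0)"
  by (induction xs) auto

section \<open>Separation of the blocks of two measures\<close>

context density_chain
begin

text \<open>The blocks of a path in the classes selected by \<open>P\<close>, which is cut out by \<open>g\<close>, can be
  realized on their own in time about \<open>w N\<close>.\<close>

lemma partial_blocks:
  fixes V :: "'a set \<Rightarrow> 'a set" and g :: "'a \<Rightarrow> real"
  assumes fr: "frame \<mu> \<epsilon>' xs V L"
    and pos: "0 < \<epsilon>" "0 < \<theta>" "0 < N" "real (length xs) * \<theta> \<le> \<epsilon>"
    and Fs: "finite Fs" "\<And>f. f \<in> Fs \<Longrightarrow> f \<in> borel_measurable borel" "\<And>f x. f \<in> Fs \<Longrightarrow> \<bar>f x\<bar> \<le> (1::real)"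
    and nu: "\<nu> \<in> prob_measures"
    and tl: "sorted_wrt (\<lambda>A B. t A + l A < t B) xs" "\<forall>A\<in>set xs. t A + l A < N"
    and cell: "\<And>A. A \<in> set xs \<Longrightarrow> chain_path X (t A) (Suc (l A)) \<omega> \<in> cell_block Fs (\<theta> * real N) (V A) (l A) (c A)"
    and cover: "\<forall>A\<in>set xs. \<forall>k\<in>{1..N}. X k \<omega> \<in> V A \<longrightarrow> t A < k \<and> k \<le> Suc (t A + l A)"
    and few: "(1 - \<epsilon>) * real N \<le> real (card {k\<in>{1..N}. X k \<omega> \<in> (\<Union>A\<in>set xs. V A)})"
    and g: "\<And>x. 0 \<le> g x" "\<And>x. g x \<le> 1" "\<And>A x. A \<in> set xs \<Longrightarrow> x \<in> V A \<Longrightarrow> g x = (if P A then 1 else 0)"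
    and avg: "\<And>f. f \<in> insert (\<lambda>_. 1) Fs \<Longrightarrow> \<bar>(\<Sum>k=1..N. f (X k \<omega>) * g (X k \<omega>)) - real N * w * (\<integral>x. f x \<partial>\<nu>)\<bar> \<le> 2 * \<epsilon> * real N"
    and w: "0 \<le> w"
    and m: "m = nat \<lceil>(w + 4 * \<epsilon>) * real N\<rceil> + length xs * L"
  shows "(\<Prod>A\<leftarrow>filter P xs. mass (l A) (cell_block Fs (\<theta> * real N) (V A) (l A) (c A)) / (real L)\<^sup>2) \<le>
    prob {\<omega>\<in>space M. \<forall>f\<in>Fs. \<bar>(\<Sum>k=1..m. f (X k \<omega>)) - real m * (\<integral>x. f x \<partial>\<nu>)\<bar> \<le> 18 * \<epsilon> * real N + 2 * real (length xs * L) + 2}"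
proof -
  note xs = frameD[OF fr]
  interpret nu: prob_space \<nu> using nu by (rule prob_measuresD)
  note cov = block_cover[OF xs(2) tl]
  define U where "U = (\<Union>A\<in>set xs. V A)"
  define bs1 where "bs1 \<phi> A = block_sum \<phi> (t A, l A, ())" for \<phi> A
  have len: "(1 - \<epsilon>) * real N \<le> real (\<Sum>A\<leftarrow>xs. Suc (l A))"
    using few cov(1)[OF cover] by (meson of_nat_le_iff order_trans)
  have out: "(\<Sum>k=1..N. indicator (- U) (X k \<omega>)) \<le> \<epsilon> * real N"
  proof -
    have "(\<Sum>k=1..N. indicator (- U) (X k \<omega>)) = (\<Sum>k=1..N. 1 - indicator U (X k \<omega>) :: real)"
      by (intro sum.cong) (auto simp: indicator_def)
    also have "\<dots> = real N - (\<Sum>k=1..N. indicator U (X k \<omega>))" by (simp add: sum_subtractf)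
    also have "(\<Sum>k=1..N. indicator U (X k \<omega>)) = real (card {k\<in>{1..N}. X k \<omega> \<in> U})"
      by (simp add: indicator_def of_bool_def sum.If_cases Int_def conj_commute)
    finally show ?thesis using few by (simp add: U_def algebra_simps)
  qed
  \<comment> \<open>The averages contribute \<open>2 * \<epsilon> * N\<close>, the times outside the
    blocks \<open>\<epsilon> * N\<close>, and the times inside blocks but outside \<open>U\<close>,
    where \<open>g\<close> may take any value between 0 and 1, another
    \<open>\<epsilon> * N\<close>.\<close>
  have part: "\<bar>(\<Sum>A\<leftarrow>filter P xs. bs1 (\<lambda>k. f (X k \<omega>)) A) - real N * w * (\<integral>x. f x \<partial>\<nu>)\<bar> \<le> 4 * \<epsilon> * real N"
    if f: "f \<in> insert (\<lambda>_. 1) Fs" for f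
  proof -
    let ?\<phi> = "\<lambda>k. f (X k \<omega>) * g (X k \<omega>)"
    have f1: "\<bar>f x\<bar> \<le> 1" for x using f Fs(3) by auto
    have fg1: "\<bar>f x * g x\<bar> \<le> 1" for x
      using mult_mono[OF f1[of x] g(2)[of x]] g(1)[of x] by (simp add: abs_mult)
    have 1: "\<bar>(\<Sum>k=1..N. ?\<phi> k) - (\<Sum>A\<leftarrow>xs. bs1 ?\<phi> A)\<bar> \<le> real N - real (\<Sum>A\<leftarrow>xs. Suc (l A))"
      unfolding bs1_def by (rule cov(2)) (use fg1 in blast)
    have 2: "\<bar>(\<Sum>A\<leftarrow>xs. bs1 ?\<phi> A) - (\<Sum>A\<leftarrow>xs. if P A then bs1 (\<lambda>k. f (X k \<omega>)) A else 0)\<bar>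
        \<le> (\<Sum>A\<leftarrow>xs. bs1 (\<lambda>k. indicator (- U) (X k \<omega>)) A)"
    proof (rule sum_list_abs_diff_le)
      fix A assume A: "A \<in> set xs"
      let ?p = "if P A then 1 else 0 :: real"
      have "(if P A then bs1 (\<lambda>k. f (X k \<omega>)) A else 0) = (\<Sum>i\<le>l A. f (X (Suc (t A + i)) \<omega>) * ?p)"
        by (simp add: bs1_def block_sum_def)
      then have "\<bar>bs1 ?\<phi> A - (if P A then bs1 (\<lambda>k. f (X k \<omega>)) A else 0)\<bar> =
          \<bar>\<Sum>i\<le>l A. f (X (Suc (t A + i)) \<omega>) * g (X (Suc (t A + i)) \<omega>) - f (X (Suc (t A + i)) \<omega>) * ?p\<bar>"
        by (simp add: bs1_def block_sum_def sum_subtractf)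
      also have "\<dots> \<le> (\<Sum>i\<le>l A. \<bar>f (X (Suc (t A + i)) \<omega>) * g (X (Suc (t A + i)) \<omega>) - f (X (Suc (t A + i)) \<omega>) * ?p\<bar>)"
        by (rule sum_abs)
      also have "\<dots> \<le> (\<Sum>i\<le>l A. indicator (- U) (X (Suc (t A + i)) \<omega>))"
      proof (rule sum_mono)
        fix i assume i: "i \<in> {..l A}"
        let ?k = "Suc (t A + i)"
        show "\<bar>f (X ?k \<omega>) * g (X ?k \<omega>) - f (X ?k \<omega>) * ?p\<bar> \<le> indicator (- U) (X ?k \<omega>)"
        proof (cases "X ?k \<omega> \<in> U")
          case True
          then obtain B where B: "B \<in> set xs" "X ?k \<omega> \<in> V B" by (auto simp: U_def)
          have "?k \<in> {1..N}" using i tl(2) A by fastforce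
          then have "t B < ?k" "?k \<le> Suc (t B + l B)" using cover B by blast+
          \<comment> \<open>A visit to \<open>V B\<close> lies in the block of \<open>B\<close>, and
            different blocks are disjoint.\<close>
          then have "B = A" using sorted_wrt_either[OF tl(1) A B(1)] i by fastforce
          then have "g (X ?k \<omega>) = ?p" using g(3)[OF B] by simp
          then show ?thesis by (simp only: diff_self abs_zero indicator_pos_le)
        next
          case False
          have "\<bar>f (X ?k \<omega>) * (g (X ?k \<omega>) - ?p)\<bar> \<le> 1 * 1"
            unfolding abs_mult using f1 g(1,2)[of "X ?k \<omega>"] by (intro mult_mono) auto
          then show ?thesis using False by (simp only: right_diff_distrib) simp
        qed
      qed
      finally show "\<bar>bs1 ?\<phi> A - (if P A then bs1 (\<lambda>k. f (X k \<omega>)) A else 0)\<bar> \<le> bs1 (\<lambda>k. indicator (- U) (X k \<omega>)) A"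
        by (simp add: bs1_def block_sum_def)
    qed
    have 3: "(\<Sum>A\<leftarrow>xs. bs1 (\<lambda>k. indicator (- U) (X k \<omega>)) A) \<le> (\<Sum>k=1..N. indicator (- U) (X k \<omega>))"
      unfolding bs1_def by (rule cov(3)) simp
    have "real N - real (\<Sum>A\<leftarrow>xs. Suc (l A)) \<le> \<epsilon> * real N" using len by (simp add: algebra_simps)
    then show ?thesis
      using 1 2 3 out avg[OF f] unfolding sum_list_filter_if by linarith
  qed
  \<comment> \<open>The time taken by the selected blocks. It is estimated by \<open>part\<close>
    for the constant function 1, which is why the averages are assumed for that function
    too.\<close>
  define n1 where "n1 = (\<Sum>A\<leftarrow>filter P xs. Suc (l A))"
  have n1: "\<bar>real n1 - real N * w\<bar> \<le> 4 * \<epsilon> * real N"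
  proof -
    have "(\<Sum>A\<leftarrow>filter P xs. bs1 (\<lambda>k. 1) A) = real n1"
      unfolding n1_def bs1_def block_sum_def by (induction xs) auto
    then show ?thesis using part[of "\<lambda>_. 1"] by (simp add: nu.prob_space)
  qed
  define r where "r = length (filter P xs)"
  have r: "r \<le> length xs" "real r * \<theta> \<le> \<epsilon>"
  proof -
    show "r \<le> length xs" by (simp add: r_def)
    then have "real r * \<theta> \<le> real (length xs) * \<theta>" using pos(2) by (intro mult_right_mono) auto
    then show "real r * \<theta> \<le> \<epsilon>" using pos(4) by linarith
  qed
  have m1: "(w + 4 * \<epsilon>) * real N \<le> real m - real (length xs * L)" "real m - real (length xs * L) \<le> (w + 4 * \<epsilon>) * real N + 1"
  proof -
    have "0 \<le> (w + 4 * \<epsilon>) * real N" using w pos(1) by simp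
    then show "(w + 4 * \<epsilon>) * real N \<le> real m - real (length xs * L)" "real m - real (length xs * L) \<le> (w + 4 * \<epsilon>) * real N + 1"
      unfolding m by linarith+
  qed
  have rL: "real (r * L) \<le> real (length xs * L)" using r(1) by (simp add: mult_right_mono)
  define bs where "bs = map (\<lambda>A. (A, l A, \<theta> * real N, c A)) (filter P xs)"
  have sums: "(\<Sum>(A, l, h, c)\<leftarrow>bs. Suc l + L) = n1 + r * L" "(\<Sum>(A, l, h, c)\<leftarrow>bs. Suc l) = n1"
    "(\<Sum>(A, l, h, c)\<leftarrow>bs. h) = real r * \<theta> * real N"
    "(\<Sum>(A, l, h, c)\<leftarrow>bs. h * real_of_int (c f)) = (\<Sum>A\<leftarrow>filter P xs. \<theta> * real N * real_of_int (c A f))"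
    "(\<Prod>(A, l, h, c)\<leftarrow>bs. mass l (cell_block Fs h (V A) l c) / (real L)\<^sup>2) =
      (\<Prod>A\<leftarrow>filter P xs. mass (l A) (cell_block Fs (\<theta> * real N) (V A) (l A) (c A)) / (real L)\<^sup>2)" for f
  proof -
    have "(\<Sum>(A, l, h, c)\<leftarrow>bs. Suc l + L) = (\<Sum>A\<leftarrow>filter P xs. Suc (l A) + L)"
      by (simp add: bs_def o_def)
    also have "\<dots> = n1 + r * L" by (simp only: sum_list_addf sum_list_triv of_nat_id n1_def r_def)
    finally show "(\<Sum>(A, l, h, c)\<leftarrow>bs. Suc l + L) = n1 + r * L" .
    show "(\<Sum>(A, l, h, c)\<leftarrow>bs. Suc l) = n1" by (simp add: bs_def o_def n1_def)
    show "(\<Sum>(A, l, h, c)\<leftarrow>bs. h) = real r * \<theta> * real N" by (simp add: bs_def o_def sum_list_triv r_def)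
    show "(\<Sum>(A, l, h, c)\<leftarrow>bs. h * real_of_int (c f)) = (\<Sum>A\<leftarrow>filter P xs. \<theta> * real N * real_of_int (c A f))"
      by (simp add: bs_def o_def)
    show "(\<Prod>(A, l, h, c)\<leftarrow>bs. mass l (cell_block Fs h (V A) l c) / (real L)\<^sup>2) =
      (\<Prod>A\<leftarrow>filter P xs. mass (l A) (cell_block Fs (\<theta> * real N) (V A) (l A) (c A)) / (real L)\<^sup>2)"
      by (simp add: bs_def o_def)
  qed
  have NN: "real N * w = w * real N" by simp
  \<comment> \<open>The length of the selected blocks is known up to
    \<open>4 * \<epsilon> * N\<close>; \<open>m\<close> exceeds \<open>w * N\<close> by this amount
    and by room for all gaps.\<close>
  have nm: "n1 + r * L \<le> m"
  proof -
    have "real (n1 + r * L) \<le> real m"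
      using m1(1) n1 rL by (simp add: algebra_simps)
    then show ?thesis by (simp only: of_nat_le_iff)
  qed
  have hN: "0 < \<theta> * real N" using pos by simp
  have "(\<Prod>(A, l, h, c)\<leftarrow>bs. mass l (cell_block Fs h (V A) l c) / (real L)\<^sup>2) \<le>
    prob {\<omega> \<in> space M. \<forall>f\<in>Fs. \<bar>(\<Sum>k=1..m. f (X k \<omega>)) - (\<Sum>(A, l, h, c)\<leftarrow>bs. h * of_int (c f))\<bar> \<le>
      real m - real (\<Sum>(A, l, h, c)\<leftarrow>bs. Suc l) + (\<Sum>(A, l, h, c)\<leftarrow>bs. h)}"
  proof (rule realize[where F = "set xs"])
    show "f \<in> borel_measurable borel" if "f \<in> Fs" for f using that by (rule Fs(2))
    show "\<bar>f x\<bar> \<le> 1" if "f \<in> Fs" for f x using that by (rule Fs(3))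
    show "links L {None} (V A)" "emeasure lborel (V A) < \<infinity>" "V A \<in> sets borel" if "A \<in> set xs" for A
      using that xs(5,7,9) by auto
    show "links L (Some ` V A) (V B)" if "A \<in> set xs" "B \<in> set xs" "leads_to \<rho> A B" for A B
      using that by (rule xs(10))
    show "A \<in> set xs \<and> 0 < h" if "(A, l, h, c) \<in> set bs" for A l h c using that hN by (auto simp: bs_def)
    show "sorted_wrt (\<lambda>b b'. leads_to \<rho> (fst b) (fst b')) bs"
      unfolding bs_def sorted_wrt_map using sorted_wrt_filter[OF xs(3)] by simp
    show "(\<Sum>(A, l, h, c)\<leftarrow>bs. Suc l + L) \<le> m" unfolding sums by (rule nm)
  qed (fact Fs(1) xs(4))+
  also have "\<dots> \<le> prob {\<omega>\<in>space M. \<forall>f\<in>Fs. \<bar>(\<Sum>k=1..m. f (X k \<omega>)) - real m * (\<integral>x. f x \<partial>\<nu>)\<bar> \<le> 18 * \<epsilon> * real N + 2 * real (length xs * L) + 2}"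
  proof (rule finite_measure_mono)
    show "{\<omega> \<in> space M. \<forall>f\<in>Fs. \<bar>(\<Sum>k=1..m. f (X k \<omega>)) - (\<Sum>(A, l, h, c)\<leftarrow>bs. h * of_int (c f))\<bar> \<le>
      real m - real (\<Sum>(A, l, h, c)\<leftarrow>bs. Suc l) + (\<Sum>(A, l, h, c)\<leftarrow>bs. h)}
      \<subseteq> {\<omega>\<in>space M. \<forall>f\<in>Fs. \<bar>(\<Sum>k=1..m. f (X k \<omega>)) - real m * (\<integral>x. f x \<partial>\<nu>)\<bar> \<le> 18 * \<epsilon> * real N + 2 * real (length xs * L) + 2}"
    proof (intro subsetI CollectI conjI ballI)
      fix \<omega>' f
      assume w': "\<omega>' \<in> {\<omega> \<in> space M. \<forall>f\<in>Fs. \<bar>(\<Sum>k=1..m. f (X k \<omega>)) - (\<Sum>(A, l, h, c)\<leftarrow>bs. h * of_int (c f))\<bar> \<le>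
        real m - real (\<Sum>(A, l, h, c)\<leftarrow>bs. Suc l) + (\<Sum>(A, l, h, c)\<leftarrow>bs. h)}" and f: "f \<in> Fs"
      let ?S = "\<Sum>k=1..m. f (X k \<omega>')" and ?I = "\<integral>x. f x \<partial>\<nu>"
      let ?Z = "\<Sum>A\<leftarrow>filter P xs. \<theta> * real N * real_of_int (c A f)"
      have rN: "real r * \<theta> * real N \<le> \<epsilon> * real N" using r(2) by (intro mult_right_mono) auto
      have 1: "\<bar>?S - ?Z\<bar> \<le> real m - real n1 + real r * \<theta> * real N"
        using w' f unfolding sums by blast
      have "\<bar>(\<Sum>A\<leftarrow>filter P xs. bs1 (\<lambda>k. f (X k \<omega>)) A) - ?Z\<bar> \<le> (\<Sum>A\<leftarrow>filter P xs. \<theta> * real N)"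
        unfolding bs1_def using f hN by (intro sum_list_abs_diff_le cell_sum[OF cell]) auto
      then have 2: "\<bar>(\<Sum>A\<leftarrow>filter P xs. bs1 (\<lambda>k. f (X k \<omega>)) A) - ?Z\<bar> \<le> real r * \<theta> * real N"
        by (simp add: sum_list_triv r_def)
      have 3: "\<bar>(\<Sum>A\<leftarrow>filter P xs. bs1 (\<lambda>k. f (X k \<omega>)) A) - real N * w * ?I\<bar> \<le> 4 * \<epsilon> * real N"
        using f by (intro part) simp
      have I1: "\<bar>?I\<bar> \<le> 1" using f by (intro abs_integral_le_1 nu Fs(2,3))
      have exp: "(w + 4 * \<epsilon>) * real N = real N * w + 4 * \<epsilon> * real N" by (simp add: algebra_simps)
      have 4: "\<bar>real N * w * ?I - real m * ?I\<bar> \<le> 4 * \<epsilon> * real N + 1 + real (length xs * L)"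
      proof -
        have "\<bar>real N * w * ?I - real m * ?I\<bar> = \<bar>real N * w - real m\<bar> * \<bar>?I\<bar>"
          by (simp only: abs_mult[symmetric] left_diff_distrib)
        also have "\<dots> \<le> \<bar>real N * w - real m\<bar> * 1" using I1 by (intro mult_left_mono) auto
        also have "\<bar>real N * w - real m\<bar> * 1 \<le> 4 * \<epsilon> * real N + 1 + real (length xs * L)"
        proof -
          have "0 \<le> 4 * \<epsilon> * real N" "0 \<le> real (length xs * L)" using pos(1) by simp_all
          then show ?thesis using m1 unfolding exp mult_1_right abs_le_iff by linarith
        qed
        finally show ?thesis .
      qed
      have e0: "0 \<le> \<epsilon> * real N" using pos(1) by simp
      \<comment> \<open>In units of \<open>\<epsilon> * N\<close>: time not covered by blocks 8,
        cells 1 twice, \<open>part\<close> 4, and the replacement of \<open>N * w\<close> by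
        \<open>m\<close> another 4. This gives 18.\<close>
      have "\<bar>?S - real m * ?I\<bar> \<le> (real m - real n1 + real r * \<theta> * real N) + real r * \<theta> * real N + 4 * \<epsilon> * real N
          + (4 * \<epsilon> * real N + 1 + real (length xs * L))"
        using 1 2 3 4 by linarith
      also have "\<dots> \<le> 18 * \<epsilon> * real N + 2 * real (length xs * L) + 2"
        using m1(2) n1 rN unfolding exp abs_le_iff by linarith
      finally show "\<bar>?S - real m * ?I\<bar> \<le> 18 * \<epsilon> * real N + 2 * real (length xs * L) + 2" .
    qed auto
    show "{\<omega>\<in>space M. \<forall>f\<in>Fs. \<bar>(\<Sum>k=1..m. f (X k \<omega>)) - real m * (\<integral>x. f x \<partial>\<nu>)\<bar> \<le> 18 * \<epsilon> * real N + 2 * real (length xs * L) + 2} \<in> events"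
    proof (rule sets.sets_Collect_finite_All[OF _ Fs(1)])
      fix f assume "f \<in> Fs"
      then have [measurable]: "f \<in> borel_measurable borel" by (rule Fs(2))
      have [measurable]: "(\<lambda>\<omega>. \<Sum>k=1..m. f (X k \<omega>)) \<in> borel_measurable M"
        by (intro borel_measurable_sum measurable_compose[OF X_measurable]) auto
      show "{\<omega>\<in>space M. \<bar>(\<Sum>k=1..m. f (X k \<omega>)) - real m * (\<integral>x. f x \<partial>\<nu>)\<bar> \<le> 18 * \<epsilon> * real N + 2 * real (length xs * L) + 2} \<in> events"
        by measurable
    qed
  qed
  finally show ?thesis unfolding sums .
qed

text \<open>The weak topology sees only averages over the whole path, whereas the argument needs
  averages over the blocks of one component. A continuous cutoff \<open>g\<close> separating the two
  families of parts makes them accessible; then the product of masses splits and each factor is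
  bounded by the rate of one component at its own time \<open>m\<close>.\<close>

lemma upper_rate_mixture:
  assumes mu: "\<mu>1 \<in> prob_measures" "\<mu>2 \<in> prob_measures" and t: "0 < t" "t < 1"
    and ord: "orderly (mixture t \<mu>1 \<mu>2)"
    and disj: "\<not> (\<exists>A\<in>comm_classes \<rho>. measure \<mu>1 A * measure \<mu>2 A > 0)"
    and r: "upper_rate \<mu>1 < ereal r1" "upper_rate \<mu>2 < ereal r2" and \<gamma>: "0 < \<gamma>"
  shows "upper_rate (mixture t \<mu>1 \<mu>2) \<le> ereal (t * r1 + (1 - t) * r2 + \<gamma>)"
proof -
  let ?\<mu> = "mixture t \<mu>1 \<mu>2"
  have mix: "?\<mu> \<in> prob_measures" using mu t by (intro mixture_prob) auto
  interpret mu1: prob_space \<mu>1 using mu(1) by (rule prob_measuresD)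
  interpret mu2: prob_space \<mu>2 using mu(2) by (rule prob_measuresD)
  obtain V1 where V1: "openin weak_topology V1" "\<mu>1 \<in> V1" "\<forall>\<^sub>F n in sequentially. prob (emp_event V1 n) \<le> exp (real n * r1)"
    by (rule upper_rate_lessD[OF r(1)])
  obtain V2 where V2: "openin weak_topology V2" "\<mu>2 \<in> V2" "\<forall>\<^sub>F n in sequentially. prob (emp_event V2 n) \<le> exp (real n * r2)"
    by (rule upper_rate_lessD[OF r(2)])
  obtain M1 where M1: "\<And>n. n \<ge> M1 \<Longrightarrow> prob (emp_event V1 n) \<le> exp (real n * r1)"
    using V1(3) by (auto simp: eventually_sequentially)
  obtain M2 where M2: "\<And>n. n \<ge> M2 \<Longrightarrow> prob (emp_event V2 n) \<le> exp (real n * r2)"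
    using V2(3) by (auto simp: eventually_sequentially)
  obtain F1 \<delta>1 where F1: "finite F1" "0 < \<delta>1" "\<And>f. f \<in> F1 \<Longrightarrow> continuous_on UNIV f" "\<And>f x. f \<in> F1 \<Longrightarrow> \<bar>f x\<bar> \<le> (1::real)"
    "\<And>\<nu>. \<nu> \<in> prob_measures \<Longrightarrow> (\<And>f. f \<in> F1 \<Longrightarrow> \<bar>(\<integral>x. f x \<partial>\<nu>) - (\<integral>x. f x \<partial>\<mu>1)\<bar> < \<delta>1) \<Longrightarrow> \<nu> \<in> V1"
    using weak_topology_nbhd[OF V1(1,2)] by metis
  obtain F2 \<delta>2 where F2: "finite F2" "0 < \<delta>2" "\<And>f. f \<in> F2 \<Longrightarrow> continuous_on UNIV f" "\<And>f x. f \<in> F2 \<Longrightarrow> \<bar>f x\<bar> \<le> (1::real)"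
    "\<And>\<nu>. \<nu> \<in> prob_measures \<Longrightarrow> (\<And>f. f \<in> F2 \<Longrightarrow> \<bar>(\<integral>x. f x \<partial>\<nu>) - (\<integral>x. f x \<partial>\<mu>2)\<bar> < \<delta>2) \<Longrightarrow> \<nu> \<in> V2"
    using weak_topology_nbhd[OF V2(1,2)] by metis
  define Fs where "Fs = F1 \<union> F2"
  define \<delta> where "\<delta> = min \<delta>1 \<delta>2"
  have Fs: "finite Fs" "\<And>f. f \<in> Fs \<Longrightarrow> continuous_on UNIV f" "\<And>f x. f \<in> Fs \<Longrightarrow> \<bar>f x\<bar> \<le> (1::real)"
    using F1 F2 by (auto simp: Fs_def)
  have \<delta>: "0 < \<delta>" using F1(2) F2(2) by (simp add: \<delta>_def)
  have meas: "f \<in> borel_measurable borel" if "f \<in> Fs" for f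
    using Fs(2)[OF that] by (rule borel_measurable_continuous_onI)
  define m0 where "m0 = min t (1 - t)"
  have m0: "0 < m0" "m0 \<le> t" "m0 \<le> 1 - t" using t by (auto simp: m0_def)
  define q where "q = \<bar>r1\<bar> + \<bar>r2\<bar> + 1"
  have q: "0 < q" "\<bar>r1\<bar> + \<bar>r2\<bar> \<le> q" by (auto simp: q_def)
  \<comment> \<open>The averages of the realized blocks deviate by at most
    \<open>19 * \<epsilon> * N\<close>, which must stay below \<open>\<delta> * m\<close>, where
    \<open>m\<close> is at least \<open>m0 * N\<close>. The second bound keeps the change of rate
    below \<open>\<gamma> / 2\<close>.\<close>
  define \<epsilon> where "\<epsilon> = min (\<delta> * m0 / 20) (\<gamma> / (10 * q))"
  have eps: "0 < \<epsilon>" "20 * \<epsilon> \<le> \<delta> * m0" "\<epsilon> * (\<bar>r1\<bar> + \<bar>r2\<bar>) \<le> \<gamma> / 10"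
  proof -
    show "0 < \<epsilon>" using \<delta> m0(1) \<gamma> q(1) by (simp add: \<epsilon>_def)
    have "\<epsilon> \<le> \<delta> * m0 / 20" unfolding \<epsilon>_def by (rule min.cobounded1)
    then show "20 * \<epsilon> \<le> \<delta> * m0" by simp
    have "\<epsilon> * (\<bar>r1\<bar> + \<bar>r2\<bar>) \<le> \<epsilon> * q"
      using \<open>0 < \<epsilon>\<close> q(2) by (intro mult_left_mono) auto
    also have "\<dots> \<le> \<gamma> / (10 * q) * q"
      unfolding \<epsilon>_def using q(1) by (intro mult_right_mono min.cobounded2) simp
    also have "\<dots> = \<gamma> / 10" using q(1) by simp
    finally show "\<epsilon> * (\<bar>r1\<bar> + \<bar>r2\<bar>) \<le> \<gamma> / 10" .
  qed
  have "0 < \<epsilon> * m0" using eps(1) m0(1) by simp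
  with ord obtain xs V L where fr: "frame ?\<mu> (\<epsilon> * m0) xs V L" by (rule frame_exists)
  note xs = frameD[OF fr]
  define U where "U = (\<Union>A\<in>set xs. V A)"
  have oU: "open U" using xs(5) by (auto simp: U_def)
  note big = mixture_big[OF mu t borel_open[OF oU] xs(11)[folded U_def, unfolded m0_def] eps(1)]
  have le1: "\<epsilon> * m0 \<le> \<epsilon>" using eps(1) m0 t by (simp add: mult_left_le)
  \<comment> \<open>A part is assigned to the first component when that component charges it. By
    disjointness of the charged classes the second component then gives it no mass.\<close>
  define P where "P A \<longleftrightarrow> 0 < measure \<mu>1 (V A)" for A
  have null2: "measure \<mu>2 (V A) = 0" if A: "A \<in> set xs" "P A" for A
  proof -
    have Ab: "A \<in> sets borel" "V A \<in> sets borel" using class_open xs(1,5) A by auto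
    have "measure \<mu>1 (V A) \<le> measure \<mu>1 A" "measure \<mu>2 (V A) \<le> measure \<mu>2 A"
      using Ab xs(6)[OF A(1)] prob_measuresD(2)[OF mu(1)] prob_measuresD(2)[OF mu(2)]
      by (auto intro!: mu1.finite_measure_mono mu2.finite_measure_mono)
    moreover have "\<not> 0 < measure \<mu>1 A * measure \<mu>2 A" using disj A(1) xs(1) by auto
    moreover have "0 < measure \<mu>1 (V A)" using A(2) by (simp add: P_def)
    ultimately show ?thesis
      using measure_nonneg[of \<mu>2 "V A"] by (smt (verit) mult_pos_pos)
  qed
  define U1 where "U1 = (\<Union>A\<in>{A\<in>set xs. P A}. V A)"
  define U2 where "U2 = (\<Union>A\<in>{A\<in>set xs. \<not> P A}. V A)"
  have oU12: "open U1" "open U2" using xs(5) by (auto simp: U1_def U2_def)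
  have parts: "measure \<nu> U \<le> measure \<nu> (\<Union>A\<in>{A\<in>set xs. 0 < measure \<nu> (V A)}. V A)" if "\<nu> \<in> prob_measures" for \<nu>
    unfolding U_def using xs(5) by (intro charged_parts[OF that]) auto
  have big1: "1 - \<epsilon> < measure \<mu>1 U1"
    using parts[OF mu(1)] big(1) by (simp add: U1_def P_def)
  have big2: "1 - \<epsilon> < measure \<mu>2 U2"
  proof -
    have "measure \<mu>2 U \<le> measure \<mu>2 (\<Union>A\<in>{A\<in>set xs. 0 < measure \<mu>2 (V A)}. V A)"
      by (rule parts[OF mu(2)])
    also have "\<dots> \<le> measure \<mu>2 U2"
      using oU12 null2 prob_measuresD(2)[OF mu(2)] by (intro mu2.finite_measure_mono) (auto simp: U2_def)
    finally show ?thesis using big(2) by linarith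
  qed
  \<comment> \<open>The closures remain inside distinct, hence disjoint, classes; so these finite
    unions are disjoint closed sets and Urysohn's lemma applies.\<close>
  define S1 where "S1 = (\<Union>A\<in>{A\<in>set xs. P A}. closure (V A))"
  define S2 where "S2 = (\<Union>A\<in>{A\<in>set xs. \<not> P A}. closure (V A))"
  have cl: "closed S1" "closed S2" by (auto simp: S1_def S2_def)
  have "S1 \<inter> S2 = {}"
  proof (rule ccontr)
    assume "S1 \<inter> S2 \<noteq> {}"
    then obtain x A B where "A \<in> set xs" "B \<in> set xs" "P A" "\<not> P B" "x \<in> closure (V A)" "x \<in> closure (V B)"
      by (auto simp: S1_def S2_def)
    then show False using class_disjoint[of A B x] xs(1,13) by blast
  qed
  from Urysohn[OF cl this, of "1::real" 0] obtain g :: "'a \<Rightarrow> real" where g: "continuous_on UNIV g" "\<And>x. g x \<in> closed_segment 1 0"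
    "\<And>x. x \<in> S1 \<Longrightarrow> g x = 1" "\<And>x. x \<in> S2 \<Longrightarrow> g x = 0" by metis
  have g01: "0 \<le> g x" "g x \<le> 1" for x
    using g(2)[of x] by (auto simp: closed_segment_eq_real_ivl)
  have gV: "g x = (if P A then 1 else 0)" if "A \<in> set xs" "x \<in> V A" for A x
    using that g(3,4)[of x] closure_subset[of "V A"] by (auto simp: S1_def S2_def)
  have gm[measurable]: "g \<in> borel_measurable borel" using g(1) by (rule borel_measurable_continuous_onI)
  let ?F = "insert (\<lambda>_. 1) Fs"
  have F: "finite ?F" "\<And>f. f \<in> ?F \<Longrightarrow> continuous_on UNIV f" "\<And>f x. f \<in> ?F \<Longrightarrow> \<bar>f x\<bar> \<le> (1::real)"
    "\<And>f. f \<in> ?F \<Longrightarrow> f \<in> borel_measurable borel"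
    using Fs meas by auto
  have prod1: "\<bar>f x * g x\<bar> \<le> 1" "\<bar>f x * (1 - g x)\<bar> \<le> 1" if "f \<in> ?F" for f x
    using mult_mono[OF F(3)[OF that, of x] g01(2)[of x]] mult_mono[OF F(3)[OF that, of x], of "1 - g x" 1] g01[of x]
    by (auto simp: abs_mult)
  have I: "\<bar>(\<integral>x. f x * g x \<partial>?\<mu>) - t * (\<integral>x. f x \<partial>\<mu>1)\<bar> \<le> \<epsilon>"
    "\<bar>(\<integral>x. f x * (1 - g x) \<partial>?\<mu>) - (1 - t) * (\<integral>x. f x \<partial>\<mu>2)\<bar> \<le> \<epsilon>" if f: "f \<in> ?F" for f
  proof -
    note [measurable] = F(4)[OF f]
    have int: "integrable \<nu> (\<lambda>x. f x * g x)" "integrable \<nu> (\<lambda>x. f x * (1 - g x))" "integrable \<nu> f" if "\<nu> \<in> prob_measures" for \<nu>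
      using prod1[OF f] F(3)[OF f] by (intro integrable_bounded_borel[OF that, where B = 1]; measurable)+
    have split: "(\<integral>x. f x \<partial>\<nu>) = (\<integral>x. f x * g x \<partial>\<nu>) + (\<integral>x. f x * (1 - g x) \<partial>\<nu>)" if "\<nu> \<in> prob_measures" for \<nu>
      using int[OF that] by (subst Bochner_Integration.integral_add[symmetric]) (auto simp: algebra_simps)
    have m: "(\<integral>x. f x * g x \<partial>?\<mu>) = t * (\<integral>x. f x * g x \<partial>\<mu>1) + (1 - t) * (\<integral>x. f x * g x \<partial>\<mu>2)"
      "(\<integral>x. f x * (1 - g x) \<partial>?\<mu>) = t * (\<integral>x. f x * (1 - g x) \<partial>\<mu>1) + (1 - t) * (\<integral>x. f x * (1 - g x) \<partial>\<mu>2)"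
      using t prod1[OF f] by (intro integral_mixture[OF mu, where B = 1]; simp)+
    have s1: "\<bar>\<integral>x. f x * (1 - g x) \<partial>\<mu>1\<bar> \<le> \<epsilon>"
      by (rule integral_small_off[OF mu(1) borel_open[OF oU12(1)] big1]) (use prod1[OF f] gV in \<open>auto simp: U1_def\<close>)
    have s2: "\<bar>\<integral>x. f x * g x \<partial>\<mu>2\<bar> \<le> \<epsilon>"
      by (rule integral_small_off[OF mu(2) borel_open[OF oU12(2)] big2]) (use prod1[OF f] gV in \<open>auto simp: U2_def\<close>)
    have comb: "\<bar>(1 - t) * a - t * b\<bar> \<le> \<epsilon>" if "\<bar>a\<bar> \<le> \<epsilon>" "\<bar>b\<bar> \<le> \<epsilon>" for a b
    proof -
      have "\<bar>(1 - t) * a - t * b\<bar> \<le> \<bar>(1 - t) * a\<bar> + \<bar>t * b\<bar>" by (rule abs_triangle_ineq4)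
      also have "\<dots> = (1 - t) * \<bar>a\<bar> + t * \<bar>b\<bar>" using t by (simp add: abs_mult)
      also have "\<dots> \<le> (1 - t) * \<epsilon> + t * \<epsilon>" using t that by (intro add_mono mult_left_mono) auto
      also have "\<dots> = \<epsilon>" by (simp add: algebra_simps)
      finally show ?thesis .
    qed
    have e1: "(\<integral>x. f x * g x \<partial>?\<mu>) - t * (\<integral>x. f x \<partial>\<mu>1) = (1 - t) * (\<integral>x. f x * g x \<partial>\<mu>2) - t * (\<integral>x. f x * (1 - g x) \<partial>\<mu>1)"
      unfolding m split[OF mu(1)] by (simp add: distrib_left)
    have e2: "(\<integral>x. f x * (1 - g x) \<partial>?\<mu>) - (1 - t) * (\<integral>x. f x \<partial>\<mu>2) = - ((1 - t) * (\<integral>x. f x * g x \<partial>\<mu>2) - t * (\<integral>x. f x * (1 - g x) \<partial>\<mu>1))"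
      unfolding m split[OF mu(2)] by (simp add: distrib_left)
    show "\<bar>(\<integral>x. f x * g x \<partial>?\<mu>) - t * (\<integral>x. f x \<partial>\<mu>1)\<bar> \<le> \<epsilon>" unfolding e1 by (rule comb[OF s2 s1])
    show "\<bar>(\<integral>x. f x * (1 - g x) \<partial>?\<mu>) - (1 - t) * (\<integral>x. f x \<partial>\<mu>2)\<bar> \<le> \<epsilon>" unfolding e2 abs_minus by (rule comb[OF s2 s1])
  qed
  \<comment> \<open>Closeness is imposed on the products with \<open>g\<close> and
    \<open>1 - g\<close>, including those with the constant 1, which measure the share of time of
    each group.\<close>
  define Gs where "Gs = (\<lambda>f x. f x * g x) ` ?F \<union> (\<lambda>f x. f x * (1 - g x)) ` ?F"
  have Gs: "finite Gs" "\<And>f. f \<in> Gs \<Longrightarrow> continuous_on UNIV f" "\<And>f x. f \<in> Gs \<Longrightarrow> \<bar>f x\<bar> \<le> (1::real)"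
  proof -
    have "\<bar>g x\<bar> \<le> 1" "\<bar>1 - g x\<bar> \<le> 1" for x using g01[of x] by auto
    then show "finite Gs" "\<And>f. f \<in> Gs \<Longrightarrow> continuous_on UNIV f" "\<And>f x. f \<in> Gs \<Longrightarrow> \<bar>f x\<bar> \<le> 1"
      unfolding Gs_def using F(1,2) g(1) prod1 by (auto intro!: continuous_intros)
  qed
  define V0 where "V0 = {\<nu> \<in> prob_measures. 1 - \<epsilon> < measure \<nu> U} \<inter> {\<nu> \<in> prob_measures. \<forall>A\<in>set xs. 0 < measure \<nu> (V A)} \<inter>
    {\<nu> \<in> prob_measures. \<forall>f\<in>Gs. \<bar>(\<integral>x. f x \<partial>\<nu>) - (\<integral>x. f x \<partial>?\<mu>)\<bar> < \<epsilon>}"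
  have V0: "openin weak_topology V0"
    unfolding V0_def using oU xs(5) Gs
    by (intro openin_Int openin_weak_open_set openin_weak_positive openin_weak_ball) auto
  have "1 - \<epsilon> < measure ?\<mu> U" using xs(11) le1 unfolding U_def by linarith
  then have muV0: "?\<mu> \<in> V0" using mix xs(8) eps(1) by (auto simp: V0_def)
  define rr where "rr = length xs"
  define \<theta> where "\<theta> = \<epsilon> / (real rr + 1)"
  have th: "0 < \<theta>" "real rr * \<theta> \<le> \<epsilon>"
  proof -
    show "0 < \<theta>" using eps(1) by (simp add: \<theta>_def)
    then have "real rr * \<theta> \<le> (real rr + 1) * \<theta>" by (intro mult_right_mono) auto
    then show "real rr * \<theta> \<le> \<epsilon>" by (simp add: \<theta>_def)
  qed
  let ?B = "(2 * nat \<lceil>1 / \<theta>\<rceil> + 1) ^ card Fs"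
  let ?K = "\<lambda>n. (real ((n + 1)\<^sup>2 * ?B)) ^ length xs"
  let ?C = "(R * (real L)\<^sup>2) ^ length xs"
  let ?s = "t * r1 + (1 - t) * r2"
  define c0 where "c0 = 2 * real (rr * L) + 2"
  show ?thesis
  proof (rule upper_rate_leI[OF V0 muV0])
    \<comment> \<open>Half of \<gamma> absorbs the subexponential factor, the other half the error
      \<open>5 * (\<epsilon> * (\<bar>r1\<bar> + \<bar>r2\<bar>))\<close>.\<close>
    have "?s + \<gamma> / 2 < ?s + \<gamma>" using \<gamma> by simp
    then have "\<forall>\<^sub>F n in sequentially. ?K n * ?C * exp (real n * (?s + \<gamma> / 2)) \<le> exp (real n * (?s + \<gamma>))"
      by (rule subexponential)
    \<comment> \<open>Large enough for \<open>c0\<close> to be at most \<open>\<epsilon> * N\<close>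
      and for the time of either group to exceed \<open>M1\<close> and \<open>M2\<close>.\<close>
    moreover have "\<forall>\<^sub>F n in sequentially. nat \<lceil>(real M1 + real M2 + 1) / m0\<rceil> + nat \<lceil>c0 / \<epsilon>\<rceil> + 1 \<le> n"
      by (rule eventually_ge_at_top)
    ultimately show "\<forall>\<^sub>F n in sequentially. prob (emp_event V0 n) \<le> exp (real n * (?s + \<gamma>))"
    proof eventually_elim
      case (elim N)
      have N1: "1 \<le> N" "0 < N" using elim(2) by auto
      have "c0 / \<epsilon> \<le> real N" using elim(2) by linarith
      then have c0: "c0 \<le> \<epsilon> * real N" using eps(1) by (simp add: field_simps)
      have "(real M1 + real M2 + 1) / m0 \<le> real N" using elim(2) by linarith
      then have NM: "real M1 + real M2 + 1 \<le> m0 * real N" using m0(1) by (simp add: field_simps)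
      show ?case
      proof (cases "0 < prob (emp_event V0 N)")
        case False
        then show ?thesis by (meson exp_ge_zero linorder_not_le order_trans)
      next
        case True
        have W: "emp_event V0 N \<in> events" by (rule emp_event_measurable[OF N1(1) V0])
        have emp: "(1 - \<epsilon>) * real N \<le> real (card {i\<in>{1..N}. X i \<omega> \<in> (\<Union>A\<in>set xs. V A)})"
          "\<And>A. A \<in> set xs \<Longrightarrow> \<exists>k\<in>{1..N}. X k \<omega> \<in> V A"
          "\<And>f. f \<in> Gs \<Longrightarrow> \<bar>(\<Sum>i=1..N. f (X i \<omega>)) - real N * (\<integral>x. f x \<partial>?\<mu>)\<bar> \<le> \<epsilon> * real N"
          if w: "\<omega> \<in> emp_event V0 N" for \<omega>
        proof -
          have "1 - \<epsilon> < real (card {i\<in>{1..N}. X i \<omega> \<in> U}) / real N"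
            using w oU by (auto simp: V0_def measure_empirical[OF N1(1)])
          then show "(1 - \<epsilon>) * real N \<le> real (card {i\<in>{1..N}. X i \<omega> \<in> (\<Union>A\<in>set xs. V A)})"
            using N1(2) by (simp add: field_simps U_def)
          show "\<exists>k\<in>{1..N}. X k \<omega> \<in> V A" if A: "A \<in> set xs" for A
          proof -
            have "0 < measure (empirical X N \<omega>) (V A)" using w A by (auto simp: V0_def)
            then have "{i\<in>{1..N}. X i \<omega> \<in> V A} \<noteq> {}"
              using xs(5)[OF A] by (simp add: measure_empirical[OF N1(1)] zero_less_divide_iff card_gt_0_iff)
            then show ?thesis by auto
          qed
          fix f assume f: "f \<in> Gs"
          then have [measurable]: "f \<in> borel_measurable borel" using Gs(2) by (simp add: borel_measurable_continuous_onI)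
          have "\<bar>(\<Sum>i=1..N. f (X i \<omega>)) / real N - (\<integral>x. f x \<partial>?\<mu>)\<bar> < \<epsilon>"
            using w f by (auto simp: V0_def integral_empirical[OF N1(1)])
          also have "(\<Sum>i=1..N. f (X i \<omega>)) / real N - (\<integral>x. f x \<partial>?\<mu>) = ((\<Sum>i=1..N. f (X i \<omega>)) - real N * (\<integral>x. f x \<partial>?\<mu>)) / real N"
            using N1(2) by (simp add: diff_divide_distrib)
          finally show "\<bar>(\<Sum>i=1..N. f (X i \<omega>)) - real N * (\<integral>x. f x \<partial>?\<mu>)\<bar> \<le> \<epsilon> * real N"
            using N1(2) by (simp add: field_simps)
        qed
        obtain \<omega> \<tau> l c where dec: "\<omega> \<in> emp_event V0 N"
          "sorted_wrt (\<lambda>A B. \<tau> A + l A < \<tau> B) xs"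
          "\<And>A. A \<in> set xs \<Longrightarrow> \<tau> A + l A < N"
          "\<And>A. A \<in> set xs \<Longrightarrow> chain_path X (\<tau> A) (Suc (l A)) \<omega> \<in> cell_block Fs (\<theta> * real N) (V A) (l A) (c A)"
          "\<And>A k. A \<in> set xs \<Longrightarrow> k \<in> {1..N} \<Longrightarrow> X k \<omega> \<in> V A \<Longrightarrow> \<tau> A < k \<and> k \<le> Suc (\<tau> A + l A)"
          "prob (emp_event V0 N) \<le> ?K N * (\<Prod>A\<leftarrow>xs. R * mass (l A) (cell_block Fs (\<theta> * real N) (V A) (l A) (c A)))"
        proof -
          note obt = that
          show thesis
          proof (rule path_decomposition[where ys = xs and V = V and Fs = Fs and \<theta> = \<theta> and n = N
                and h = "\<theta> * real N" and W = "emp_event V0 N"])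
            show "V A \<subseteq> A" "V A \<in> sets borel" "emeasure lborel (V A) < \<infinity>" if "A \<in> set xs" for A
              using xs(5-7)[OF that] by auto
            show "f \<in> borel_measurable borel" if "f \<in> Fs" for f using that by (rule meas)
            show "\<bar>f x\<bar> \<le> 1" if "f \<in> Fs" for f x using that by (rule Fs(3))
            show "\<exists>k\<in>{1..N}. X k \<omega> \<in> V A" if "\<omega> \<in> emp_event V0 N" "A \<in> set xs" for \<omega> A using that by (rule emp(2))
          qed (fact xs(1-3) Fs(1) th N1(2) W True refl obt)+
        qed
        let ?m = "\<lambda>A. mass (l A) (cell_block Fs (\<theta> * real N) (V A) (l A) (c A)) / (real L)\<^sup>2"
        have dec3: "\<forall>A\<in>set xs. \<tau> A + l A < N" using dec(3) by blast
        have dec5: "\<forall>A\<in>set xs. \<forall>k\<in>{1..N}. X k \<omega> \<in> V A \<longrightarrow> \<tau> A < k \<and> k \<le> Suc (\<tau> A + l A)" using dec(5) by blast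
        \<comment> \<open>One estimate for both components: \<open>Q\<close> selects the group of
          blocks, \<open>w\<close> is its share of time and \<open>G\<close> its cutoff.\<close>
        have half: "(\<Prod>A\<leftarrow>filter Q xs. ?m A) \<le> exp (real N * (w * r + 5 * \<epsilon> * \<bar>r\<bar>))"
          if w: "m0 \<le> w" and nu: "\<nu> \<in> prob_measures"
            and G: "\<And>x. 0 \<le> G x" "\<And>x. G x \<le> 1" "\<And>A x. A \<in> set xs \<Longrightarrow> x \<in> V A \<Longrightarrow> G x = (if Q A then 1 else 0)"
            and GG: "\<And>f. f \<in> ?F \<Longrightarrow> (\<lambda>x. f x * G x) \<in> Gs \<and> \<bar>(\<integral>x. f x * G x \<partial>?\<mu>) - w * (\<integral>x. f x \<partial>\<nu>)\<bar> \<le> \<epsilon>"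
            and VV: "openin weak_topology VV" "\<And>n. n \<ge> M' \<Longrightarrow> prob (emp_event VV n) \<le> exp (real n * r)"
            and MM: "M' \<le> M1 + M2"
            and test: "\<And>\<eta>. \<eta> \<in> prob_measures \<Longrightarrow> (\<And>f. f \<in> Fs \<Longrightarrow> \<bar>(\<integral>x. f x \<partial>\<eta>) - (\<integral>x. f x \<partial>\<nu>)\<bar> < \<delta>) \<Longrightarrow> \<eta> \<in> VV"
          for Q w \<nu> G VV M' r
        proof -
          define m where "m = nat \<lceil>(w + 4 * \<epsilon>) * real N\<rceil> + length xs * L"
          have w0: "0 \<le> w" using w m0(1) by linarith
          have avg: "\<bar>(\<Sum>k=1..N. f (X k \<omega>) * G (X k \<omega>)) - real N * w * (\<integral>x. f x \<partial>\<nu>)\<bar> \<le> 2 * \<epsilon> * real N"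
            if f: "f \<in> ?F" for f
          proof -
            have 1: "\<bar>(\<Sum>k=1..N. f (X k \<omega>) * G (X k \<omega>)) - real N * (\<integral>x. f x * G x \<partial>?\<mu>)\<bar> \<le> \<epsilon> * real N"
              using emp(3)[OF dec(1), of "\<lambda>x. f x * G x"] GG[OF f] by blast
            have "\<bar>real N * (\<integral>x. f x * G x \<partial>?\<mu>) - real N * (w * (\<integral>x. f x \<partial>\<nu>))\<bar> =
                real N * \<bar>(\<integral>x. f x * G x \<partial>?\<mu>) - w * (\<integral>x. f x \<partial>\<nu>)\<bar>"
              by (simp only: right_diff_distrib[symmetric] abs_mult abs_of_nat)
            also have "\<dots> \<le> real N * \<epsilon>" using GG[OF f] by (intro mult_left_mono) auto
            finally show ?thesis using 1 by (simp add: mult.assoc mult.commute[of \<epsilon>])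
          qed
          have "(\<Prod>A\<leftarrow>filter Q xs. ?m A) \<le> prob {\<omega>\<in>space M. \<forall>f\<in>Fs. \<bar>(\<Sum>k=1..m. f (X k \<omega>)) - real m * (\<integral>x. f x \<partial>\<nu>)\<bar> \<le> 18 * \<epsilon> * real N + 2 * real (length xs * L) + 2}"
          proof (rule partial_blocks[where \<omega> = \<omega> and t = \<tau> and g = G and w = w])
            show "f \<in> borel_measurable borel" if "f \<in> Fs" for f using that by (rule meas)
            show "\<bar>f x\<bar> \<le> 1" if "f \<in> Fs" for f x using that by (rule Fs(3))
            show "real (length xs) * \<theta> \<le> \<epsilon>" using th(2) by (simp only: rr_def)
            show "chain_path X (\<tau> A) (Suc (l A)) \<omega> \<in> cell_block Fs (\<theta> * real N) (V A) (l A) (c A)" if "A \<in> set xs" for A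
              using that by (rule dec(4))
            show "(1 - \<epsilon>) * real N \<le> real (card {k\<in>{1..N}. X k \<omega> \<in> (\<Union>A\<in>set xs. V A)})"
              by (rule emp(1)[OF dec(1)])
            show "0 \<le> G x" "G x \<le> 1" for x by (rule G)+
            show "G x = (if Q A then 1 else 0)" if "A \<in> set xs" "x \<in> V A" for A x using that by (rule G(3))
            show "\<bar>(\<Sum>k=1..N. f (X k \<omega>) * G (X k \<omega>)) - real N * w * (\<integral>x. f x \<partial>\<nu>)\<bar> \<le> 2 * \<epsilon> * real N"
              if "f \<in> ?F" for f using that by (rule avg)
          qed (fact fr eps(1) th(1) N1(2) Fs(1) nu dec(2) dec3 dec5 w0 m_def)+
          also have "\<dots> \<le> prob (emp_event VV m)"
          proof (rule finite_measure_mono)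
            have e0: "0 \<le> 4 * \<epsilon> * real N" using eps(1) by simp
            have "(w + 4 * \<epsilon>) * real N \<le> real m" unfolding m_def by linarith
            then have mw: "w * real N \<le> real m" using e0 by (simp add: distrib_right)
            have "m0 * real N \<le> w * real N" using w by (intro mult_right_mono) auto
            then have mN: "m0 * real N \<le> real m" using mw by linarith
            then have m1: "1 \<le> m" using NM by linarith
            show "emp_event VV m \<in> events" by (rule emp_event_measurable[OF m1 VV(1)])
            show "{\<omega>\<in>space M. \<forall>f\<in>Fs. \<bar>(\<Sum>k=1..m. f (X k \<omega>)) - real m * (\<integral>x. f x \<partial>\<nu>)\<bar> \<le> 18 * \<epsilon> * real N + 2 * real (length xs * L) + 2} \<subseteq> emp_event VV m"
            proof (intro subsetI)
              fix \<omega>' assume w': "\<omega>' \<in> {\<omega>\<in>space M. \<forall>f\<in>Fs. \<bar>(\<Sum>k=1..m. f (X k \<omega>)) - real m * (\<integral>x. f x \<partial>\<nu>)\<bar> \<le> 18 * \<epsilon> * real N + 2 * real (length xs * L) + 2}"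
              have "empirical X m \<omega>' \<in> VV"
              proof (rule test[OF empirical_prob[OF m1]])
                fix f assume f: "f \<in> Fs"
                let ?S = "\<Sum>k=1..m. f (X k \<omega>')"
                have "\<bar>?S - real m * (\<integral>x. f x \<partial>\<nu>)\<bar> \<le> 18 * \<epsilon> * real N + c0"
                  using w' f by (auto simp: c0_def rr_def)
                also have "\<dots> < 20 * \<epsilon> * real N"
                  using c0 mult_pos_pos[OF eps(1), of "real N"] N1(2) by simp
                also have "\<dots> \<le> \<delta> * m0 * real N" using eps(2) by (intro mult_right_mono) auto
                also have "\<dots> \<le> \<delta> * real m" using mN \<delta> by (simp add: mult.assoc)
                finally have "\<bar>?S - real m * (\<integral>x. f x \<partial>\<nu>)\<bar> / real m < \<delta>"
                  using m1 by (simp add: field_simps)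
                moreover have "?S / real m - (\<integral>x. f x \<partial>\<nu>) = (?S - real m * (\<integral>x. f x \<partial>\<nu>)) / real m"
                  using m1 by (simp add: diff_divide_distrib)
                ultimately have "\<bar>?S / real m - (\<integral>x. f x \<partial>\<nu>)\<bar> < \<delta>"
                  by (simp only: abs_divide abs_of_nat)
                then show "\<bar>(\<integral>x. f x \<partial>empirical X m \<omega>') - (\<integral>x. f x \<partial>\<nu>)\<bar> < \<delta>"
                  by (simp add: integral_empirical[OF m1 meas[OF f]])
              qed
              then show "\<omega>' \<in> emp_event VV m" using w' by simp
            qed
          qed
          also have "\<dots> \<le> exp (real m * r)"
          proof (rule VV(2))
            have "(w + 4 * \<epsilon>) * real N \<le> real m" unfolding m_def by linarith
            moreover have "m0 * real N \<le> (w + 4 * \<epsilon>) * real N" using w eps(1) by (intro mult_right_mono) auto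
            ultimately show "M' \<le> m" using NM MM by linarith
          qed
          \<comment> \<open>\<open>m\<close> exceeds \<open>w * N\<close> by at most
            \<open>5 * \<epsilon> * N\<close>. The sign of \<open>r\<close> is open, so the excess
            is charged with its absolute value.\<close>
          also have "\<dots> \<le> exp (real N * (w * r + 5 * \<epsilon> * \<bar>r\<bar>))"
          proof -
            have up: "real m \<le> (w + 4 * \<epsilon>) * real N + 1 + real (length xs * L)"
            proof -
              have "0 \<le> (w + 4 * \<epsilon>) * real N" using w0 eps(1) by simp
              then show ?thesis unfolding m_def by linarith
            qed
            have lo: "(w + 4 * \<epsilon>) * real N \<le> real m" unfolding m_def by linarith
            have e0: "0 \<le> \<epsilon> * real N" using eps(1) by simp
            have ex: "(w + 4 * \<epsilon>) * real N = w * real N + 4 * (\<epsilon> * real N)" by (simp add: algebra_simps)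
            have "0 \<le> real (length xs * L)" by simp
            then have "1 + real (length xs * L) \<le> \<epsilon> * real N" using c0 unfolding c0_def rr_def by linarith
            then have d: "0 \<le> real m - w * real N" "real m - w * real N \<le> 5 * (\<epsilon> * real N)"
              using up lo e0 unfolding ex by linarith+
            have "(real m - w * real N) * r \<le> (real m - w * real N) * \<bar>r\<bar>" using d(1) by (intro mult_left_mono) auto
            also have "\<dots> \<le> 5 * (\<epsilon> * real N) * \<bar>r\<bar>" using d(2) by (intro mult_right_mono) auto
            finally show ?thesis by (simp add: algebra_simps)
          qed
          finally show ?thesis .
        qed
        have h1: "(\<Prod>A\<leftarrow>filter P xs. ?m A) \<le> exp (real N * (t * r1 + 5 * \<epsilon> * \<bar>r1\<bar>))"
        proof (rule half[of t \<mu>1 g P V1 M1 r1])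
          show "(\<lambda>x. f x * g x) \<in> Gs \<and> \<bar>(\<integral>x. f x * g x \<partial>?\<mu>) - t * (\<integral>x. f x \<partial>\<mu>1)\<bar> \<le> \<epsilon>" if "f \<in> ?F" for f
            using I(1)[OF that] that by (auto simp: Gs_def)
          show "\<eta> \<in> V1" if "\<eta> \<in> prob_measures" "\<And>f. f \<in> Fs \<Longrightarrow> \<bar>(\<integral>x. f x \<partial>\<eta>) - (\<integral>x. f x \<partial>\<mu>1)\<bar> < \<delta>" for \<eta>
            using that by (intro F1(5)) (fastforce simp: Fs_def \<delta>_def)+
          show "prob (emp_event V1 n) \<le> exp (real n * r1)" if "M1 \<le> n" for n using that by (rule M1)
          show "g x = (if P A then 1 else 0)" if "A \<in> set xs" "x \<in> V A" for A x using that by (rule gV)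
          show "M1 \<le> M1 + M2" by simp
        qed (fact m0(2) mu(1) g01 V1(1))+
        have h2: "(\<Prod>A\<leftarrow>filter (\<lambda>A. \<not> P A) xs. ?m A) \<le> exp (real N * ((1 - t) * r2 + 5 * \<epsilon> * \<bar>r2\<bar>))"
        proof (rule half[of "1 - t" \<mu>2 "\<lambda>x. 1 - g x" "\<lambda>A. \<not> P A" V2 M2 r2])
          show "(\<lambda>x. f x * (1 - g x)) \<in> Gs \<and> \<bar>(\<integral>x. f x * (1 - g x) \<partial>?\<mu>) - (1 - t) * (\<integral>x. f x \<partial>\<mu>2)\<bar> \<le> \<epsilon>" if "f \<in> ?F" for f
            using I(2)[OF that] that by (auto simp: Gs_def)
          show "\<eta> \<in> V2" if "\<eta> \<in> prob_measures" "\<And>f. f \<in> Fs \<Longrightarrow> \<bar>(\<integral>x. f x \<partial>\<eta>) - (\<integral>x. f x \<partial>\<mu>2)\<bar> < \<delta>" for \<eta>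
            using that by (intro F2(5)) (fastforce simp: Fs_def \<delta>_def)+
          show "prob (emp_event V2 n) \<le> exp (real n * r2)" if "M2 \<le> n" for n using that by (rule M2)
          show "1 - g x = (if \<not> P A then 1 else 0)" if "A \<in> set xs" "x \<in> V A" for A x using gV[OF that] by simp
          show "0 \<le> 1 - g x" "1 - g x \<le> 1" for x using g01[of x] by simp_all
          show "M2 \<le> M1 + M2" by simp
        qed (fact m0(3) mu(2) V2(1))+
        have "(\<Prod>A\<leftarrow>xs. R * mass (l A) (cell_block Fs (\<theta> * real N) (V A) (l A) (c A))) = ?C * (\<Prod>A\<leftarrow>xs. ?m A)"
          using xs(4) by (induction xs) (simp_all add: field_simps)
        also have "(\<Prod>A\<leftarrow>xs. ?m A) = (\<Prod>A\<leftarrow>filter P xs. ?m A) * (\<Prod>A\<leftarrow>filter (\<lambda>A. \<not> P A) xs. ?m A)"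
          by (rule prod_list_filter_split)
        finally have pr: "prob (emp_event V0 N) \<le> ?K N * (?C * ((\<Prod>A\<leftarrow>filter P xs. ?m A) * (\<Prod>A\<leftarrow>filter (\<lambda>A. \<not> P A) xs. ?m A)))"
          using dec(6) by simp
        have pos: "0 \<le> (\<Prod>A\<leftarrow>ys. ?m A)" for ys
          by (induction ys) (auto intro!: mult_nonneg_nonneg divide_nonneg_nonneg mass_nonneg)
        have C0: "0 \<le> ?C" using R_pos by simp
        note pr
        also have "?K N * (?C * ((\<Prod>A\<leftarrow>filter P xs. ?m A) * (\<Prod>A\<leftarrow>filter (\<lambda>A. \<not> P A) xs. ?m A))) \<le>
            ?K N * (?C * (exp (real N * (t * r1 + 5 * \<epsilon> * \<bar>r1\<bar>)) * exp (real N * ((1 - t) * r2 + 5 * \<epsilon> * \<bar>r2\<bar>))))"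
          using h1 h2 C0 pos by (intro mult_left_mono mult_mono) auto
        also have "\<dots> = ?K N * ?C * exp (real N * (?s + 5 * (\<epsilon> * (\<bar>r1\<bar> + \<bar>r2\<bar>))))"
          by (simp add: exp_add[symmetric] algebra_simps)
        also have "\<dots> \<le> ?K N * ?C * exp (real N * (?s + \<gamma> / 2))"
        proof (intro mult_left_mono mult_nonneg_nonneg C0)
          have "real N * (?s + 5 * (\<epsilon> * (\<bar>r1\<bar> + \<bar>r2\<bar>))) \<le> real N * (?s + \<gamma> / 2)"
            using eps(3) by (intro mult_left_mono) auto
          then show "exp (real N * (?s + 5 * (\<epsilon> * (\<bar>r1\<bar> + \<bar>r2\<bar>)))) \<le> exp (real N * (?s + \<gamma> / 2))"
            by (simp only: exp_le_cancel_iff)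
        qed simp
        also have "\<dots> \<le> exp (real N * (?s + \<gamma>))" by (rule elim(1))
        finally show ?thesis .
      qed
    qed
  qed
qed

end

section \<open>Measures of infinite rate\<close>

context density_chain
begin

text \<open>Whatever the past, the next point falls into \<open>S\<close> with probability at most
  \<open>R\<close> times its Lebesgue measure; conditioning successively gives one factor per
  step.\<close>

lemma count_moment:
  assumes S[measurable]: "S \<in> sets borel" and l: "0 \<le> lam"
  shows "(\<integral>\<^sup>+\<omega>. (\<Prod>k=1..n. 1 + ennreal lam * indicator S (X k \<omega>)) \<partial>M) \<le> (1 + ennreal lam * (ennreal R * emeasure lborel S)) ^ n"
proof (induction n)
  case 0
  then show ?case by (simp add: emeasure_space_1)
next
  case (Suc n)
  let ?h = "\<lambda>y. 1 + ennreal lam * indicator S y :: ennreal" and ?c = "1 + ennreal lam * (ennreal R * emeasure lborel S)"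
  have [measurable]: "X k \<in> past M X n \<rightarrow>\<^sub>M borel" if "k \<in> {1..n}" for k
    using that by (intro measurable_X_past) auto
  have P[measurable]: "(\<lambda>\<omega>. \<Prod>k=1..n. ?h (X k \<omega>)) \<in> borel_measurable (past M X n)"
    by (intro borel_measurable_prod_ennreal) measurable
  have PM: "(\<lambda>\<omega>. \<Prod>k=1..n. ?h (X k \<omega>)) \<in> borel_measurable M"
    by (rule measurable_from_subalg[OF subalgebra_past P])
  have one: "(\<integral>\<^sup>+y. ennreal (\<rho> x y) * ?h y \<partial>lborel) \<le> ?c" for x
  proof -
    have "(\<integral>\<^sup>+y. ennreal (\<rho> x y) * ?h y \<partial>lborel) = (\<integral>\<^sup>+y. ennreal (\<rho> x y) + ennreal lam * (ennreal (\<rho> x y) * indicator S y) \<partial>lborel)"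
      by (intro nn_integral_cong) (simp add: distrib_left mult_ac)
    also have "\<dots> = 1 + ennreal lam * (\<integral>\<^sup>+y. ennreal (\<rho> x y) * indicator S y \<partial>lborel)"
      by (simp add: nn_integral_add nn_integral_cmult rho_prob)
    also have "(\<integral>\<^sup>+y. ennreal (\<rho> x y) * indicator S y \<partial>lborel) \<le> (\<integral>\<^sup>+y. ennreal R * indicator S y \<partial>lborel)"
      by (intro nn_integral_mono mult_right_mono ennreal_leI rho_le) simp
    also have "\<dots> = ennreal R * emeasure lborel S" by (simp add: nn_integral_cmult)
    finally show ?thesis by (simp add: mult_left_mono)
  qed
  have "(\<integral>\<^sup>+\<omega>. (\<Prod>k=1..Suc n. ?h (X k \<omega>)) \<partial>M) = (\<integral>\<^sup>+\<omega>. (\<lambda>\<omega> y. (\<Prod>k=1..n. ?h (X k \<omega>)) * ?h y) \<omega> (X (Suc n) \<omega>) \<partial>M)"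
    by simp
  also have "\<dots> = (\<integral>\<^sup>+\<omega>. \<integral>\<^sup>+y. ennreal (\<rho> (Y n \<omega>) y) * ((\<Prod>k=1..n. ?h (X k \<omega>)) * ?h y) \<partial>lborel \<partial>M)"
    by (rule nn_integral_one_step) measurable
  also have "\<dots> = (\<integral>\<^sup>+\<omega>. (\<Prod>k=1..n. ?h (X k \<omega>)) * (\<integral>\<^sup>+y. ennreal (\<rho> (Y n \<omega>) y) * ?h y \<partial>lborel) \<partial>M)"
    by (rule nn_integral_cong, subst nn_integral_cmult[symmetric]) (measurable, simp add: mult_ac)
  also have "\<dots> \<le> (\<integral>\<^sup>+\<omega>. (\<Prod>k=1..n. ?h (X k \<omega>)) * ?c \<partial>M)"
    by (intro nn_integral_mono mult_left_mono one) simp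
  also have "\<dots> = (\<integral>\<^sup>+\<omega>. (\<Prod>k=1..n. ?h (X k \<omega>)) \<partial>M) * ?c"
    by (rule nn_integral_multc[OF PM])
  also have "\<dots> \<le> ?c ^ n * ?c" using Suc by (rule mult_right_mono) simp
  finally show ?case by (simp add: mult.commute)
qed

text \<open>Chernoff's bound: the product equals \<open>1 + lam\<close> to the number of visits, and
  the smallness assumption bounds its expectation by \<open>2 ^ n\<close>.\<close>

lemma prob_many_visits:
  assumes S[measurable]: "S \<in> sets borel" and l: "0 < lam" and small: "ennreal lam * (ennreal R * emeasure lborel S) \<le> 1"
    and n: "0 < n"
  shows "prob {\<omega> \<in> space M. d < real (card {i\<in>{1..n}. X i \<omega> \<in> S}) / real n} \<le> exp (real n * (ln 2 - d * ln (1 + lam)))"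
proof -
  let ?E = "{\<omega> \<in> space M. d < real (card {i\<in>{1..n}. X i \<omega> \<in> S}) / real n}"
  let ?a = "exp (real n * (d * ln (1 + lam)))"
  have [measurable]: "X k \<in> M \<rightarrow>\<^sub>M borel" if "k \<in> {1..n}" for k using that by (intro X_measurable) auto
  have card_eq: "real (card {i\<in>{1..n}. X i \<omega> \<in> S}) = (\<Sum>i=1..n. indicator S (X i \<omega>))" for \<omega>
    by (simp add: indicator_def of_bool_def sum.If_cases Int_def conj_commute)
  have [measurable]: "(\<lambda>\<omega>. \<Sum>i=1..n. indicator S (X i \<omega>) :: real) \<in> borel_measurable M"
    by (intro borel_measurable_sum) measurable
  have E: "?E \<in> events" unfolding card_eq by measurable
  have pointwise: "ennreal ?a * indicator ?E \<omega> \<le> (\<Prod>k=1..n. 1 + ennreal lam * indicator S (X k \<omega>))" for \<omega>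
  proof (cases "\<omega> \<in> ?E")
    case True
    let ?c = "card {i\<in>{1..n}. X i \<omega> \<in> S}"
    have "real n * d \<le> real ?c" using True n by (simp add: field_simps)
    then have "real n * (d * ln (1 + lam)) \<le> real ?c * ln (1 + lam)"
      using l by (simp add: mult.assoc[symmetric])
    then have "?a \<le> exp (real ?c * ln (1 + lam))" by simp
    also have "\<dots> = (1 + lam) ^ ?c" using l by (simp add: exp_of_nat_mult)
    also have "\<dots> = (\<Prod>k=1..n. if X k \<omega> \<in> S then 1 + lam else 1)"
      by (simp add: prod.If_cases Int_def conj_commute)
    finally have "ennreal ?a \<le> ennreal (\<Prod>k=1..n. if X k \<omega> \<in> S then 1 + lam else 1)" by (rule ennreal_leI)
    also have "\<dots> = (\<Prod>k=1..n. ennreal (if X k \<omega> \<in> S then 1 + lam else 1))"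
      using l by (intro prod_ennreal[symmetric]) auto
    also have "\<dots> = (\<Prod>k=1..n. 1 + ennreal lam * indicator S (X k \<omega>))"
      using l by (intro prod.cong) (auto simp: ennreal_plus)
    finally show ?thesis using True by simp
  qed simp
  have "ennreal ?a * emeasure M ?E = (\<integral>\<^sup>+\<omega>. ennreal ?a * indicator ?E \<omega> \<partial>M)"
    using E by (simp add: nn_integral_cmult_indicator)
  also have "\<dots> \<le> (\<integral>\<^sup>+\<omega>. (\<Prod>k=1..n. 1 + ennreal lam * indicator S (X k \<omega>)) \<partial>M)"
    by (intro nn_integral_mono pointwise)
  also have "\<dots> \<le> (1 + ennreal lam * (ennreal R * emeasure lborel S)) ^ n"
    using l by (intro count_moment) auto
  also have "\<dots> \<le> (1 + 1) ^ n" using small by (intro power_mono add_left_mono) auto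
  also have "\<dots> = ennreal (2 ^ n)" by (simp add: ennreal_power[symmetric])
  finally have "ennreal (?a * prob ?E) \<le> ennreal (2 ^ n)"
    by (simp add: emeasure_eq_measure ennreal_mult)
  then have "?a * prob ?E \<le> 2 ^ n" by (subst (asm) ennreal_le_iff) auto
  also have "2 ^ n = exp (real n * ln 2)" by (simp add: exp_of_nat_mult)
  finally have "prob ?E \<le> exp (real n * ln 2) / ?a" by (simp add: pos_le_divide_eq mult.commute)
  also have "\<dots> = exp (real n * (ln 2 - d * ln (1 + lam)))"
    by (simp add: exp_diff[symmetric] right_diff_distrib)
  finally show ?thesis .
qed

lemma upper_rate_minus_inftyI:
  assumes "\<And>r. upper_rate \<mu> \<le> ereal r"
  shows "upper_rate \<mu> = -\<infinity>"
  using assms by (metis ereal_bot)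

text \<open>A null set charged by \<mu> lies in an open set of arbitrarily small Lebesgue measure.
  Empirical measures near \<mu> visit it in a fixed fraction of the time, which is
  superexponentially unlikely as its measure shrinks.\<close>

lemma upper_rate_not_ac:
  assumes mu: "\<mu> \<in> prob_measures" and nac: "\<not> absolutely_continuous lborel \<mu>"
  shows "upper_rate \<mu> = -\<infinity>"
proof (rule upper_rate_minus_inftyI)
  fix r
  interpret mu: prob_space \<mu> using mu by (rule prob_measuresD)
  note smu = prob_measuresD(2)[OF mu]
  obtain A where A: "A \<in> null_sets lborel" "A \<notin> null_sets \<mu>"
    using nac by (auto simp: absolutely_continuous_def)
  have Ab: "A \<in> sets borel" using A(1) by auto
  have pos: "0 < measure \<mu> A"
    using A(2) Ab by (auto simp: null_sets_def smu mu.emeasure_eq_measure zero_less_measure_iff)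
  define d where "d = measure \<mu> A / 2"
  have d: "0 < d" "d < measure \<mu> A" using pos by (auto simp: d_def)
  \<comment> \<open>Chosen so that \<open>d * ln (1 + lam)\<close> is at least
    \<open>ln 2 + \<bar>r\<bar>\<close>; the Chernoff exponent is then at most
    \<open>- \<bar>r\<bar>\<close>.\<close>
  define lam where "lam = exp ((ln 2 + \<bar>r\<bar>) / d)"
  have lam: "0 < lam" by (simp add: lam_def)
  have "(ln 2 + \<bar>r\<bar>) / d \<le> ln (1 + lam)"
  proof -
    have "(ln 2 + \<bar>r\<bar>) / d = ln lam" by (simp add: lam_def)
    also have "\<dots> \<le> ln (1 + lam)" using lam by (subst ln_le_cancel_iff) auto
    finally show ?thesis .
  qed
  then have rate: "ln 2 - d * ln (1 + lam) \<le> r"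
    using d(1) by (simp add: pos_divide_le_eq mult.commute)
  \<comment> \<open>This bound on the Lebesgue measure makes \<open>lam * R * Leb(S)\<close> at most
    1.\<close>
  have e: "0 < 1 / (lam * R)" using lam R_pos by simp
  obtain S where S: "open S" "A \<subseteq> S" "emeasure lborel (S - A) < ennreal (1 / (lam * R))"
    by (rule outer_regular_lborel[OF Ab e])
  have "emeasure lborel S \<le> emeasure lborel ((S - A) \<union> A)" using S(1) Ab by (intro emeasure_mono) auto
  also have "\<dots> \<le> emeasure lborel (S - A) + emeasure lborel A" using S(1) Ab by (intro emeasure_subadditive) auto
  also have "\<dots> \<le> ennreal (1 / (lam * R))" using S(3) A(1) by (simp add: null_sets_def)
  finally have "ennreal lam * (ennreal R * emeasure lborel S) \<le> ennreal lam * (ennreal R * ennreal (1 / (lam * R)))"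
    by (intro mult_left_mono) auto
  also have "\<dots> = 1" using lam R_pos by (simp add: ennreal_mult[symmetric])
  finally have small: "ennreal lam * (ennreal R * emeasure lborel S) \<le> 1" .
  let ?V = "{\<nu> \<in> prob_measures. d < measure \<nu> S}"
  show "upper_rate \<mu> \<le> ereal r"
  proof (rule upper_rate_leI)
    show "openin weak_topology ?V" using S(1) by (rule openin_weak_open_set)
    have "measure \<mu> A \<le> measure \<mu> S" using S(1,2) by (intro mu.finite_measure_mono) (auto simp: smu)
    then show "\<mu> \<in> ?V" using mu d by simp
    show "\<forall>\<^sub>F n in sequentially. prob (emp_event ?V n) \<le> exp (real n * r)"
      using eventually_ge_at_top[of 1]
    proof eventually_elim
      case (elim n)
      have "emp_event ?V n = {\<omega> \<in> space M. d < real (card {i\<in>{1..n}. X i \<omega> \<in> S}) / real n}"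
        using elim S(1) by (auto simp: measure_empirical empirical_prob)
      then have "prob (emp_event ?V n) \<le> exp (real n * (ln 2 - d * ln (1 + lam)))"
        using prob_many_visits[OF _ lam small, of n d] S(1) elim by simp
      also have "\<dots> \<le> exp (real n * r)" using rate by (simp add: mult_left_mono)
      finally show ?case .
    qed
  qed
qed

section \<open>Exclusion by the almost sure order of visits\<close>

lemma upper_rate_null:
  assumes "openin weak_topology W" "\<mu> \<in> W"
    and "\<And>n. n \<ge> 1 \<Longrightarrow> AE \<omega> in M. empirical X n \<omega> \<notin> W"
  shows "upper_rate \<mu> = -\<infinity>"
proof (rule upper_rate_minus_inftyI)
  fix r
  show "upper_rate \<mu> \<le> ereal r"
  proof (rule upper_rate_leI[OF assms(1,2)])
    show "\<forall>\<^sub>F n in sequentially. prob (emp_event W n) \<le> exp (real n * r)"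
      using eventually_ge_at_top[of 1]
    proof eventually_elim
      case (elim n)
      have "prob (emp_event W n) = 0"
        using assms(3)[OF elim] by (intro measure_eq_0_null_sets) (auto simp: AE_iff_null_sets emp_event_measurable[OF elim assms(1)] elim: AE_mp)
      then show ?case by simp
    qed
  qed
qed

lemma visits_class:
  assumes "open A" "0 < measure (empirical X n \<omega>) A" "n \<ge> 1"
  obtains k where "1 \<le> k" "X k \<omega> \<in> A"
proof -
  have "{i\<in>{1..n}. X i \<omega> \<in> A} \<noteq> {}"
    using assms by (simp add: measure_empirical zero_less_divide_iff card_gt_0_iff)
  then show thesis using that by auto
qed

text \<open>Charging an open class is a weakly open condition, and the chain almost surely never
  visits a class that is unreachable from the initial point.\<close>

lemma upper_rate_not_init:
  assumes mu: "\<mu> \<in> prob_measures" and A: "A \<in> charged_classes \<rho> \<mu>" "\<not> init_leads_to \<rho> A"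
  shows "upper_rate \<mu> = -\<infinity>"
proof (rule upper_rate_null)
  have A': "A \<in> comm_classes \<rho>" "0 < measure \<mu> A" using A by (auto simp: charged_classes_def)
  let ?W = "{\<nu> \<in> prob_measures. 0 < measure \<nu> A}"
  show "openin weak_topology ?W" using class_open[OF A'(1)] by (rule openin_weak_open_set)
  show "\<mu> \<in> ?W" using mu A' by simp
  fix n :: nat assume n: "n \<ge> 1"
  show "AE \<omega> in M. empirical X n \<omega> \<notin> ?W"
    using AE_arrow
  proof eventually_elim
    case (elim \<omega>)
    show ?case
    proof
      assume "empirical X n \<omega> \<in> ?W"
      then obtain k where k: "1 \<le> k" "X k \<omega> \<in> A" using visits_class[OF class_open[OF A'(1)] _ n, of \<omega>] by auto
      have "arrow None (X k \<omega>)" using elim[rule_format, of 0 "k - 1"] k(1) by (simp add: Y_eq)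
      then show False using init_leads_toI[OF A'(1) k(2)] A(2) by simp
    qed
  qed
qed

text \<open>A path visiting both classes does so at different times, and the earlier visit would
  have an arrow to the later one.\<close>

lemma upper_rate_incomparable:
  assumes mu: "\<mu> \<in> prob_measures" and AB: "A \<in> charged_classes \<rho> \<mu>" "B \<in> charged_classes \<rho> \<mu>"
    and inc: "\<not> leads_to \<rho> A B" "\<not> leads_to \<rho> B A"
  shows "upper_rate \<mu> = -\<infinity>"
proof (rule upper_rate_null)
  have A: "A \<in> comm_classes \<rho>" "0 < measure \<mu> A" and B: "B \<in> comm_classes \<rho>" "0 < measure \<mu> B"
    using AB by (auto simp: charged_classes_def)
  have ne: "A \<noteq> B" using inc leads_to_refl[OF A(1)] by auto
  let ?W = "{\<nu> \<in> prob_measures. 0 < measure \<nu> A} \<inter> {\<nu> \<in> prob_measures. 0 < measure \<nu> B}"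
  show "openin weak_topology ?W"
    using class_open[OF A(1)] class_open[OF B(1)] by (intro openin_Int openin_weak_open_set)
  show "\<mu> \<in> ?W" using mu A B by simp
  fix n :: nat assume n: "n \<ge> 1"
  show "AE \<omega> in M. empirical X n \<omega> \<notin> ?W"
    using AE_arrow
  proof eventually_elim
    case (elim \<omega>)
    have arr: "arrow (Some (X s \<omega>)) (X k \<omega>)" if "1 \<le> s" "s < k" for s k
      using elim[rule_format, of s "k - s - 1"] that by (simp add: Y_eq)
    show ?case
    proof
      assume W: "empirical X n \<omega> \<in> ?W"
      obtain a where a: "1 \<le> a" "X a \<omega> \<in> A" using visits_class[OF class_open[OF A(1)] _ n, of \<omega>] W by auto
      obtain b where b: "1 \<le> b" "X b \<omega> \<in> B" using visits_class[OF class_open[OF B(1)] _ n, of \<omega>] W by auto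
      consider "a < b" | "b < a" | "a = b" by linarith
      then show False
      proof cases
        case 1
        then show False using leads_toI[OF A(1) B(1) a(2) b(2) arr] a(1) inc(1) by simp
      next
        case 2
        then show False using leads_toI[OF B(1) A(1) b(2) a(2) arr] b(1) inc(2) by simp
      next
        case 3
        then show False using class_disjoint[OF A(1) B(1) a(2)] b(2) ne by simp
      qed
    qed
  qed
qed

lemma orderly_admissible:
  assumes "\<mu> \<in> admissible \<rho>" "measure \<mu> (\<Union> (comm_classes \<rho>)) = 1"
  shows "orderly \<mu>"
  unfolding orderly_def
proof (intro conjI ballI)
  show "\<mu> \<in> prob_measures" using assms(1) by (simp add: admissible_def)
  show "init_leads_to \<rho> A" if "A \<in> charged_classes \<rho> \<mu>" for A
    using assms(1) that by (simp add: admissible_def)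
  fix A B assume AB: "A \<in> charged_classes \<rho> \<mu>" "B \<in> charged_classes \<rho> \<mu>"
  have "total_on (charged_classes \<rho> \<mu>)
       {(A, B). A \<in> charged_classes \<rho> \<mu> \<and> B \<in> charged_classes \<rho> \<mu> \<and> leads_to \<rho> A B}"
    using assms(1) by (simp add: admissible_def linear_order_on_def)
  then show "leads_to \<rho> A B \<or> leads_to \<rho> B A"
    using AB leads_to_refl by (cases "A = B") (auto simp: total_on_def charged_classes_def)
qed (rule assms(2))

text \<open>The preceding lemmas exclude failure of absolute continuity, of reachability and of
  comparability. Full mass on the classes gives the support condition, and the remaining order
  axioms hold for all classes.\<close>

lemma upper_rate_not_admissible:
  assumes mu: "\<mu> \<in> prob_measures" and C: "measure \<mu> (\<Union> (comm_classes \<rho>)) = 1"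
    and na: "\<mu> \<notin> admissible \<rho>"
  shows "upper_rate \<mu> = -\<infinity>"
proof (rule ccontr)
  assume neg: "upper_rate \<mu> \<noteq> -\<infinity>"
  interpret mu: prob_space \<mu> using mu by (rule prob_measuresD)
  note smu = prob_measuresD(2)[OF mu]
  let ?S = "charged_classes \<rho> \<mu>"
  have cl: "A \<in> comm_classes \<rho>" if "A \<in> ?S" for A using that by (simp add: charged_classes_def)
  have ac: "absolutely_continuous lborel \<mu>" using upper_rate_not_ac[OF mu] neg by blast
  have init: "\<forall>A\<in>?S. init_leads_to \<rho> A" using upper_rate_not_init[OF mu] neg by blast
  have tot: "leads_to \<rho> A B \<or> leads_to \<rho> B A" if "A \<in> ?S" "B \<in> ?S" for A B
    using upper_rate_incomparable[OF mu that] neg by blast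
  have supp: "measure_support \<mu> \<subseteq> closure (\<Union> (comm_classes \<rho>))"
  proof
    fix x assume x: "x \<in> measure_support \<mu>"
    show "x \<in> closure (\<Union> (comm_classes \<rho>))"
    proof (rule ccontr)
      assume "x \<notin> closure (\<Union> (comm_classes \<rho>))"
      then have "x \<in> - closure (\<Union> (comm_classes \<rho>))" by simp
      moreover have "open (- closure (\<Union> (comm_classes \<rho>)))" by (rule open_Compl) simp
      ultimately have pos: "emeasure \<mu> (- closure (\<Union> (comm_classes \<rho>))) > 0"
        using x unfolding measure_support_def by blast
      have oC: "open (\<Union> (comm_classes \<rho>))" using class_open by auto
      have "measure \<mu> (- closure (\<Union> (comm_classes \<rho>))) + measure \<mu> (\<Union> (comm_classes \<rho>)) =
          measure \<mu> (- closure (\<Union> (comm_classes \<rho>)) \<union> \<Union> (comm_classes \<rho>))"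
        using oC closure_subset[of "\<Union> (comm_classes \<rho>)"]
        by (intro mu.finite_measure_Union[symmetric]) (auto simp: smu)
      also have "\<dots> \<le> 1" by (rule mu.prob_le_1)
      finally have "measure \<mu> (- closure (\<Union> (comm_classes \<rho>))) \<le> 0" using C by simp
      then show False using pos by (simp add: mu.emeasure_eq_measure)
    qed
  qed
  have "linear_order_on ?S {(A, B). A \<in> ?S \<and> B \<in> ?S \<and> leads_to \<rho> A B}"
    unfolding linear_order_on_def partial_order_on_def preorder_on_def
  proof (intro conjI)
    show "refl_on ?S {(A, B). A \<in> ?S \<and> B \<in> ?S \<and> leads_to \<rho> A B}"
      using cl leads_to_refl by (auto simp: refl_on_def)
    have tr: "leads_to \<rho> A D" if "A \<in> ?S" "B \<in> ?S" "leads_to \<rho> A B" "D \<in> ?S" "leads_to \<rho> B D" for A B D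
      using that(3,5) by (rule leads_to_trans[OF cl[OF that(1)] cl[OF that(2)] cl[OF that(4)]])
    show "trans {(A, B). A \<in> ?S \<and> B \<in> ?S \<and> leads_to \<rho> A B}"
      unfolding trans_def using tr by fast
    have as: "A = B" if "A \<in> ?S" "B \<in> ?S" "leads_to \<rho> A B" "leads_to \<rho> B A" for A B
      using that(3,4) by (rule leads_to_antisym[OF cl[OF that(1)] cl[OF that(2)]])
    show "antisym {(A, B). A \<in> ?S \<and> B \<in> ?S \<and> leads_to \<rho> A B}"
      unfolding antisym_def using as by fast
    show "total_on ?S {(A, B). A \<in> ?S \<and> B \<in> ?S \<and> leads_to \<rho> A B}"
      using tot by (auto simp: total_on_def)
  qed auto
  then have "\<mu> \<in> admissible \<rho>" using mu ac supp init by (simp add: admissible_def)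
  then show False using na by simp
qed

section \<open>The weak large deviation principle\<close>

lemma upper_le_lower:
  assumes "orderly \<mu>"
  shows "upper_rate \<mu> \<le> lower_rate \<mu>"
proof (rule ccontr)
  assume "\<not> ?thesis"
  then obtain s where s: "lower_rate \<mu> < ereal s" "ereal s < upper_rate \<mu>"
    using ereal_dense2[of "lower_rate \<mu>" "upper_rate \<mu>"] by (auto simp: not_le)
  have mu: "\<mu> \<in> prob_measures" using assms by (simp add: orderly_def)
  have eq: "mixture (1 / 2) \<mu> \<mu> = \<mu>" by (rule mixture_self[OF mu]) simp
  have "ereal (1 / 2 * s + (1 - 1 / 2) * s) \<le> lower_rate (mixture (1 / 2) \<mu> \<mu>)"
    using s(2) assms by (intro lower_rate_mixture mu) (auto simp: eq)
  also have "1 / 2 * s + (1 - 1 / 2) * s = s" by simp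
  finally show False using s(1) by (simp add: eq)
qed

text \<open>An open neighbourhood that bounds the local rate at one measure bounds it at all of its
  points.\<close>

lemma lsc_rate_function_lower_rate: "lsc_rate_function (\<lambda>\<mu>. - lower_rate \<mu>)"
  unfolding lsc_rate_function_def
proof (intro conjI ballI allI)
  fix \<mu> :: "'a measure" assume "\<mu> \<in> prob_measures"
  then have "lower_rate \<mu> \<le> 0" using order_trans[OF lower_le_upper upper_rate_nonpos] by blast
  then show "0 \<le> - lower_rate \<mu>" by (simp add: ereal_0_le_uminus_iff)
next
  fix a :: ereal
  show "openin weak_topology {\<mu> \<in> prob_measures. a < - lower_rate \<mu>}"
  proof (subst openin_subopen, intro ballI)
    fix \<mu> assume "\<mu> \<in> {\<mu> \<in> prob_measures. a < - lower_rate \<mu>}"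
    then have mu: "\<mu> \<in> prob_measures" "lower_rate \<mu> < - a"
      by (auto simp: ereal_less_uminus_reorder)
    then obtain V where V: "openin weak_topology V" "\<mu> \<in> V" "liminf (log_rate M X V) < - a"
      by (auto simp: lower_rate_def INF_less_iff)
    have "V \<subseteq> {\<mu> \<in> prob_measures. a < - lower_rate \<mu>}"
    proof
      fix \<nu> assume nu: "\<nu> \<in> V"
      have "lower_rate \<nu> \<le> liminf (log_rate M X V)" unfolding lower_rate_def using V nu by (intro INF_lower) auto
      with V(3) have "lower_rate \<nu> < - a" by simp
      moreover have "\<nu> \<in> prob_measures" using openin_subset[OF V(1)] nu by (auto simp: topspace_weak_topology)
      ultimately show "\<nu> \<in> {\<mu> \<in> prob_measures. a < - lower_rate \<mu>}" by (simp add: ereal_less_uminus_reorder)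
    qed
    then show "\<exists>T. openin weak_topology T \<and> \<mu> \<in> T \<and> T \<subseteq> {\<mu> \<in> prob_measures. a < - lower_rate \<mu>}"
      using V by blast
  qed
qed

text \<open>The lower bound is immediate, since an open set is a neighbourhood of its points. For a
  compact set, finitely many neighbourhoods with exponent \<open>r'\<close> cover it, and equality
  of the local rates turns this into a bound by the same rate function.\<close>

lemma weak_LDP_lower_rate:
  assumes eq: "\<And>\<mu>. \<mu> \<in> prob_measures \<Longrightarrow> upper_rate \<mu> \<le> lower_rate \<mu>"
  shows "weak_LDP M X (\<lambda>\<mu>. - lower_rate \<mu>)"
  unfolding weak_LDP_def
proof (intro conjI allI impI)
  fix U :: "'a measure set" assume U: "openin weak_topology U"
  have "- liminf (log_rate M X U) \<le> - lower_rate \<mu>" if "\<mu> \<in> U" for \<mu>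
    unfolding lower_rate_def ereal_minus_le_minus using U that by (intro INF_lower) auto
  then have "- liminf (log_rate M X U) \<le> (INF \<mu>\<in>U. - lower_rate \<mu>)" by (rule INF_greatest)
  then show "- (INF \<mu>\<in>U. - lower_rate \<mu>) \<le> liminf (log_rate M X U)"
    by (simp add: ereal_uminus_le_reorder)
next
  fix F :: "'a measure set" assume F: "compactin weak_topology F"
  have Fp: "F \<subseteq> prob_measures" using compactin_subset_topspace[OF F] by (simp add: topspace_weak_topology)
  define J where "J = - (INF \<mu>\<in>F. - lower_rate \<mu>)"
  have J: "upper_rate \<mu> \<le> J" if mu: "\<mu> \<in> F" for \<mu>
  proof -
    have "(INF \<mu>\<in>F. - lower_rate \<mu>) \<le> - lower_rate \<mu>" using mu by (rule INF_lower)
    then have "- (- lower_rate \<mu>) \<le> J" unfolding J_def by (simp only: ereal_minus_le_minus)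
    moreover have "upper_rate \<mu> \<le> lower_rate \<mu>" by (rule eq[OF subsetD[OF Fp mu]])
    ultimately show ?thesis by simp
  qed
  have "limsup (log_rate M X F) \<le> J"
  proof (rule ccontr)
    assume "\<not> ?thesis"
    then have "J < limsup (log_rate M X F)" by simp
    from ereal_dense2[OF this] obtain r where r: "J < ereal r" "ereal r < limsup (log_rate M X F)" by blast
    from ereal_dense2[OF r(1)] obtain r' where r': "J < ereal r'" "r' < r" by auto
    have "\<forall>\<mu>\<in>F. \<exists>V. openin weak_topology V \<and> \<mu> \<in> V \<and> (\<forall>\<^sub>F n in sequentially. prob (emp_event V n) \<le> exp (real n * r'))"
    proof
      fix \<mu> assume mu: "\<mu> \<in> F"
      obtain V where "openin weak_topology V" "\<mu> \<in> V" "\<forall>\<^sub>F n in sequentially. prob (emp_event V n) \<le> exp (real n * r')"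
        by (rule upper_rate_lessD[OF le_less_trans[OF J[OF mu] r'(1)]])
      then show "\<exists>V. openin weak_topology V \<and> \<mu> \<in> V \<and> (\<forall>\<^sub>F n in sequentially. prob (emp_event V n) \<le> exp (real n * r'))"
        by (intro exI conjI)
    qed
    from bchoice[OF this] obtain V where
      "\<forall>\<mu>\<in>F. openin weak_topology (V \<mu>) \<and> \<mu> \<in> V \<mu> \<and> (\<forall>\<^sub>F n in sequentially. prob (emp_event (V \<mu>) n) \<le> exp (real n * r'))"
      by (rule exE)
    then have V: "openin weak_topology (V \<mu>)" "\<mu> \<in> V \<mu>" "\<forall>\<^sub>F n in sequentially. prob (emp_event (V \<mu>) n) \<le> exp (real n * r')"
      if "\<mu> \<in> F" for \<mu>
      using that by simp_all
    have "\<forall>U\<in>V ` F. openin weak_topology U" "F \<subseteq> \<Union> (V ` F)" using V(1,2) by auto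
    then obtain \<F> where \<F>: "finite \<F>" "\<F> \<subseteq> V ` F" "F \<subseteq> \<Union> \<F>"
      using F[unfolded compactin_def, THEN conjunct2, rule_format, of "V ` F"] by auto
    obtain T where T: "T \<subseteq> F" "finite T" "\<F> = V ` T"
      using finite_subset_image[OF \<F>(1,2)] by blast
    then have T: "finite T" "T \<subseteq> F" "F \<subseteq> (\<Union>\<mu>\<in>T. V \<mu>)" using \<F>(3) by auto
    have "\<forall>\<^sub>F n in sequentially. \<forall>\<mu>\<in>T. prob (emp_event (V \<mu>) n) \<le> exp (real n * r')"
      using T(2) V(3) by (intro eventually_ball_finite[OF T(1)]) auto
    \<comment> \<open>With power 0 only the number of covering sets remains to be absorbed.\<close>
    moreover have "\<forall>\<^sub>F n in sequentially. (real ((n + 1)\<^sup>2 * 1)) ^ 0 * real (card T) * exp (real n * r') \<le> exp (real n * r)"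
      by (rule subexponential[OF r'(2)])
    ultimately have "\<forall>\<^sub>F n in sequentially. log_rate M X F n \<le> ereal r"
      using eventually_ge_at_top[of 1]
    proof eventually_elim
      case (elim n)
      have ev: "emp_event (V \<mu>) n \<in> events" if "\<mu> \<in> T" for \<mu>
        using V(1) T(2) that elim(3) by (intro emp_event_measurable) auto
      have "prob (emp_event F n) \<le> prob (\<Union>\<mu>\<in>T. emp_event (V \<mu>) n)"
      \<comment> \<open>This avoids proving measurability of the event for \<open>F\<close>: outside
        the sigma-algebra \<open>measure\<close> is 0 by convention.\<close>
      proof (cases "emp_event F n \<in> events")
        case True
        then show ?thesis using T(3) ev T(1) by (intro finite_measure_mono) auto
      next
        case False
        then show ?thesis by (simp add: measure_notin_sets)
      qed
      also have "\<dots> \<le> (\<Sum>\<mu>\<in>T. prob (emp_event (V \<mu>) n))"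
        using T(1) ev by (intro finite_measure_subadditive_finite) auto
      also have "\<dots> \<le> (\<Sum>\<mu>\<in>T. exp (real n * r'))" using elim(1) by (intro sum_mono) auto
      also have "\<dots> \<le> exp (real n * r)" using elim(2) by simp
      finally show ?case using elim(3) by (simp add: log_rate_le_iff)
    qed
    then have "limsup (log_rate M X F) \<le> ereal r" by (rule Limsup_bounded)
    then show False using r(2) by simp
  qed
  then show "limsup (log_rate M X F) \<le> - (INF \<mu>\<in>F. - lower_rate \<mu>)" unfolding J_def .
qed

end

section \<open>Convex combinations of extended real rates\<close>

lemma ereal_convex_upper:
  fixes u1 u2 w :: ereal
  assumes t: "0 < t" "t < 1" and u: "u1 \<le> 0" "u2 \<le> 0"
    and le: "\<And>s1 s2. ereal s1 < u1 \<Longrightarrow> ereal s2 < u2 \<Longrightarrow> ereal (t * s1 + (1 - t) * s2) \<le> w"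
  shows "- w \<le> ereal t * - u1 + ereal (1 - t) * - u2"
proof (cases u1)
  case PInf
  then show ?thesis using u by simp
next
  case MInf
  \<comment> \<open>The other term is nonnegative, so the infinite one makes the right-hand side
    infinite.\<close>
  have "0 \<le> ereal (1 - t) * - u2" using t u by (cases u2) (auto simp: mult_le_0_iff)
  then show ?thesis using MInf t by (cases "ereal (1 - t) * - u2") auto
next
  case 1: (real v1)
  show ?thesis
  proof (cases u2)
    case PInf
    then show ?thesis using u by simp
  next
    case MInf
    then show ?thesis using 1 t by simp
  next
    case 2: (real v2)
    have "ereal (t * v1 + (1 - t) * v2) \<le> w"
    proof (rule ereal_le_epsilon2)
      fix e :: real assume e: "0 < e"
      have "ereal (t * (v1 - e) + (1 - t) * (v2 - e)) \<le> w" using e 1 2 by (intro le) auto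
      moreover have "t * (v1 - e) + (1 - t) * (v2 - e) = t * v1 + (1 - t) * v2 - e" by (simp add: algebra_simps)
      ultimately show "ereal (t * v1 + (1 - t) * v2) \<le> w + ereal e" by (cases w) auto
    qed
    then show ?thesis using 1 2 by (cases w) auto
  qed
qed

lemma ereal_convex_lower:
  fixes u1 u2 w :: ereal
  assumes t: "0 < t" "t < 1" and u: "u1 \<le> 0" "u2 \<le> 0"
    and le: "\<And>r1 r2 e. u1 < ereal r1 \<Longrightarrow> u2 < ereal r2 \<Longrightarrow> 0 < e \<Longrightarrow> w \<le> ereal (t * r1 + (1 - t) * r2 + e)"
  shows "ereal t * - u1 + ereal (1 - t) * - u2 \<le> - w"
proof -
  have inf: "w = -\<infinity>" if "u1 = -\<infinity> \<or> u2 = -\<infinity>"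
  proof -
    have "w \<le> ereal B" for B
    proof -
      have pos: "u1 < ereal 1" "u2 < ereal 1" using u by (auto intro: le_less_trans)
      show ?thesis
      proof (cases "u1 = -\<infinity>")
        case True
        \<comment> \<open>The first term equals \<open>B - 2\<close>, and the other two add less
          than 2.\<close>
        have "w \<le> ereal (t * ((B - 2) / t) + (1 - t) * 1 + 1)" using True pos by (intro le) auto
        also have "\<dots> \<le> ereal B" using t by simp
        finally show ?thesis .
      next
        case False
        then have "u2 = -\<infinity>" using that by simp
        then have "w \<le> ereal (t * 1 + (1 - t) * ((B - 2) / (1 - t)) + 1)" using pos by (intro le) auto
        also have "\<dots> \<le> ereal B" using t by simp
        finally show ?thesis .
      qed
    qed
    then show ?thesis by (metis ereal_bot)
  qed
  show ?thesis
  proof (cases "u1 = -\<infinity> \<or> u2 = -\<infinity>")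
    case True
    then show ?thesis using inf by simp
  next
    case False
    then obtain v1 v2 where v: "u1 = ereal v1" "u2 = ereal v2" using u by (cases u1; cases u2) auto
    have "w \<le> ereal (t * v1 + (1 - t) * v2)"
    proof (rule ereal_le_epsilon2)
      fix e :: real assume e: "0 < e"
      have "w \<le> ereal (t * (v1 + e / 2) + (1 - t) * (v2 + e / 2) + e / 2)" using e v by (intro le) auto
      also have "t * (v1 + e / 2) + (1 - t) * (v2 + e / 2) + e / 2 = t * v1 + (1 - t) * v2 + e" by (simp add: field_simps)
      finally show "w \<le> ereal (t * v1 + (1 - t) * v2) + ereal e" by simp
    qed
    then show ?thesis using v by (cases w) auto
  qed
qed

theorem theorem1p7:
  fixes \<beta> :: "'a::euclidean_space measure"
    and p :: "'a \<Rightarrow> 'a measure"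
    and \<rho> :: "'a option \<Rightarrow> 'a \<Rightarrow> real"
    and M :: "'w measure"
    and X :: "nat \<Rightarrow> 'w \<Rightarrow> 'a"
  assumes beta: "\<beta> \<in> prob_measures"
    and kernel: "p \<in> borel \<rightarrow>\<^sub>M prob_algebra borel"
    and rho_nonneg: "\<And>x y. 0 \<le> \<rho> x y"
    and rho_measurable: "(\<lambda>(x, y). \<rho> x y) \<in> borel_measurable (borel \<Otimes>\<^sub>M borel)"
    and rho_density: "\<And>x. ext_kernel \<beta> p x = density lborel (\<lambda>y. ennreal (\<rho> x y))"
    and chain: "markov_chain M X \<beta> p"
    and i_lsc: "lsc (\<lambda>(x, y). \<rho> x y)"
    and i_bounded: "bounded (range (\<lambda>(x, y). \<rho> x y))"
    and ii: "emeasure lborel (frontier (\<Union> (comm_classes \<rho>))) = 0"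
    and iii: "\<And>\<mu>. \<mu> \<in> prob_measures \<Longrightarrow> measure \<mu> (\<Union> (comm_classes \<rho>)) < 1 \<Longrightarrow>
      \<exists>V. openin weak_topology V \<and> \<mu> \<in> V \<and> log_rate M X V \<longlonglongrightarrow> -\<infinity>"
  shows "\<exists>I :: 'a measure \<Rightarrow> ereal.
    lsc_rate_function I \<and> weak_LDP M X I \<and>
    (\<forall>\<mu>\<in>prob_measures. \<mu> \<notin> admissible \<rho> \<longrightarrow> I \<mu> = \<infinity>) \<and>
    (\<forall>\<mu>1\<in>admissible \<rho>. \<forall>\<mu>2\<in>admissible \<rho>. \<forall>t\<in>{0..1}.
       mixture t \<mu>1 \<mu>2 \<in> admissible \<rho> \<longrightarrow>
       I (mixture t \<mu>1 \<mu>2) \<le> ereal t * I \<mu>1 + ereal (1 - t) * I \<mu>2) \<and>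
    (\<forall>\<mu>1\<in>admissible \<rho>. \<forall>\<mu>2\<in>admissible \<rho>. \<forall>t\<in>{0..1}.
       mixture t \<mu>1 \<mu>2 \<in> admissible \<rho> \<longrightarrow>
       \<not> (\<exists>A\<in>comm_classes \<rho>. measure \<mu>1 A * measure \<mu>2 A > 0) \<longrightarrow>
       I (mixture t \<mu>1 \<mu>2) = ereal t * I \<mu>1 + ereal (1 - t) * I \<mu>2)"
proof -
  have X: "X n \<in> M \<rightarrow>\<^sub>M borel" if "n \<ge> 1" for n
    using chain that by (simp add: markov_chain_def)
  have M: "prob_space M" and X1: "distr M borel (X 1) = \<beta>"
    using chain by (simp_all add: markov_chain_def)
  interpret prob_space M by (rule M)
  obtain R where "\<forall>z\<in>range (\<lambda>(x, y). \<rho> x y). norm z \<le> R"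
    using i_bounded unfolding bounded_iff by blast
  then have R: "\<rho> x y \<le> R" for x y
    by (auto intro: order_trans[OF abs_ge_self])
  define Y where "Y t = (\<lambda>\<omega>. if t = 0 then None else Some (X t \<omega>))" for t
  have ext_prob: "prob_space (ext_kernel \<beta> p x)" for x
    using prob_measuresD(1)[OF beta] prob_measuresD(1)[OF measurable_space[OF kernel]]
    by (cases x) (auto simp: ext_kernel_def)
  have meas_rho[measurable]: "(\<lambda>y. \<rho> x y) \<in> borel_measurable borel" for x
    using measurable_compose[OF measurable_Pair[OF measurable_const[of x borel borel] measurable_ident] rho_measurable]
    by simp
  have ext_emeasure: "emeasure (ext_kernel \<beta> p x) B = (\<integral>\<^sup>+y. ennreal (\<rho> x y) * indicator B y \<partial>lborel)"
    if "B \<in> sets borel" for x B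
    unfolding rho_density using that by (intro emeasure_density) auto
  interpret density_chain \<rho> R M X Y
  proof
    show "(\<integral>\<^sup>+y. ennreal (\<rho> x y) \<partial>lborel) = 1" for x
      using ext_emeasure[of UNIV x] prob_space.emeasure_space_1[OF ext_prob[of x]]
      by (simp add: rho_density[of x] )
    fix t A B assume A: "A \<in> sets (past M X t)" and B[measurable]: "B \<in> sets (borel :: 'a measure)"
    have sub: "subalgebra M (past M X t)" by (rule past_subalgebra[OF X])
    then have AM[measurable]: "A \<in> sets M" using A by (auto simp: subalgebra_def)
    show "emeasure M {\<omega>\<in>A. X (Suc t) \<omega> \<in> B} =
      (\<integral>\<^sup>+\<omega>. indicator A \<omega> * (\<integral>\<^sup>+y. ennreal (\<rho> (Y t \<omega>) y) * indicator B y \<partial>lborel) \<partial>M)"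
    proof (cases "t = 0")
      case True
      \<comment> \<open>Without earlier coordinates the past is the trivial sigma-algebra.\<close>
      have "A = {} \<or> A = space M"
        using A True by (auto simp: sets_past sigma_sets_empty_eq)
      moreover have "emeasure M {\<omega>\<in>space M. X 1 \<omega> \<in> B} = (\<integral>\<^sup>+y. ennreal (\<rho> None y) * indicator B y \<partial>lborel)"
      proof -
        have "emeasure M {\<omega>\<in>space M. X 1 \<omega> \<in> B} = emeasure (distr M borel (X 1)) B"
          using X[of 1] by (subst emeasure_distr) (auto intro!: arg_cong[where f="emeasure M"])
        then show ?thesis using ext_emeasure[OF B, of None] by (simp only: X1 ext_kernel_def option.case)
      qed
      ultimately show ?thesis
        using True by (auto simp: Y_def nn_integral_cmult emeasure_space_1 cong: nn_integral_cong_simp)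
    next
      case False
      then have t: "t \<ge> 1" by simp
      interpret fs: finite_measure_subalgebra M "past M X t"
        by unfold_locales (rule sub)
      let ?E = "X (Suc t) -` B \<inter> space M"
      have E[measurable]: "?E \<in> sets M" using X[of "Suc t"] B by (intro measurable_sets) auto
      have pm[measurable]: "(\<lambda>\<omega>. measure (p (X t \<omega>)) B) \<in> borel_measurable M"
        unfolding measure_def
        by (intro borel_measurable_enn2real measurable_compose[OF _ measurable_emeasure_subprob_algebra[OF B]]
            measurable_compose[OF X[OF t] measurable_prob_algebraD[OF kernel]])
      have p1: "measure (p x) B \<le> 1" "emeasure (p x) B = ennreal (measure (p x) B)" for x
        using prob_space.prob_le_1[OF ext_prob[of "Some x"]] finite_measure.emeasure_eq_measure[OF prob_space.finite_measure[OF ext_prob[of "Some x"]]]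
        by (simp_all add: ext_kernel_def)
      \<comment> \<open>Integrated over the past event \<open>A\<close>, this almost sure identity
        becomes the identity of measures that \<open>one_step\<close> demands.\<close>
      have ce: "AE \<omega> in M. real_cond_exp M (past M X t) (indicator ?E) \<omega> = measure (p (X t \<omega>)) B"
        using chain t B by (simp add: markov_chain_def)
      have "{\<omega>\<in>A. X (Suc t) \<omega> \<in> B} = A \<inter> ?E" using sets.sets_into_space[OF AM] by auto
      then have "prob {\<omega>\<in>A. X (Suc t) \<omega> \<in> B} = (\<integral>\<omega>\<in>A. indicator ?E \<omega> \<partial>M)"
        using AM E by (simp add: set_lebesgue_integral_def indicator_inter_arith[symmetric])
      also have "\<dots> = (\<integral>\<omega>\<in>A. real_cond_exp M (past M X t) (indicator ?E) \<omega> \<partial>M)"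
        by (rule fs.real_cond_exp_intA[OF _ A]) (use E in \<open>auto simp: emeasure_eq_measure\<close>)
      also have "\<dots> = (\<integral>\<omega>. indicator A \<omega> * measure (p (X t \<omega>)) B \<partial>M)"
        unfolding set_lebesgue_integral_def
        by (rule integral_cong_AE) (use ce in \<open>auto intro: measurable_from_subalg[OF sub]\<close>)
      finally have pr: "prob {\<omega>\<in>A. X (Suc t) \<omega> \<in> B} = (\<integral>\<omega>. indicator A \<omega> * measure (p (X t \<omega>)) B \<partial>M)" .
      have "emeasure M {\<omega>\<in>A. X (Suc t) \<omega> \<in> B} = ennreal (\<integral>\<omega>. indicator A \<omega> * measure (p (X t \<omega>)) B \<partial>M)"
        by (simp only: emeasure_eq_measure pr)
      also have "\<dots> = (\<integral>\<^sup>+\<omega>. ennreal (indicator A \<omega> * measure (p (X t \<omega>)) B) \<partial>M)"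
      proof (rule nn_integral_eq_integral[symmetric])
        show "integrable M (\<lambda>\<omega>. indicator A \<omega> * measure (p (X t \<omega>)) B)"
          by (rule integrable_const_bound[where B = 1]) (use p1(1) in \<open>auto simp: indicator_def\<close>)
      qed (simp add: indicator_def)
      also have "\<dots> = (\<integral>\<^sup>+\<omega>. indicator A \<omega> * emeasure (ext_kernel \<beta> p (Y t \<omega>)) B \<partial>M)"
        using t p1(2) by (intro nn_integral_cong) (auto simp: Y_def ext_kernel_def indicator_def)
      finally show ?thesis by (simp only: ext_emeasure[OF B])
    qed
  qed (use rho_nonneg rho_measurable i_lsc R X in \<open>auto simp: Y_def\<close>)
  let ?C = "\<Union> (comm_classes \<rho>)"
  have oC: "?C \<in> sets borel" using class_open by (intro borel_open) auto
  have C1: "measure \<mu> ?C \<le> 1" if "\<mu> \<in> prob_measures" for \<mu>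
    by (rule prob_space.prob_le_1[OF prob_measuresD(1)[OF that]])
  \<comment> \<open>Here (iii) enters: only measures with full mass on the classes can have a finite
    rate.\<close>
  have inf: "upper_rate \<mu> = -\<infinity>" if mu: "\<mu> \<in> prob_measures" and lt: "measure \<mu> ?C \<noteq> 1" for \<mu>
  proof -
    have "measure \<mu> ?C < 1" using C1[OF mu] lt by simp
    from iii[OF mu this] obtain V where V: "openin weak_topology V" "\<mu> \<in> V" "log_rate M X V \<longlonglongrightarrow> -\<infinity>" by blast
    have "limsup (log_rate M X V) = -\<infinity>" by (rule lim_imp_Limsup[OF _ V(3)]) simp
    moreover have "upper_rate \<mu> \<le> limsup (log_rate M X V)"
      unfolding upper_rate_def using V by (intro INF_lower) auto
    ultimately show ?thesis by simp
  qed
  have na: "upper_rate \<mu> = -\<infinity>" if "\<mu> \<in> prob_measures" "\<mu> \<notin> admissible \<rho>" for \<mu>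
    using inf[OF that(1)] upper_rate_not_admissible[OF that(1) _ that(2)] by blast
  \<comment> \<open>When the upper rate is not minus infinity, \<mu> is admissible with full mass on
    the classes, so \<open>upper_le_lower\<close> applies.\<close>
  have le: "upper_rate \<mu> \<le> lower_rate \<mu>" if mu: "\<mu> \<in> prob_measures" for \<mu>
  proof (cases "upper_rate \<mu> = -\<infinity>")
    case False
    then show ?thesis using inf[OF mu] na[OF mu] orderly_admissible upper_le_lower by blast
  qed simp
  have eq: "lower_rate \<mu> = upper_rate \<mu>" if "\<mu> \<in> prob_measures" for \<mu>
    using le[OF that] lower_le_upper[of \<mu>] by (rule antisym[rotated])
  define I where "I \<mu> = - lower_rate \<mu>" for \<mu> :: "'a measure"
  have Iu: "I \<mu> = - upper_rate \<mu>" if "\<mu> \<in> prob_measures" for \<mu> using eq[OF that] by (simp add: I_def)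
  have adm: "\<mu> \<in> prob_measures" if "\<mu> \<in> admissible \<rho>" for \<mu> using that by (simp add: admissible_def)
  have I0: "0 \<le> I \<mu>" if "\<mu> \<in> prob_measures" for \<mu>
    using upper_rate_nonpos[OF that] by (simp add: Iu[OF that] ereal_0_le_uminus_iff)
  have ends: "mixture 0 \<mu>1 \<mu>2 = \<mu>2" "mixture 1 \<mu>1 \<mu>2 = \<mu>1" if mu: "\<mu>1 \<in> prob_measures" "\<mu>2 \<in> prob_measures" for \<mu>1 \<mu>2 :: "'a measure"
    using prob_measuresD(2)[OF mu(1)] prob_measuresD(2)[OF mu(2)]
    by (auto intro!: measure_eqI simp: emeasure_mixture[OF mu])
  \<comment> \<open>At the endpoints the term with weight 0 vanishes even if its rate is infinite,
    by the convention for 0 times infinity.\<close>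
  have edge: "I (mixture t \<mu>1 \<mu>2) = ereal t * I \<mu>1 + ereal (1 - t) * I \<mu>2"
    if mu: "\<mu>1 \<in> prob_measures" "\<mu>2 \<in> prob_measures" and t: "t = 0 \<or> t = 1" for \<mu>1 \<mu>2 t
    using t ends[OF mu] by (auto simp: zero_ereal_def[symmetric] one_ereal_def[symmetric])
  \<comment> \<open>If the mixture misses mass on the classes, so does one of its components, and
    both sides are infinite by (iii).\<close>
  have sing: "I (mixture t \<mu>1 \<mu>2) = \<infinity>" "ereal t * I \<mu>1 + ereal (1 - t) * I \<mu>2 = \<infinity>"
    if mu: "\<mu>1 \<in> prob_measures" "\<mu>2 \<in> prob_measures" and t: "0 < t" "t < 1" and C: "measure (mixture t \<mu>1 \<mu>2) ?C \<noteq> 1" for \<mu>1 \<mu>2 t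
  proof -
    show "I (mixture t \<mu>1 \<mu>2) = \<infinity>"
      using mixture_prob[OF mu, of t] t inf[OF _ C] by (simp add: Iu)
    have "measure \<mu>1 ?C \<noteq> 1 \<or> measure \<mu>2 ?C \<noteq> 1"
      using C measure_mixture[OF mu _ oC, of t] t by auto
    then have "I \<mu>1 = \<infinity> \<or> I \<mu>2 = \<infinity>" using inf[OF mu(1)] inf[OF mu(2)] Iu[OF mu(1)] Iu[OF mu(2)] by auto
    then show "ereal t * I \<mu>1 + ereal (1 - t) * I \<mu>2 = \<infinity>"
      using t I0[OF mu(1)] I0[OF mu(2)] by (cases "I \<mu>1"; cases "I \<mu>2") auto
  qed
  have convex: "I (mixture t \<mu>1 \<mu>2) \<le> ereal t * I \<mu>1 + ereal (1 - t) * I \<mu>2"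
    if a: "\<mu>1 \<in> admissible \<rho>" "\<mu>2 \<in> admissible \<rho>" "t \<in> {0..1}" "mixture t \<mu>1 \<mu>2 \<in> admissible \<rho>" for \<mu>1 \<mu>2 t
  proof (cases "0 < t \<and> t < 1")
    case False
    then show ?thesis using edge[OF adm[OF a(1)] adm[OF a(2)], of t] a(3) by force
  next
    case True
    show ?thesis
    proof (cases "measure (mixture t \<mu>1 \<mu>2) ?C = 1")
      case False
      then show ?thesis using sing[OF adm[OF a(1)] adm[OF a(2)], of t] True by simp
    next
      case C: True
      have "- lower_rate (mixture t \<mu>1 \<mu>2) \<le> ereal t * - upper_rate \<mu>1 + ereal (1 - t) * - upper_rate \<mu>2"
        using True by (intro ereal_convex_upper upper_rate_nonpos adm a(1,2) lower_rate_mixture orderly_admissible[OF a(4) C]) auto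
      then show ?thesis unfolding Iu[OF adm[OF a(1)]] Iu[OF adm[OF a(2)]] by (simp only: I_def)
    qed
  qed
  have affine: "ereal t * I \<mu>1 + ereal (1 - t) * I \<mu>2 \<le> I (mixture t \<mu>1 \<mu>2)"
    if a: "\<mu>1 \<in> admissible \<rho>" "\<mu>2 \<in> admissible \<rho>" "t \<in> {0..1}" "mixture t \<mu>1 \<mu>2 \<in> admissible \<rho>"
      and d: "\<not> (\<exists>A\<in>comm_classes \<rho>. measure \<mu>1 A * measure \<mu>2 A > 0)" for \<mu>1 \<mu>2 t
  proof (cases "0 < t \<and> t < 1")
    case False
    then show ?thesis using edge[OF adm[OF a(1)] adm[OF a(2)], of t] a(3) by force
  next
    case True
    show ?thesis
    proof (cases "measure (mixture t \<mu>1 \<mu>2) ?C = 1")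
      case False
      then show ?thesis using sing[OF adm[OF a(1)] adm[OF a(2)], of t] True by simp
    next
      case C: True
      have "ereal t * - upper_rate \<mu>1 + ereal (1 - t) * - upper_rate \<mu>2 \<le> - upper_rate (mixture t \<mu>1 \<mu>2)"
        using True d by (intro ereal_convex_lower upper_rate_nonpos adm a(1,2) upper_rate_mixture orderly_admissible[OF a(4) C]) auto
      then show ?thesis by (simp only: Iu[OF adm[OF a(1)]] Iu[OF adm[OF a(2)]] Iu[OF adm[OF a(4)]])
    qed
  qed
  have "lsc_rate_function I" using lsc_rate_function_lower_rate by (simp add: I_def[abs_def])
  moreover have "weak_LDP M X I" using weak_LDP_lower_rate[OF le] by (simp add: I_def[abs_def])
  moreover have "I \<mu> = \<infinity>" if "\<mu> \<in> prob_measures" "\<mu> \<notin> admissible \<rho>" for \<mu>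
    using na[OF that] by (simp add: Iu[OF that(1)])
  ultimately show ?thesis
    using convex affine by (intro exI[of _ I]) (auto intro: antisym)
qed


end
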